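(* For every $d\in\mathbb{N}$ and $\epsilon>0$ there is $r(d,\epsilon)\in\mathbb{N}$ such that for every integer $r\ge r(d,\epsilon)$ and every sufficiently large $n$ (depending on $d,\epsilon,r$) which is a multiple of $d+1$, there is a $(d+1)$-uniform $r$-regular hypergraph $H$ on $n$ vertices with $c(H)\ge c(d)-\epsilon$.
   Context: A hypergraph is $r$-regular if every vertex lies in exactly $r$ hyperedges. For a $(d+1)$-uniform hypergraph $H=(V,E)$, its overlap number $c(H)$ is the largest $c\in(0,1]$ such that for every injective map $f:V\to\mathbb{R}^d$ there exists a point $x\in\mathbb{R}^d$ contained in $\mathrm{conv}(f(e))$ for at least $c|E|$ hyperedges $e\in E$. Let $K_n^{d+1}$ be the complete $(d+1)$-uniform hypergraph on $n$ vertices and $c(d)=\lim_{n\to\infty}c(K_n^{d+1})$ (this limit exists). *)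

theory Defs
  imports "HOL-Analysis.Analysis"
begin

definition uniform_hypergraph :: "nat \<Rightarrow> 'v set \<Rightarrow> 'v set set \<Rightarrow> bool" where
  "uniform_hypergraph k V E \<longleftrightarrow> finite V \<and> (\<forall>e\<in>E. e \<subseteq> V \<and> card e = k)"

definition regular_hypergraph :: "nat \<Rightarrow> 'v set \<Rightarrow> 'v set set \<Rightarrow> bool" where
  "regular_hypergraph r V E \<longleftrightarrow> (\<forall>v\<in>V. card {e \<in> E. v \<in> e} = r)"

definition complete_edges :: "nat \<Rightarrow> 'v set \<Rightarrow> 'v set set" where
  "complete_edges k V = {e. e \<subseteq> V \<and> card e = k}"

definition has_overlap :: "'d::finite itself \<Rightarrow> 'v set \<Rightarrow> 'v set set \<Rightarrow> real \<Rightarrow> bool" where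
  "has_overlap _ V E c \<longleftrightarrow>
     (\<forall>f :: 'v \<Rightarrow> real ^ 'd. inj_on f V \<longrightarrow>
        (\<exists>x. real (card {e \<in> E. x \<in> convex hull (f ` e)}) \<ge> c * real (card E)))"

text \<open>
  The dimension \<open>d\<close> of the target space is \<open>CARD('d)\<close>; it is passed as a type argument.
  The greatest element below exists for every finite hypergraph with nonempty edges, see
  \<open>overlap_number_greatest\<close>; a hypergraph without edges has overlap number \<open>1\<close>.
\<close>

definition overlap_number :: "'d::finite itself \<Rightarrow> 'v set \<Rightarrow> 'v set set \<Rightarrow> real" where
  "overlap_number D V E = (GREATEST c. 0 < c \<and> c \<le> 1 \<and> has_overlap D V E c)"

definition overlap_constant :: "'d::finite itself \<Rightarrow> real" where
  "overlap_constant D =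
     lim (\<lambda>n. overlap_number D {..<n} (complete_edges (CARD('d) + 1) {..<n}))"

lemma overlap_number_greatest:
  fixes V :: "'v set" and D :: "'d::finite itself"
  assumes "finite E" and "{} \<notin> E"
  shows "0 < overlap_number D V E" "overlap_number D V E \<le> 1"
    and "has_overlap D V E (overlap_number D V E)"
    and "\<And>c. 0 < c \<Longrightarrow> c \<le> 1 \<Longrightarrow> has_overlap D V E c \<Longrightarrow> c \<le> overlap_number D V E"
proof -
  let ?P = "\<lambda>c. 0 < c \<and> c \<le> 1 \<and> has_overlap D V E c"
  define N where "N f x = card {e \<in> E. x \<in> convex hull (f ` e)}" for f :: "'v \<Rightarrow> real ^ 'd" and x
  define A where "A = {k. k \<le> card E \<and> (\<forall>f. inj_on f V \<longrightarrow> (\<exists>x. k \<le> N f x))}"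
  have P: "has_overlap D V E c \<longleftrightarrow> (\<forall>f. inj_on f V \<longrightarrow> (\<exists>x. c * real (card E) \<le> real (N f x)))" for c
    by (simp add: has_overlap_def N_def)
  have "\<exists>c. ?P c \<and> (\<forall>y. ?P y \<longrightarrow> y \<le> c)"
  proof (cases "E = {}")
    case True
    then show ?thesis by (intro exI[of _ 1]) (auto simp: has_overlap_def)
  next
    case False
    then obtain e where e: "e \<in> E" by blast
    then obtain v where v: "v \<in> e" using assms(2) by (metis ex_in_conv)
    have cE: "card E > 0" using False assms(1) by (simp add: card_gt_0_iff)
    have "1 \<le> N f (f v)" for f
    proof -
      have "e \<in> {e \<in> E. f v \<in> convex hull (f ` e)}" using e v by (simp add: hull_inc)
      then have "0 < N f (f v)" unfolding N_def using assms(1) by (auto simp: card_gt_0_iff)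
      then show ?thesis by simp
    qed
    then have 1: "1 \<in> A" using cE by (auto simp: A_def)
    have fin: "finite A" by (rule finite_subset[of _ "{..card E}"]) (auto simp: A_def)
    define m where "m = Max A"
    have mA: "m \<in> A" using fin 1 unfolding m_def by (metis Max_in empty_iff)
    have m1: "1 \<le> m" using fin 1 by (simp add: m_def)
    let ?c = "real m / real (card E)"
    have "?P ?c" using mA m1 cE by (auto simp: P A_def)
    moreover have "y \<le> ?c" if y: "?P y" for y
    proof -
      have "nat \<lceil>y * real (card E)\<rceil> \<in> A"
      proof -
        have "y * real (card E) \<le> real (card E)" using y by (simp add: mult_left_le_one_le)
        moreover have "\<exists>x. nat \<lceil>y * real (card E)\<rceil> \<le> N f x" if "inj_on f V" for f
          using y that unfolding P by (metis nat_ceiling_le_eq)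
        ultimately show ?thesis by (simp add: A_def nat_ceiling_le_eq)
      qed
      then have "nat \<lceil>y * real (card E)\<rceil> \<le> m" using fin unfolding m_def by (rule Max_ge[rotated])
      then show ?thesis using cE by (simp add: nat_ceiling_le_eq pos_le_divide_eq)
    qed
    ultimately show ?thesis by blast
  qed
  then obtain c where c: "?P c" "\<And>y. ?P y \<Longrightarrow> y \<le> c" by blast
  have eq: "overlap_number D V E = c"
    unfolding overlap_number_def by (rule Greatest_equality) (use c in auto)
  show "0 < overlap_number D V E" "overlap_number D V E \<le> 1"
    "has_overlap D V E (overlap_number D V E)"
    "\<And>c. 0 < c \<Longrightarrow> c \<le> 1 \<Longrightarrow> has_overlap D V E c \<Longrightarrow> c \<le> overlap_number D V E"
    using c unfolding eq by auto
qed

end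

theory Submission
  imports Defs "HOL-Real_Asymp.Real_Asymp"
begin

text \<open>
  Let \<open>D = d + 1\<close>. Fix points \<open>f v\<close> and let \<open>x\<close> be a point in a fraction \<open>c(K_n)\<close> of all simplices. There is a
  colouring of the vertices with a number of colours depending only on \<open>d\<close> and \<open>\<epsilon>\<close> such that, up to a fraction \<open>\<epsilon>\<close>
  of all \<open>D\<close>-tuples, the colours of a tuple decide whether its simplex contains \<open>x\<close>. Thus the simplices around \<open>x\<close> are
  approximated from inside by a union of colour blocks, and there are only exponentially many pairs of a colouring and
  a set of colour patterns. A union of \<open>r\<close> random perfect matchings has about the right number of edges in one such
  union of blocks except with probability \<open>exp (- C r n)\<close>, so for large \<open>r\<close> some choice works for all of them at once.

  The colouring exists for the sign of every multilinear form \<open>M\<close>, by induction on the arity: write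
  \<open>M (p, ys) = p \<bullet> \<phi> ys\<close>. A bounded random sample of the points \<open>p\<close> spans an arrangement of hyperplanes, each \<open>\<phi> ys\<close>
  lies in a simplicial cone determined by few sample points, and for all but a few \<open>p\<close> the sign of \<open>p \<bullet> _\<close> is constant
  on that cone. Membership in the cone is a condition on signs of multilinear forms of smaller arity. Containment of \<open>x\<close>
  in a simplex is a condition on signs of determinants.

  The numbers \<open>c(K_n)\<close> converge because blowing up the points of a configuration into small clusters
  hardly increases the largest fraction of simplices with a common point.
\<close>

section \<open>Cells of central hyperplane arrangements\<close>

text \<open>The number of colours must not depend on \<open>n\<close>. For fixed dimension,
  \<open>n\<close> labelled points have n^Theta(n) order types, so a union bound over the
  configurations themselves would force \<open>r\<close> to grow like log n. With \<open>K\<close>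
  colours there are only K^n colourings and at most 2^(K^D) pattern sets, which a failure
  probability exp(- C r n) beats for constant \<open>r\<close>. The colouring depends on both
  \<open>f\<close> and \<open>x\<close>; therefore quasirandomness is demanded for all colourings
  before \<open>f\<close> is known. Only lower deviations matter, since the blocks approximate from
  inside. Edges form a set, so different matchings must not share an edge: each new matching avoids
  all earlier ones. This costs a factor exp(\<delta> n) per matching with \<delta> as small as
  desired, hence does not spoil the exponent. Tuples replace \<open>D\<close>-subsets because colour
  blocks are products of colour classes; tuples with a repetition are a fraction tending to
  0.\<close>

lemma cone_caratheodory:
  fixes \<phi> :: "'a::real_vector"
  assumes "finite A" "\<phi> = (\<Sum>a\<in>A. l a *\<^sub>R a)" "\<And>a. a \<in> A \<Longrightarrow> l a \<ge> 0"
  shows "\<exists>I \<mu>. I \<subseteq> A \<and> independent I \<and> (\<forall>a\<in>I. \<mu> a > 0) \<and> \<phi> = (\<Sum>a\<in>I. \<mu> a *\<^sub>R a)"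
  using assms
proof (induction A arbitrary: l rule: finite_psubset_induct)
  case (psubset A)
  have remove: ?case if "\<phi> = (\<Sum>a\<in>A. k a *\<^sub>R a)" "\<And>a. a \<in> A \<Longrightarrow> k a \<ge> 0" "a0 \<in> A" "k a0 = 0" for k a0
  proof -
    have "\<phi> = (\<Sum>a\<in>A - {a0}. k a *\<^sub>R a)"
      using that psubset.hyps by (simp add: sum_diff1)
    moreover have "A - {a0} \<subset> A" using that by auto
    ultimately show ?thesis
      using psubset.IH[of "A - {a0}" k] that by blast
  qed
  show ?case
  proof (cases "\<exists>a0\<in>A. l a0 = 0")
    case True
    then show ?thesis using remove psubset.prems by blast
  next
    case False
    then have pos: "l a > 0" if "a \<in> A" for a using psubset.prems(2)[OF that] that by force
    show ?thesis
    proof (cases "independent A")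
      case True
      then show ?thesis using psubset.prems pos by blast
    next
      case False
      then obtain u0 a1 where u0: "a1 \<in> A" "u0 a1 \<noteq> 0" "(\<Sum>a\<in>A. u0 a *\<^sub>R a) = 0"
        using dependent_finite[OF psubset.hyps] by auto
      obtain u where u: "u a1 > 0" "(\<Sum>a\<in>A. u a *\<^sub>R a) = 0"
      proof (cases "u0 a1 > 0")
        case True
        then show ?thesis using that u0 by blast
      next
        case False
        then show ?thesis using that[of "\<lambda>a. - u0 a"] u0 by (simp add: sum_negf)
      qed
      \<comment> \<open>Ratio test: the least quotient is the largest step along the relation
        \<open>u\<close> that keeps all coefficients nonnegative. At a minimiser \<open>a0\<close>
        the new coefficient is \<open>0\<close>, so \<open>a0\<close> can be removed.\<close>
      define R where "R = (\<lambda>a. l a / u a) ` {a\<in>A. u a > 0}"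
      have R: "finite R" "R \<noteq> {}" using psubset.hyps u u0 by (auto simp: R_def)
      define t where "t = Min R"
      have "t \<in> R" using R Min_in t_def by blast
      then obtain a0 where a0: "a0 \<in> A" "u a0 > 0" "t = l a0 / u a0" by (auto simp: R_def)
      have t0: "t > 0" using a0 pos by simp
      have nn: "l a - t * u a \<ge> 0" if a: "a \<in> A" for a
      proof (cases "u a > 0")
        case True
        then have "t \<le> l a / u a" unfolding t_def using R a by (intro Min_le) (auto simp: R_def)
        then show ?thesis using True by (simp add: field_simps)
      next
        case False
        then show ?thesis using t0 pos[OF a] mult_nonneg_nonpos[of t "u a"] by linarith
      qed
      have "(\<Sum>a\<in>A. (l a - t * u a) *\<^sub>R a) = (\<Sum>a\<in>A. l a *\<^sub>R a) - t *\<^sub>R (\<Sum>a\<in>A. u a *\<^sub>R a)"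
        by (simp add: scaleR_diff_left sum_subtractf scaleR_sum_right)
      then show ?thesis
        using remove[of "\<lambda>a. l a - t * u a" a0] nn a0 u psubset.prems by simp
    qed
  qed
qed

text \<open>Names a ray by few vectors. Where the orthogonal complement of \<open>B\<close> is a
  line, the value is determined up to sign; for other \<open>B\<close> it is some arbitrary vector,
  which does no harm because only the number of these vectors is counted.\<close>

definition unit_normal :: "'a::euclidean_space set \<Rightarrow> 'a" where
  "unit_normal B = (SOME v. norm v = 1 \<and> (\<forall>s\<in>B. s \<bullet> v = 0))"

text \<open>Both signs are taken because the choice fixes a normal only up to sign. Running over all
  subsets bounds the size in terms of \<open>card S\<close> alone.\<close>

definition unit_normals :: "'a::euclidean_space set \<Rightarrow> 'a set" where
  "unit_normals S = (\<Union>B\<in>Pow S. {unit_normal B, - unit_normal B})"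

lemma finite_unit_normals: "finite S \<Longrightarrow> finite (unit_normals S)"
  by (auto simp: unit_normals_def)

lemma card_unit_normals: 
  assumes "finite S" shows "card (unit_normals S) \<le> 2 * 2 ^ card S"
proof -
  have "card (unit_normals S) \<le> (\<Sum>B\<in>Pow S. card {unit_normal B, - unit_normal B})"
    unfolding unit_normals_def by (rule card_UN_le) (simp add: assms)
  also have "\<dots> \<le> (\<Sum>B\<in>Pow S. 2)" by (intro sum_mono) (simp add: card_insert_if)
  also have "\<dots> = 2 * 2 ^ card S" by (simp add: card_Pow assms)
  finally show ?thesis .
qed

lemma finite_scaling_below:
  fixes f g :: "'a \<Rightarrow> real"
  assumes "finite A" "\<And>s. s \<in> A \<Longrightarrow> f s > 0" "\<And>s. s \<in> A \<Longrightarrow> g s \<ge> 0"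
  shows "\<exists>\<delta>>0. \<forall>s\<in>A. \<delta> * g s \<le> f s"
proof -
  \<comment> \<open>The \<open>+ 1\<close> guards against \<open>g s = 0\<close>, the inserted
    \<open>1\<close> against an empty \<open>A\<close>.\<close>
  define \<delta> where "\<delta> = Min (insert 1 ((\<lambda>s. f s / (g s + 1)) ` A))"
  have "\<delta> > 0" unfolding \<delta>_def using assms by (subst Min_gr_iff) (auto intro!: divide_pos_pos add_nonneg_pos)
  moreover have "\<delta> * g s \<le> f s" if s: "s \<in> A" for s
  proof -
    have "\<delta> \<le> f s / (g s + 1)" unfolding \<delta>_def using assms s by (intro Min_le) auto
    then have "\<delta> * (g s + 1) \<le> f s" using assms(3)[OF s] by (simp add: pos_le_divide_eq)
    then show ?thesis using \<open>\<delta> > 0\<close> by (simp add: algebra_simps)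
  qed
  ultimately show ?thesis by blast
qed

text \<open>If \<open>u \<noteq> 0\<close> were orthogonal to \<open>w\<close> and to all members of \<open>S\<close> that vanish at \<open>v\<close>, then \<open>v\<close> would be the midpoint
  of \<open>v \<plusminus> \<delta> u\<close>. Hence \<open>v\<close> spans the orthogonal complement of those members.\<close>

lemma extreme_point_cell_section:
  fixes S :: "'a::euclidean_space set" and \<sigma> :: "'a \<Rightarrow> real" and w v :: 'a
  defines "P \<equiv> {v. (\<forall>s\<in>S. (\<sigma> s = 0 \<longrightarrow> s \<bullet> v = 0) \<and> \<sigma> s * (s \<bullet> v) \<ge> 0) \<and> w \<bullet> v = 1}"
  assumes "finite S" and v: "v extreme_point_of P"
  shows "\<exists>B\<subseteq>S. card B \<le> DIM('a) \<and> (v = norm v *\<^sub>R unit_normal B \<or> v = norm v *\<^sub>R (- unit_normal B))"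
proof -
  have vP: "v \<in> P" using v by (simp add: extreme_point_of_def)
  have wv: "w \<bullet> v = 1" using vP by (simp add: P_def)
  have v0: "v \<noteq> 0" using wv by auto
  define Z where "Z = {s\<in>S. s \<bullet> v = 0}"
  have zero: "u = 0" if u: "\<forall>s\<in>Z. s \<bullet> u = 0" "w \<bullet> u = 0" for u
  proof (rule ccontr)
    assume un: "u \<noteq> 0"
    \<comment> \<open>A step this small along \<open>u\<close> cannot flip the sign of any
      \<open>s \<bullet> v\<close> that is not zero.\<close>
    obtain \<delta> where \<delta>: "\<delta> > 0" "\<forall>s\<in>S - Z. \<delta> * \<bar>s \<bullet> u\<bar> \<le> \<bar>s \<bullet> v\<bar>"
      using finite_scaling_below[of "S - Z" "\<lambda>s. \<bar>s \<bullet> v\<bar>" "\<lambda>s. \<bar>s \<bullet> u\<bar>"] assms(2) by (auto simp: Z_def)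
    have mem: "v + t *\<^sub>R u \<in> P" if t: "\<bar>t\<bar> = \<delta>" for t
    proof -
      have "(\<sigma> s = 0 \<longrightarrow> s \<bullet> (v + t *\<^sub>R u) = 0) \<and> \<sigma> s * (s \<bullet> (v + t *\<^sub>R u)) \<ge> 0" if s: "s \<in> S" for s
      proof (cases "s \<in> Z")
        case True
        then show ?thesis using u by (simp add: Z_def inner_add_right)
      next
        case False
        then have sv: "s \<bullet> v \<noteq> 0" using s by (simp add: Z_def)
        have le: "\<bar>t * (s \<bullet> u)\<bar> \<le> \<bar>s \<bullet> v\<bar>" using \<delta>(2) False s t by (simp add: abs_mult)
        have sig: "\<sigma> s \<noteq> 0" "\<sigma> s * (s \<bullet> v) \<ge> 0" using vP s sv by (auto simp: P_def)
        show ?thesis using le sig sv by (auto simp: inner_add_right zero_le_mult_iff)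
      qed
      moreover have "w \<bullet> (v + t *\<^sub>R u) = 1" using u wv by (simp add: inner_add_right)
      ultimately show ?thesis by (simp add: P_def)
    qed
    have "v + \<delta> *\<^sub>R u \<in> P" "v + (-\<delta>) *\<^sub>R u \<in> P" using mem[of \<delta>] mem[of "-\<delta>"] \<delta> by auto
    moreover have "v = midpoint (v + \<delta> *\<^sub>R u) (v + (-\<delta>) *\<^sub>R u)" 
      by (simp add: midpoint_def algebra_simps flip: scaleR_2)
    moreover have "v + \<delta> *\<^sub>R u \<noteq> v + (-\<delta>) *\<^sub>R u"
    proof
      assume "v + \<delta> *\<^sub>R u = v + (-\<delta>) *\<^sub>R u"
      then have "\<delta> *\<^sub>R u = - (\<delta> *\<^sub>R u)" by simp
      then have "(\<delta> + \<delta>) *\<^sub>R u = 0" by (metis eq_neg_iff_add_eq_0 scaleR_add_left)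
      then show False using \<delta> un by simp
    qed
    ultimately show False using v unfolding extreme_point_of_def by (metis midpoint_in_open_segment)
  qed
  obtain B where B: "B \<subseteq> Z" "independent B" "Z \<subseteq> span B" "card B = dim Z"
    using basis_exists by blast
  have cB: "card B \<le> DIM('a)" using B(2) by (rule independent_card_le)
  have ex: "norm ((1 / norm v) *\<^sub>R v) = 1 \<and> (\<forall>s\<in>B. s \<bullet> ((1 / norm v) *\<^sub>R v) = 0)"
    using v0 B(1) by (auto simp: Z_def)
  have un: "norm (unit_normal B) = 1 \<and> (\<forall>s\<in>B. s \<bullet> unit_normal B = 0)"
    unfolding unit_normal_def using ex by (rule someI)
  define u where "u = unit_normal B"
  have uZ: "s \<bullet> u = 0" if "s \<in> Z" for s
  proof -
    have "\<forall>b\<in>B. orthogonal u b" using un by (simp add: u_def orthogonal_def inner_commute)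
    then have "orthogonal u s" using B(3) that orthogonal_to_span[of s B u] by auto
    then show ?thesis by (simp add: orthogonal_def inner_commute)
  qed
  \<comment> \<open>As \<open>w \<bullet> v = 1\<close>, subtracting this multiple of
    \<open>v\<close> yields a vector orthogonal to \<open>w\<close> and to \<open>Z\<close>, to
    which \<open>zero\<close> applies. So \<open>u\<close> and \<open>v\<close> are
    parallel.\<close>
  have "u - (w \<bullet> u) *\<^sub>R v = 0"
    by (rule zero) (use uZ wv in \<open>auto simp: inner_diff_right Z_def\<close>)
  then have uv: "u = (w \<bullet> u) *\<^sub>R v" by simp
  have "1 = \<bar>w \<bullet> u\<bar> * norm v" using un uv u_def by (metis norm_scaleR)
  then have *: "\<bar>w \<bullet> u\<bar> * norm v = 1" by simp
  have "v = norm v *\<^sub>R u \<or> v = norm v *\<^sub>R (- u)"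
  proof (cases "w \<bullet> u \<ge> 0")
    case True
    then have "norm v *\<^sub>R u = v" using * by (subst uv) (simp add: mult.commute)
    then show ?thesis by simp
  next
    case False
    then have "norm v * (- (w \<bullet> u)) = 1" using * by (simp add: mult.commute)
    then have "norm v *\<^sub>R (- u) = v" by (subst uv) simp
    then show ?thesis by simp
  qed
  then show ?thesis using B(1) cB by (auto simp: u_def Z_def intro!: exI[of _ B])
qed

text \<open>The point is that the cone spanned by \<open>I\<close> depends on boundedly many members of \<open>S\<close> only, whereas the cell of
  \<open>\<phi>\<close> in the arrangement of the hyperplanes orthogonal to \<open>S\<close> may depend on all of them.\<close>

lemma simplicial_cone_in_cell:
  fixes S :: "'a::euclidean_space set" and \<phi> :: 'a
  assumes fin: "finite S" and basis: "Basis \<subseteq> S"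
  shows "\<exists>I \<mu>. independent I \<and> (\<forall>a\<in>I. \<mu> a > 0) \<and> \<phi> = (\<Sum>a\<in>I. \<mu> a *\<^sub>R a) \<and>
     (\<forall>a\<in>I. \<exists>B\<subseteq>S. card B \<le> DIM('a) \<and> (a = unit_normal B \<or> a = - unit_normal B)) \<and>
     (\<forall>s\<in>S. (\<forall>a\<in>I. s \<bullet> a \<ge> 0) \<or> (\<forall>a\<in>I. s \<bullet> a \<le> 0))"
proof (cases "\<phi> = 0")
  case True
  then show ?thesis by (intro exI[of _ "{}"]) (auto simp: independent_empty)
next
  case False
  define \<sigma> where "\<sigma> s = sgn (s \<bullet> \<phi>)" for s
  \<comment> \<open>On the closed cell of \<phi> the functional \<open>w\<close> is the sum of all
    \<open>\<bar>s \<bullet> v\<bar>\<close>. As \<open>Basis \<subseteq> S\<close>, it dominates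
    every coordinate, so the section \<open>P\<close> of the cell is compact and Krein-Milman
    applies to it.\<close>
  define w where "w = (\<Sum>s\<in>S. \<sigma> s *\<^sub>R s)"
  define P where "P = {v. (\<forall>s\<in>S. (\<sigma> s = 0 \<longrightarrow> s \<bullet> v = 0) \<and> \<sigma> s * (s \<bullet> v) \<ge> 0) \<and> w \<bullet> v = 1}"
  have wsum: "w \<bullet> v = (\<Sum>s\<in>S. \<sigma> s * (s \<bullet> v))" for v by (simp add: w_def inner_sum_left)
  have \<sigma>\<phi>: "\<sigma> s * (s \<bullet> \<phi>) = \<bar>s \<bullet> \<phi>\<bar>" for s by (simp add: \<sigma>_def sgn_if)
  have w\<phi>: "w \<bullet> \<phi> > 0"
  proof -
    obtain b where b: "b \<in> Basis" "b \<bullet> \<phi> \<noteq> 0" using False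
      by (metis euclidean_all_zero_iff inner_commute)
    have "w \<bullet> \<phi> = (\<Sum>s\<in>S. \<bar>s \<bullet> \<phi>\<bar>)" by (simp only: wsum \<sigma>\<phi>)
    also have "\<dots> > 0" using b basis fin by (intro sum_pos2[of _ b]) auto
    finally show ?thesis .
  qed
  have Peq: "P = (\<Inter>s\<in>S. {v. (if \<sigma> s = 0 then s else 0) \<bullet> v = 0} \<inter> {v. (\<sigma> s *\<^sub>R s) \<bullet> v \<ge> 0}) \<inter> {v. w \<bullet> v = 1}"
  proof -
    have "(\<sigma> s = 0 \<longrightarrow> s \<bullet> v = 0) \<longleftrightarrow> (if \<sigma> s = 0 then s else 0) \<bullet> v = 0" for s v by simp
    then show ?thesis unfolding P_def by (simp only: inner_scaleR_left) blast
  qed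
  have cl: "closed P" unfolding Peq
    by (intro closed_Int closed_INT ballI closed_hyperplane closed_halfspace_ge)
  have cv: "convex P" unfolding Peq
    by (intro convex_Int convex_INT convex_hyperplane convex_halfspace_ge)
  have "\<bar>v \<bullet> b\<bar> \<le> 1" if "v \<in> P" "b \<in> Basis" for v b
  proof -
    have bS: "b \<in> S" using that basis by auto
    have "\<sigma> b * (b \<bullet> v) \<le> (\<Sum>s\<in>S. \<sigma> s * (s \<bullet> v))"
      using that bS fin by (intro member_le_sum) (auto simp: P_def)
    then have "\<sigma> b * (b \<bullet> v) \<le> 1" "\<sigma> b * (b \<bullet> v) \<ge> 0" "\<sigma> b = 0 \<longrightarrow> b \<bullet> v = 0" using that bS by (auto simp: P_def wsum)
    then show ?thesis by (cases "b \<bullet> \<phi>" "0::real" rule: linorder_cases) (auto simp: \<sigma>_def inner_commute)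
  qed
  then have "norm v \<le> (\<Sum>b\<in>(Basis::'a set). 1)" if "v \<in> P" for v
    using that by (intro order_trans[OF norm_le_l1] sum_mono)
  then have bd: "bounded P" unfolding bounded_iff by (intro exI ballI)
  have comp: "compact P" using cl bd compact_eq_bounded_closed by blast
  define \<psi> where "\<psi> = (1 / (w \<bullet> \<phi>)) *\<^sub>R \<phi>"
  have "\<psi> \<in> P"
  proof -
    have "\<sigma> s * (s \<bullet> \<psi>) = \<bar>s \<bullet> \<phi>\<bar> / (w \<bullet> \<phi>)" for s
      by (simp add: \<psi>_def flip: \<sigma>\<phi>)
    moreover have "\<sigma> s = 0 \<longrightarrow> s \<bullet> \<psi> = 0" for s by (simp add: \<sigma>_def \<psi>_def sgn_0_0)
    ultimately show ?thesis using w\<phi> by (simp add: P_def) (simp add: \<psi>_def)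
  qed
  then have "\<psi> \<in> convex hull {x. x extreme_point_of P}"
    using Krein_Milman_Minkowski[OF comp cv] by simp
  then obtain X l where X: "finite X" "X \<subseteq> {x. x extreme_point_of P}" "\<forall>x\<in>X. 0 \<le> l x" 
     "(\<Sum>x\<in>X. l x *\<^sub>R x) = \<psi>"
    unfolding convex_hull_explicit by blast
  \<comment> \<open>Extreme points are scaled to length 1 to become values of
    \<open>unit_normal\<close> up to sign; the coefficients absorb the norms.\<close>
  define A where "A = (\<lambda>x. (1 / norm x) *\<^sub>R x) ` X"
  have x0: "x \<noteq> 0" if "x \<in> X" for x
    using X that by (auto simp: extreme_point_of_def P_def)
  have "\<phi> = (w \<bullet> \<phi>) *\<^sub>R \<psi>" using w\<phi> by (simp add: \<psi>_def)
  also have "\<dots> = (\<Sum>x\<in>X. (w \<bullet> \<phi> * l x * norm x) *\<^sub>R ((1 / norm x) *\<^sub>R x))"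
    unfolding X(4)[symmetric] scaleR_sum_right by (intro sum.cong) (use x0 in auto)
  also have "\<dots> = (\<Sum>a\<in>A. \<Sum>x\<in>{x\<in>X. (1 / norm x) *\<^sub>R x = a}. (w \<bullet> \<phi> * l x * norm x) *\<^sub>R ((1 / norm x) *\<^sub>R x))"
    unfolding A_def by (rule sum.image_gen[OF X(1)])
  also have "\<dots> = (\<Sum>a\<in>A. (\<Sum>x\<in>{x\<in>X. (1 / norm x) *\<^sub>R x = a}. (w \<bullet> \<phi> * l x * norm x)) *\<^sub>R a)"
    unfolding scaleR_sum_left by (intro sum.cong) auto
  finally have \<phi>A: "\<phi> = (\<Sum>a\<in>A. (\<Sum>x\<in>{x\<in>X. (1 / norm x) *\<^sub>R x = a}. (w \<bullet> \<phi> * l x * norm x)) *\<^sub>R a)" .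
  have "finite A" using X by (simp add: A_def)
  moreover have "(\<Sum>x\<in>{x\<in>X. (1 / norm x) *\<^sub>R x = a}. (w \<bullet> \<phi> * l x * norm x)) \<ge> 0" for a
    using X(3) w\<phi> by (intro sum_nonneg mult_nonneg_nonneg) auto
  ultimately obtain I \<mu> where I: "I \<subseteq> A" "independent I" "\<forall>a\<in>I. \<mu> a > 0" "\<phi> = (\<Sum>a\<in>I. \<mu> a *\<^sub>R a)"
    using cone_caratheodory[OF _ \<phi>A] by blast
  have AP: "\<exists>B\<subseteq>S. card B \<le> DIM('a) \<and> (a = unit_normal B \<or> a = - unit_normal B)" if aA: "a \<in> A" for a
  proof -
    obtain x where x: "x \<in> X" "a = (1 / norm x) *\<^sub>R x" using aA unfolding A_def by blast
    then have "x extreme_point_of P" using X by auto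
    from extreme_point_cell_section[OF fin this[unfolded P_def]]
    obtain B where B: "B \<subseteq> S" "card B \<le> DIM('a)" "x = norm x *\<^sub>R unit_normal B \<or> x = norm x *\<^sub>R (- unit_normal B)"
      by blast
    have "y = (1 / norm x) *\<^sub>R x" if "x = norm x *\<^sub>R y" for y
      using that x0[OF x(1)] by (metis divide_self_if norm_eq_zero scaleR_one scaleR_scaleR times_divide_eq_left mult_1)
    then show ?thesis using B x(2) by metis
  qed
  have sg: "(\<forall>a\<in>I. s \<bullet> a \<ge> 0) \<or> (\<forall>a\<in>I. s \<bullet> a \<le> 0)" if s: "s \<in> S" for s
  proof -
    have "\<sigma> s * (s \<bullet> a) \<ge> 0 \<and> (\<sigma> s = 0 \<longrightarrow> s \<bullet> a = 0)" if aI: "a \<in> I" for a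
    proof -
      obtain x where x: "x \<in> X" "a = (1 / norm x) *\<^sub>R x" using aI I(1) unfolding A_def by blast
      then have "x \<in> P" using X by (auto simp: extreme_point_of_def)
      then have "\<sigma> s * (s \<bullet> x) \<ge> 0" "\<sigma> s = 0 \<longrightarrow> s \<bullet> x = 0" using s by (auto simp: P_def)
      then show ?thesis using x by auto
    qed
    then show ?thesis by (cases "s \<bullet> \<phi>" "0::real" rule: linorder_cases) (auto simp: \<sigma>_def)
  qed
  show ?thesis using I AP sg by blast
qed

section \<open>Random samples\<close>

text \<open>A small set becomes a list of length exactly \<open>D\<close> by padding with the extra
  symbol \<open>m\<close>; this is where \<open>Suc m\<close> comes from.\<close>

lemma card_subsets_card_le:
  "card {R. R \<subseteq> {..<m} \<and> card R \<le> D} \<le> Suc m ^ D"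
proof -
  have "{R. R \<subseteq> {..<m} \<and> card R \<le> D} \<subseteq> (\<lambda>xs. set xs - {m}) ` {xs. set xs \<subseteq> {..m} \<and> length xs = D}"
  proof
    fix R assume R: "R \<in> {R. R \<subseteq> {..<m} \<and> card R \<le> D}"
    then have fin: "finite R" using finite_subset by blast
    define xs where "xs = sorted_list_of_set R @ replicate (D - card R) m"
    have "length xs = D" "set xs \<subseteq> {..m}" "R = set xs - {m}" using R fin
      by (auto simp: xs_def)
    then show "R \<in> (\<lambda>xs. set xs - {m}) ` {xs. set xs \<subseteq> {..m} \<and> length xs = D}" by blast
  qed
  then have "card {R. R \<subseteq> {..<m} \<and> card R \<le> D} \<le> card {xs. set xs \<subseteq> {..m} \<and> length xs = D}"
    by (rule surj_card_le[OF finite_lists_length_eq[OF finite_atMost]])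
  then show ?thesis by (simp add: card_lists_length_eq)
qed

text \<open>The polynomial factor counts the positions of the points that determine a test set; the
  power is the probability that the other sample points miss a test set of density
  \<epsilon>.\<close>

lemma sample_size_exists:
  fixes \<epsilon> C :: real
  assumes "0 < \<epsilon>" "\<epsilon> < 1"
  shows "\<exists>m\<ge>D. real (Suc m ^ D) * (C * (1 - \<epsilon>) ^ (m - D)) < 1"
proof -
  define q where "q = 1 - \<epsilon>"
  have q: "0 < q" "q < 1" using assms by (auto simp: q_def)
  have "(\<lambda>m. (real m + 1) ^ D * (C * (q ^ m / q ^ D))) \<longlonglongrightarrow> 0"
    using q by real_asymp
  then have "\<forall>\<^sub>F m in sequentially. (real m + 1) ^ D * (C * (q ^ m / q ^ D)) < 1"
    by (rule order_tendstoD) simp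
  then have "\<forall>\<^sub>F m in sequentially. m \<ge> D \<and> (real m + 1) ^ D * (C * (q ^ m / q ^ D)) < 1"
    using eventually_ge_at_top eventually_conj by blast
  then obtain m where m: "m \<ge> D" "(real m + 1) ^ D * (C * (q ^ m / q ^ D)) < 1"
    unfolding eventually_sequentially by blast
  have "q ^ m / q ^ D = q ^ (m - D)" using q m by (simp add: power_diff)
  then show ?thesis using m by (auto simp: q_def add.commute intro!: exI[of _ m])
qed

text \<open>An epsilon-net property whose ranges are generated by the net itself, as in the theory
  of cuttings.\<close>

definition hits_large_sets :: "real \<Rightarrow> nat \<Rightarrow> ('v set \<Rightarrow> 'v set set) \<Rightarrow> 'v set \<Rightarrow> 'v set \<Rightarrow> bool" where
  "hits_large_sets \<epsilon> D \<X> V S \<longleftrightarrow>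
     (\<forall>S0\<subseteq>S. card S0 \<le> D \<longrightarrow> (\<forall>X\<in>\<X> S0. X \<subseteq> V \<longrightarrow> X \<inter> S = {} \<longrightarrow> real (card X) \<le> \<epsilon> * card V))"

text \<open>A union bound over random samples. No complexity assumption on the sets is needed, since each of them is
  determined by few points of the sample itself.\<close>

lemma sample_hits_large_sets:
  fixes \<epsilon> :: real
  assumes "\<epsilon> > 0"
  shows "\<exists>m. \<forall>(V :: 'v set) \<X>. finite V \<longrightarrow> V \<noteq> {} \<longrightarrow>
     (\<forall>S\<subseteq>V. card S \<le> D \<longrightarrow> finite (\<X> S) \<and> card (\<X> S) \<le> L) \<longrightarrow>
     (\<exists>S\<subseteq>V. card S \<le> m \<and> hits_large_sets \<epsilon> D \<X> V S)"
proof (cases "\<epsilon> < 1")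
  case False
  have "real (card X) \<le> \<epsilon> * card V" if "finite V" "X \<subseteq> V" for X V :: "'v set"
  proof -
    have "real (card X) \<le> 1 * real (card V)" using that by (simp add: card_mono)
    also have "\<dots> \<le> \<epsilon> * card V" using False by (intro mult_right_mono) auto
    finally show ?thesis .
  qed
  then show ?thesis by (intro exI[of _ 0] allI impI) (auto simp: hits_large_sets_def intro!: exI[of _ "{}"])
next
  case True
  obtain m where m: "m \<ge> D" "real (Suc m ^ D) * (real L * (1 - \<epsilon>) ^ (m - D)) < 1"
    using sample_size_exists assms True by blast
  show ?thesis
  proof (intro exI[of _ m] allI impI)
    fix V :: "'v set" and \<X> :: "'v set \<Rightarrow> 'v set set"
    assume V: "finite V" "V \<noteq> {}" and X: "\<forall>S\<subseteq>V. card S \<le> D \<longrightarrow> finite (\<X> S) \<and> card (\<X> S) \<le> L"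
    define P where "P S0 S X \<longleftrightarrow> X \<in> \<X> S0 \<and> X \<subseteq> V \<and> X \<inter> S = {} \<and> real (card X) > \<epsilon> * card V" for S0 S X
    define \<R> where "\<R> = {R. R \<subseteq> {..<m} \<and> card R \<le> D}"
    define \<Omega> where "\<Omega> = ({..<m} \<rightarrow>\<^sub>E V)"
    define Y where "Y \<rho> R = {X \<in> \<X> (\<rho> ` R). X \<subseteq> V \<and> real (card X) > \<epsilon> * card V}" for \<rho> :: "nat \<Rightarrow> 'v" and R
    define T where "T R \<rho> X = (\<Pi>\<^sub>E i\<in>{..<m}. if i \<in> R then {\<rho> i} else V - X)" for R \<rho> X
    define bad where "bad = {s \<in> \<Omega>. \<exists>S0\<subseteq>s ` {..<m}. card S0 \<le> D \<and> (\<exists>X. P S0 (s ` {..<m}) X)}"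
    have fin\<R>: "finite \<R>" by (auto simp: \<R>_def)
    have n0: "real (card V) > 0" using V by (simp add: card_gt_0_iff)
    \<comment> \<open>A bad sample is encoded by the positions \<open>R\<close> at which
      \<open>S0\<close> occurs, the values \<rho> there, and a large set \<open>X\<close> missed by
      the remaining \<open>m - card R\<close> independent entries. Taking \<open>s\<close> injective
      on \<open>R\<close> ensures \<open>card R \<le> D\<close>.\<close>
    have sub: "bad \<subseteq> (\<Union>R\<in>\<R>. \<Union>\<rho>\<in>R \<rightarrow>\<^sub>E V. \<Union>X\<in>Y \<rho> R. T R \<rho> X)"
    proof
      fix s assume "s \<in> bad"
      then obtain S0 X where s: "s \<in> \<Omega>" "S0 \<subseteq> s ` {..<m}" "card S0 \<le> D" "P S0 (s ` {..<m}) X"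
        unfolding bad_def by blast
      obtain R where R: "R \<subseteq> {..<m}" "inj_on s R" "S0 = s ` R"
        using s(2) by (auto simp: subset_image_inj)
      have RR: "R \<in> \<R>" using R s(3) by (simp add: \<R>_def card_image)
      have \<rho>: "restrict s R \<in> R \<rightarrow>\<^sub>E V" using s(1) R(1) by (auto simp: \<Omega>_def)
      have XY: "X \<in> Y (restrict s R) R" using s(4) R(3) by (simp add: Y_def P_def)
      have "s \<in> T R (restrict s R) X" using s R by (auto simp: T_def \<Omega>_def P_def PiE_iff)
      with RR \<rho> XY show "s \<in> (\<Union>R\<in>\<R>. \<Union>\<rho>\<in>R \<rightarrow>\<^sub>E V. \<Union>X\<in>Y \<rho> R. T R \<rho> X)" by blast
    qed
    have cT: "real (card (T R \<rho> X)) \<le> ((1 - \<epsilon>) * card V) ^ (m - card R)" if "R \<in> \<R>" "X \<in> Y \<rho> R" for R \<rho> X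
    proof -
      have R: "R \<subseteq> {..<m}" "finite R" using that finite_subset by (auto simp: \<R>_def)
      have "card (T R \<rho> X) = (\<Prod>i\<in>{..<m}. if i \<in> R then 1 else card (V - X))"
        unfolding T_def by (subst card_PiE) (auto intro!: prod.cong)
      also have "\<dots> = card (V - X) ^ card ({..<m} - R)"
        by (simp add: prod.If_cases Diff_eq)
      also have "card ({..<m} - R) = m - card R" using R by (simp add: card_Diff_subset)
      finally have c: "real (card (T R \<rho> X)) = real (card (V - X)) ^ (m - card R)" by simp
      have XV: "X \<subseteq> V" "real (card X) > \<epsilon> * card V" using that by (auto simp: Y_def)
      have "real (card (V - X)) = real (card V) - real (card X)"
        using XV V by (simp add: card_Diff_subset finite_subset card_mono of_nat_diff)
      also have "\<dots> \<le> (1 - \<epsilon>) * card V" using XV by (simp add: algebra_simps)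
      finally show ?thesis unfolding c by (rule power_mono) simp
    qed
    have finY: "finite (Y \<rho> R)" "card (Y \<rho> R) \<le> L" if "R \<in> \<R>" "\<rho> \<in> R \<rightarrow>\<^sub>E V" for R \<rho>
    proof -
      have R: "finite R" "card R \<le> D" using that finite_subset by (auto simp: \<R>_def)
      then have "\<rho> ` R \<subseteq> V" "card (\<rho> ` R) \<le> D" using that card_image_le[OF R(1), of \<rho>] by auto
      then have *: "finite (\<X> (\<rho> ` R))" "card (\<X> (\<rho> ` R)) \<le> L" using X by auto
      have "Y \<rho> R \<subseteq> \<X> (\<rho> ` R)" by (auto simp: Y_def)
      then show "finite (Y \<rho> R)" "card (Y \<rho> R) \<le> L"
        using * finite_subset[of "Y \<rho> R"] card_mono[of _ "Y \<rho> R"] by (blast, fastforce)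
    qed
    have "real (card bad) \<le> card (\<Union>R\<in>\<R>. \<Union>\<rho>\<in>R \<rightarrow>\<^sub>E V. \<Union>X\<in>Y \<rho> R. T R \<rho> X)"
    proof -
      have "(\<Union>R\<in>\<R>. \<Union>\<rho>\<in>R \<rightarrow>\<^sub>E V. \<Union>X\<in>Y \<rho> R. T R \<rho> X) \<subseteq> (\<Pi>\<^sub>E i\<in>{..<m}. V)"
      proof (intro UN_least)
        fix R :: "nat set" and \<rho> X assume "\<rho> \<in> R \<rightarrow>\<^sub>E V"
        then show "T R \<rho> X \<subseteq> (\<Pi>\<^sub>E i\<in>{..<m}. V)"
          unfolding T_def by (intro PiE_mono) auto
      qed
      then have "finite (\<Union>R\<in>\<R>. \<Union>\<rho>\<in>R \<rightarrow>\<^sub>E V. \<Union>X\<in>Y \<rho> R. T R \<rho> X)"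
        by (rule finite_subset) (simp add: finite_PiE V)
      then show ?thesis using sub by (simp only: of_nat_le_iff) (rule card_mono)
    qed
    also have "\<dots> \<le> (\<Sum>R\<in>\<R>. \<Sum>\<rho>\<in>R \<rightarrow>\<^sub>E V. \<Sum>X\<in>Y \<rho> R. card (T R \<rho> X))"
    proof -
      have "card (\<Union>R\<in>\<R>. \<Union>\<rho>\<in>R \<rightarrow>\<^sub>E V. \<Union>X\<in>Y \<rho> R. T R \<rho> X) \<le> (\<Sum>R\<in>\<R>. card (\<Union>\<rho>\<in>R \<rightarrow>\<^sub>E V. \<Union>X\<in>Y \<rho> R. T R \<rho> X))"
        by (rule card_UN_le[OF fin\<R>])
      also have "\<dots> \<le> (\<Sum>R\<in>\<R>. \<Sum>\<rho>\<in>R \<rightarrow>\<^sub>E V. card (\<Union>X\<in>Y \<rho> R. T R \<rho> X))"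
        using V by (intro sum_mono card_UN_le finite_PiE) (auto simp: \<R>_def intro: finite_subset)
      also have "\<dots> \<le> (\<Sum>R\<in>\<R>. \<Sum>\<rho>\<in>R \<rightarrow>\<^sub>E V. \<Sum>X\<in>Y \<rho> R. card (T R \<rho> X))"
        using finY by (intro sum_mono card_UN_le) auto
      finally show ?thesis by (simp only: of_nat_le_iff)
    qed
    also have "\<dots> = (\<Sum>R\<in>\<R>. \<Sum>\<rho>\<in>R \<rightarrow>\<^sub>E V. \<Sum>X\<in>Y \<rho> R. real (card (T R \<rho> X)))" by simp
    also have "\<dots> \<le> (\<Sum>R\<in>\<R>. \<Sum>\<rho>\<in>R \<rightarrow>\<^sub>E V. \<Sum>X\<in>Y \<rho> R. ((1 - \<epsilon>) * card V) ^ (m - card R))"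
      using cT by (intro sum_mono) auto
    also have "\<dots> \<le> (\<Sum>R\<in>\<R>. \<Sum>\<rho>\<in>R \<rightarrow>\<^sub>E V. L * ((1 - \<epsilon>) * card V) ^ (m - card R))"
      using finY True by (intro sum_mono) (simp add: mult_right_mono)
    also have "\<dots> = (\<Sum>R\<in>\<R>. L * (1 - \<epsilon>) ^ (m - card R) * card V ^ m)"
    proof (intro sum.cong refl)
      fix R assume R: "R \<in> \<R>"
      then have finR: "finite R" and le: "card R \<le> m" using finite_subset m(1) by (auto simp: \<R>_def)
      have "card (R \<rightarrow>\<^sub>E V) = card V ^ card R" using finR by (simp add: card_PiE)
      moreover have "real (card V) ^ m = real (card V) ^ card R * real (card V) ^ (m - card R)"
        using le by (simp flip: power_add)
      ultimately show "(\<Sum>\<rho>\<in>R \<rightarrow>\<^sub>E V. L * ((1 - \<epsilon>) * card V) ^ (m - card R)) = L * (1 - \<epsilon>) ^ (m - card R) * card V ^ m"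
        by (simp add: power_mult_distrib)
    qed
    also have "\<dots> \<le> (\<Sum>R\<in>\<R>. L * (1 - \<epsilon>) ^ (m - D) * card V ^ m)"
      using True assms by (intro sum_mono mult_right_mono mult_left_mono power_decreasing) (auto simp: \<R>_def)
    also have "\<dots> = real (card \<R>) * (L * (1 - \<epsilon>) ^ (m - D)) * card V ^ m" by simp
    also have "\<dots> \<le> real (Suc m ^ D) * (L * (1 - \<epsilon>) ^ (m - D)) * card V ^ m"
      using True card_subsets_card_le[of m D] unfolding \<R>_def[symmetric]
      by (intro mult_right_mono) (auto simp del: of_nat_power of_nat_Suc)
    also have "\<dots> < 1 * real (card V ^ m)"
      using m(2) n0 by (intro mult_strict_right_mono) auto
    also have "real (card V ^ m) = card \<Omega>" by (simp add: \<Omega>_def card_PiE)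
    finally have "card bad < card \<Omega>" by simp
    moreover have "bad \<subseteq> \<Omega>" by (auto simp: bad_def)
    ultimately have "bad \<noteq> \<Omega>" by auto
    then obtain s where s: "s \<in> \<Omega>" "s \<notin> bad" using \<open>bad \<subseteq> \<Omega>\<close> by blast
    let ?S = "s ` {..<m}"
    have a: "?S \<subseteq> V" using s by (auto simp: \<Omega>_def)
    have b: "card ?S \<le> m" using card_image_le[of "{..<m}" s] by simp
    have c: "real (card X) \<le> \<epsilon> * card V" if "S0 \<subseteq> ?S" "card S0 \<le> D" "X \<in> \<X> S0" "X \<subseteq> V" "X \<inter> ?S = {}" for S0 X
    proof (rule ccontr)
      assume "\<not> real (card X) \<le> \<epsilon> * card V"
      then have "P S0 ?S X" using that by (simp add: P_def)
      then show False using s that unfolding bad_def by blast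
    qed
    show "\<exists>S\<subseteq>V. card S \<le> m \<and> hits_large_sets \<epsilon> D \<X> V S"
      unfolding hits_large_sets_def by (intro exI[of _ ?S] conjI allI impI ballI a b) (rule c)
  qed
qed

section \<open>Homogeneous colourings for signs of multilinear forms\<close>

definition tuples :: "nat \<Rightarrow> 'v set \<Rightarrow> 'v list set" where
  "tuples k V = {vs. set vs \<subseteq> V \<and> length vs = k}"

lemma finite_tuples: "finite V \<Longrightarrow> finite (tuples k V)"
  by (simp add: tuples_def finite_lists_length_eq)

lemma card_tuples: "finite V \<Longrightarrow> card (tuples k V) = card V ^ k"
  by (simp add: tuples_def card_lists_length_eq)

lemma tuples_Suc: "tuples (Suc k) V = (\<lambda>(v, vs). v # vs) ` (V \<times> tuples k V)"
  by (auto simp: tuples_def length_Suc_conv image_iff)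

text \<open>A single dissenting tuple spoils its whole colour block. The complement is therefore a
  union of blocks on each of which \<open>F\<close> is constant.\<close>

definition mixed :: "nat \<Rightarrow> 'v set \<Rightarrow> ('v \<Rightarrow> 'c) \<Rightarrow> ('v list \<Rightarrow> 'b) \<Rightarrow> 'v list set" where
  "mixed k V c F = {vs \<in> tuples k V. \<exists>us\<in>tuples k V. map c us = map c vs \<and> F us \<noteq> F vs}"

lemma mixed_subset: "mixed k V c F \<subseteq> tuples k V"
  by (auto simp: mixed_def)

lemma finite_mixed: "finite V \<Longrightarrow> finite (mixed k V c F)"
  by (rule finite_subset[OF mixed_subset finite_tuples])

lemma map_eq_coarsen:
  assumes "\<And>u v. u \<in> V \<Longrightarrow> v \<in> V \<Longrightarrow> g u = g v \<Longrightarrow> c u = c v"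
    and "set us \<subseteq> V" "set vs \<subseteq> V" "map g us = map g vs"
  shows "map c us = map c vs"
proof -
  have l: "length us = length vs" using assms(4) map_eq_imp_length_eq by blast
  moreover have "c (us ! i) = c (vs ! i)" if "i < length us" for i
  proof (rule assms(1))
    show "us ! i \<in> V" "vs ! i \<in> V" using that l assms(2,3) nth_mem by (metis subsetD)+
    show "g (us ! i) = g (vs ! i)" using assms(4) that l by (metis nth_map)
  qed
  ultimately show ?thesis by (auto intro!: nth_equalityI)
qed

lemma mixed_refine:
  assumes "\<And>u v. u \<in> V \<Longrightarrow> v \<in> V \<Longrightarrow> g u = g v \<Longrightarrow> c u = c v"
  shows "mixed k V g F \<subseteq> mixed k V c F"
proof -
  have "map c us = map c vs" if "us \<in> tuples k V" "vs \<in> tuples k V" "map g us = map g vs" for us vs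
    using that by (intro map_eq_coarsen[of V g c, OF assms]) (auto simp: tuples_def)
  then show ?thesis unfolding mixed_def by blast
qed

definition block_colorable :: "nat \<Rightarrow> real \<Rightarrow> nat \<Rightarrow> 'v set \<Rightarrow> ('v list \<Rightarrow> 'b) \<Rightarrow> bool" where
  "block_colorable K \<epsilon> k V F \<longleftrightarrow>
     (\<exists>c :: 'v \<Rightarrow> nat. c ` V \<subseteq> {..<K} \<and> real (card (mixed k V c F)) \<le> \<epsilon> * real (card V) ^ k)"

lemma nat_coloring:
  assumes "finite V" "card (g ` V) \<le> K"
  shows "\<exists>c :: 'v \<Rightarrow> nat. c ` V \<subseteq> {..<K} \<and> (\<forall>u\<in>V. \<forall>v\<in>V. c u = c v \<longrightarrow> g u = g v)"
proof -
  obtain h :: "_ \<Rightarrow> nat" where h: "bij_betw h (g ` V) {0..<card (g ` V)}"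
    using ex_bij_betw_finite_nat[of "g ` V"] assms(1) by blast
  have "(h \<circ> g) ` V = {0..<card (g ` V)}" using h by (simp add: bij_betw_def image_comp)
  then have "(h \<circ> g) ` V \<subseteq> {..<K}" using assms(2) by auto
  moreover have "g u = g v" if "u \<in> V" "v \<in> V" "(h \<circ> g) u = (h \<circ> g) v" for u v
    using h that by (auto simp: bij_betw_def inj_on_def)
  ultimately show ?thesis by (intro exI[of _ "h \<circ> g"]) blast
qed

lemma block_colorableI:
  assumes "finite V" "card (g ` V) \<le> K" "real (card (mixed k V g F)) \<le> \<epsilon> * real (card V) ^ k"
  shows "block_colorable K \<epsilon> k V F"
proof -
  obtain c :: "_ \<Rightarrow> nat" where c: "c ` V \<subseteq> {..<K}" "\<forall>u\<in>V. \<forall>v\<in>V. c u = c v \<longrightarrow> g u = g v"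
    using nat_coloring[OF assms(1,2)] by blast
  have "mixed k V c F \<subseteq> mixed k V g F" using c(2) by (intro mixed_refine) blast
  then have "card (mixed k V c F) \<le> card (mixed k V g F)" by (rule card_mono[OF finite_mixed[OF assms(1)]])
  then show ?thesis unfolding block_colorable_def using c(1) assms(3) by (intro exI[of _ c]) linarith
qed

text \<open>The product of the colourings refines each of them, and by \<open>mixed_refine\<close> a
  refinement never creates mixed tuples.\<close>

lemma block_colorable_joint:
  assumes "finite V" "finite J" "\<And>j. j \<in> J \<Longrightarrow> block_colorable K \<epsilon> k V (F j)"
  shows "\<exists>c :: 'v \<Rightarrow> nat. c ` V \<subseteq> {..<K ^ card J} \<and>
     (\<forall>j\<in>J. real (card (mixed k V c (F j))) \<le> \<epsilon> * real (card V) ^ k)"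
proof -
  have "\<forall>j\<in>J. \<exists>c :: 'v \<Rightarrow> nat. c ` V \<subseteq> {..<K} \<and> real (card (mixed k V c (F j))) \<le> \<epsilon> * real (card V) ^ k"
    using assms(3) by (simp add: block_colorable_def)
  then obtain C :: "_ \<Rightarrow> 'v \<Rightarrow> nat" where C: "\<And>j. j \<in> J \<Longrightarrow> C j ` V \<subseteq> {..<K}"
      "\<And>j. j \<in> J \<Longrightarrow> real (card (mixed k V (C j) (F j))) \<le> \<epsilon> * real (card V) ^ k"
    by metis
  define g where "g v = restrict (\<lambda>j. C j v) J" for v
  have "g ` V \<subseteq> J \<rightarrow>\<^sub>E {..<K}" using C(1) by (fastforce simp: g_def)
  then have "card (g ` V) \<le> card (J \<rightarrow>\<^sub>E {..<K})" by (rule card_mono[rotated]) (simp add: finite_PiE assms(2))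
  also have "\<dots> = K ^ card J" by (simp add: card_PiE assms(2))
  finally obtain c :: "_ \<Rightarrow> nat" where c: "c ` V \<subseteq> {..<K ^ card J}" "\<forall>u\<in>V. \<forall>v\<in>V. c u = c v \<longrightarrow> g u = g v"
    using nat_coloring[OF assms(1)] by blast
  have "real (card (mixed k V c (F j))) \<le> \<epsilon> * real (card V) ^ k" if j: "j \<in> J" for j
  proof -
    have "C j u = C j v" if "g u = g v" for u v using fun_cong[OF that, of j] j by (simp add: g_def)
    then have "mixed k V c (F j) \<subseteq> mixed k V (C j) (F j)" using c(2) by (intro mixed_refine) blast
    then have "card (mixed k V c (F j)) \<le> card (mixed k V (C j) (F j))"
      by (rule card_mono[OF finite_mixed[OF assms(1)]])
    then show ?thesis using C(2)[OF j] by linarith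
  qed
  then show ?thesis using c(1) by blast
qed

text \<open>Arguments form a list so that the arity is a number on which one can induct, freezing
  the first argument at each stage.\<close>

definition multilin :: "nat \<Rightarrow> ('a::real_vector list \<Rightarrow> real) \<Rightarrow> bool" where
  "multilin k M \<longleftrightarrow> (\<forall>ys i. length ys = k \<longrightarrow> i < k \<longrightarrow> linear (\<lambda>x. M (ys[i := x])))"

lemma multilin_Cons: "multilin (Suc k) M \<Longrightarrow> multilin k (\<lambda>ys. M (w # ys))"
  unfolding multilin_def
proof (intro allI impI)
  fix ys :: "'a list" and i
  assume M: "\<forall>ys i. length ys = Suc k \<longrightarrow> i < Suc k \<longrightarrow> linear (\<lambda>x. M (ys[i := x]))" and *: "length ys = k" "i < k"
  show "linear (\<lambda>x. M (w # ys[i := x]))" using M[rule_format, of "w # ys" "Suc i"] * by simp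
qed

lemma multilin_hd: "multilin (Suc k) M \<Longrightarrow> length ys = k \<Longrightarrow> linear (\<lambda>x. M (x # ys))"
  unfolding multilin_def by (drule spec[of _ "undefined # ys"], drule spec[of _ 0]) simp

text \<open>Riesz representation with an explicit vector; the vectors \<phi> and \<open>wv\<close>
  of the induction below have this shape.\<close>

lemma linear_eq_inner:
  fixes g :: "'a::euclidean_space \<Rightarrow> real"
  assumes "linear g"
  shows "g x = x \<bullet> (\<Sum>b\<in>Basis. g b *\<^sub>R b)"
proof -
  have "g x = g (\<Sum>b\<in>Basis. (x \<bullet> b) *\<^sub>R b)" by (simp add: euclidean_representation)
  also have "\<dots> = (\<Sum>b\<in>Basis. (x \<bullet> b) * g b)" using assms by (simp add: linear_sum linear_scale)
  finally show ?thesis by (simp add: inner_sum_right mult.commute)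
qed

text \<open>Without cancellation the sign of a positive combination depends only on the signs of its
  terms, whatever the weights.\<close>

lemma sgn_sum_cong:
  fixes x y \<mu> \<nu> :: "'a \<Rightarrow> real"
  assumes "finite I" "(\<forall>a\<in>I. x a \<ge> 0) \<or> (\<forall>a\<in>I. x a \<le> 0)"
    and "\<And>a. a \<in> I \<Longrightarrow> sgn (x a) = sgn (y a)" "\<And>a. a \<in> I \<Longrightarrow> \<mu> a > 0" "\<And>a. a \<in> I \<Longrightarrow> \<nu> a > 0"
  shows "sgn (\<Sum>a\<in>I. \<mu> a * x a) = sgn (\<Sum>a\<in>I. \<nu> a * y a)"
proof -
  have pos: "sgn (\<Sum>a\<in>I. \<rho> a * z a) = (if \<exists>a\<in>I. z a > 0 then 1 else 0)"
    if "\<And>a. a \<in> I \<Longrightarrow> \<rho> a > 0" "\<And>a. a \<in> I \<Longrightarrow> z a \<ge> 0" for \<rho> z :: "'a \<Rightarrow> real"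
  proof (cases "\<exists>a\<in>I. z a > 0")
    case True
    then obtain a where "a \<in> I" "z a > 0" by blast
    then have "(\<Sum>a\<in>I. \<rho> a * z a) > 0"
      using that assms(1) by (intro sum_pos2[of _ a]) (auto simp: less_imp_le)
    then show ?thesis using True by simp
  next
    case False
    then have "z a = 0" if "a \<in> I" for a using \<open>\<And>a. a \<in> I \<Longrightarrow> z a \<ge> 0\<close>[OF that] that by force
    then show ?thesis by simp
  qed
  show ?thesis
  proof (cases "\<forall>a\<in>I. x a \<ge> 0")
    case True
    then have y: "y a \<ge> 0" "y a > 0 \<longleftrightarrow> x a > 0" if "a \<in> I" for a
      using assms(3)[OF that] that by (auto simp: sgn_if split: if_splits)
    show ?thesis using pos[of \<mu> x] pos[of \<nu> y] True y assms(4,5) by auto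
  next
    case False
    then have x: "\<forall>a\<in>I. x a \<le> 0" using assms(2) by blast
    then have y: "- y a \<ge> 0" "- y a > 0 \<longleftrightarrow> - x a > 0" if "a \<in> I" for a
      using assms(3)[OF that] that by (auto simp: sgn_if split: if_splits)
    have "sgn (\<Sum>a\<in>I. \<mu> a * - x a) = sgn (\<Sum>a\<in>I. \<nu> a * - y a)"
      using pos[of \<mu> "\<lambda>a. - x a"] pos[of \<nu> "\<lambda>a. - y a"] x y assms(4,5) by auto
    then show ?thesis by (simp add: sum_negf sgn_minus)
  qed
qed

text \<open>Lets membership in the relatively open cone on \<open>I\<close> be read off from
  coordinate signs: positive on \<open>I\<close> and zero on the rest of the basis.\<close>

lemma representation_positive_combination:
  fixes I :: "'a::euclidean_space set"
  assumes "independent E" "I \<subseteq> E" "finite E"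
  shows "representation E (\<Sum>a\<in>I. \<mu> a *\<^sub>R a) b = (if b \<in> I then \<mu> b else 0)"
proof -
  have "finite I" using assms finite_subset by blast
  have "representation E (\<Sum>a\<in>I. \<mu> a *\<^sub>R a) b = (\<Sum>a\<in>I. representation E (\<mu> a *\<^sub>R a) b)"
    using assms by (subst representation_sum) (auto intro: span_scale span_base)
  also have "\<dots> = (\<Sum>a\<in>I. if a = b then \<mu> a else 0)"
  proof (rule sum.cong[OF refl])
    fix a assume "a \<in> I"
    then have "a \<in> E" using assms by auto
    then show "representation E (\<mu> a *\<^sub>R a) b = (if a = b then \<mu> a else 0)"
      using assms by (simp add: representation_scale span_base representation_basis)
  qed
  finally show ?thesis using \<open>finite I\<close> by simp
qed

text \<open>The colour of \<open>v\<close> consists of \<open>c1 v\<close>, which controls the cone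
  containing \<phi>, and of the signs of \<open>p v\<close> on all candidate rays. A tuple
  \<open>v # vs\<close> is mixed only if \<open>vs\<close> is mixed for some coordinate form
  (\<open>A1\<close>) or if the hyperplane of \<open>p v\<close> cuts the cone chosen for
  \<open>vs\<close> (\<open>A2\<close>). Each event is allotted
  \<open>\<epsilon> / 2\<close>.\<close>

lemma sgn_multilin_colorable:
  fixes \<epsilon> :: real
  assumes "\<epsilon> > 0"
  shows "\<exists>K. \<forall>(V :: 'v set) (p :: 'v \<Rightarrow> 'a::euclidean_space) M. finite V \<longrightarrow> V \<noteq> {} \<longrightarrow> multilin k M \<longrightarrow>
     block_colorable K \<epsilon> k V (\<lambda>vs. sgn (M (map p vs)))"
  using assms
proof (induction k arbitrary: \<epsilon>)
  case 0
  have "block_colorable 1 \<epsilon> 0 V (\<lambda>vs. sgn (M (map p vs)))" if "finite V" for V :: "'v set" and p :: "'v \<Rightarrow> 'a" and M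
  proof -
    have "mixed 0 V (\<lambda>_. 0::nat) (\<lambda>vs. sgn (M (map p vs))) = {}" by (auto simp: mixed_def tuples_def)
    then show ?thesis using 0 by (auto simp: block_colorable_def intro!: exI[of _ "\<lambda>_. 0::nat"])
  qed
  then show ?case by blast
next
  case (Suc k)
  define n where "n = DIM('a)"
  \<comment> \<open>A cone has at most \<open>n\<close> rays, each fixed by at most \<open>n\<close>
    sample points, hence \<open>n * n\<close>. \<open>N1\<close> bounds the rays obtainable from so
    many points together with the \<open>n\<close> basis vectors; a test set is named by a subset of
    such rays.\<close>
  define N1 :: nat where "N1 = 2 * 2 ^ (n * n + n)"
  have e2: "\<epsilon> / 2 > 0" using Suc.prems by simp
  obtain m where m: "\<forall>(V :: 'v set) \<X>. finite V \<longrightarrow> V \<noteq> {} \<longrightarrow>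
     (\<forall>S\<subseteq>V. card S \<le> n * n \<longrightarrow> finite (\<X> S) \<and> card (\<X> S) \<le> 2 ^ N1) \<longrightarrow>
     (\<exists>S\<subseteq>V. card S \<le> m \<and> hits_large_sets (\<epsilon> / 2) (n * n) \<X> V S)"
    using sample_hits_large_sets[OF e2, of "n * n" "2 ^ N1", where 'v = 'v] ..
  \<comment> \<open>\<open>N2\<close> bounds the rays obtainable from the whole sample, and
    \<open>q\<close> the pairs of a set of rays and one of the \<open>n\<close> coordinates in a
    basis extending it.\<close>
  define N2 :: nat where "N2 = 2 * 2 ^ (m + n)"
  define q :: nat where "q = 2 ^ N2 * n"
  define \<epsilon>0 where "\<epsilon>0 = \<epsilon> / (2 * (real q + 1))"
  have e0: "\<epsilon>0 > 0" using Suc.prems by (simp add: \<epsilon>0_def)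
  obtain K0 where K0: "\<And>(V :: 'v set) (p :: 'v \<Rightarrow> 'a) M. finite V \<Longrightarrow> V \<noteq> {} \<Longrightarrow> multilin k M \<Longrightarrow>
     block_colorable K0 \<epsilon>0 k V (\<lambda>vs. sgn (M (map p vs)))"
    using Suc.IH[OF e0] by blast
  \<comment> \<open>\<open>K0\<close> colours for each of at most \<open>q\<close> coordinate forms
    and three signs for each ray. \<open>K0 + 1\<close> keeps the power monotone in its exponent
    even if \<open>K0 = 0\<close>.\<close>
  define K where "K = (K0 + 1) ^ q * 3 ^ N2"
  have "block_colorable K \<epsilon> (Suc k) V (\<lambda>vs. sgn (M (map p vs)))"
    if V: "finite V" "V \<noteq> {}" and M: "multilin (Suc k) M" for V :: "'v set" and p :: "'v \<Rightarrow> 'a" and M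
  proof -
    \<comment> \<open>These are the vertices whose hyperplane strictly separates two rays of
      \<open>I\<close>; for all others the weak sign is constant on the cone.\<close>
    define X where "X I = {v \<in> V. \<exists>a\<in>I. \<exists>b\<in>I. p v \<bullet> a > 0 \<and> p v \<bullet> b < 0}" for I
    define \<X> where "\<X> S0 = X ` Pow (unit_normals (p ` S0 \<union> Basis))" for S0
    have cU: "finite (unit_normals (p ` S0 \<union> Basis))" "card (unit_normals (p ` S0 \<union> Basis)) \<le> 2 * 2 ^ (s + n)"
      if S0: "S0 \<subseteq> V" "card S0 \<le> s" for S0 s
    proof -
      have fS: "finite S0" using S0 V finite_subset by blast
      then show "finite (unit_normals (p ` S0 \<union> Basis))" by (simp add: finite_unit_normals)
      have "card (p ` S0 \<union> Basis) \<le> s + n"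
        using card_Un_le[of "p ` S0" "Basis :: 'a set"] card_image_le[OF fS, of p] S0(2) by (simp add: n_def)
      then have "(2::nat) ^ card (p ` S0 \<union> Basis) \<le> 2 ^ (s + n)" by (rule power_increasing) simp
      then show "card (unit_normals (p ` S0 \<union> Basis)) \<le> 2 * 2 ^ (s + n)"
        using card_unit_normals[of "p ` S0 \<union> Basis", OF finite_UnI[OF finite_imageI[OF fS] finite_Basis]] by linarith
    qed
    have "\<forall>S\<subseteq>V. card S \<le> n * n \<longrightarrow> finite (\<X> S) \<and> card (\<X> S) \<le> 2 ^ N1"
    proof (intro allI impI conjI)
      fix S0 assume S0: "S0 \<subseteq> V" "card S0 \<le> n * n"
      show "finite (\<X> S0)" using cU[OF S0] by (simp add: \<X>_def)
      have "card (\<X> S0) \<le> card (Pow (unit_normals (p ` S0 \<union> Basis)))"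
        unfolding \<X>_def using cU[OF S0] by (intro card_image_le) simp
      also have "\<dots> \<le> 2 ^ N1" using cU[OF S0] by (simp add: card_Pow N1_def)
      finally show "card (\<X> S0) \<le> 2 ^ N1" .
    qed
    from m[THEN spec, THEN spec, THEN mp, THEN mp, THEN mp, OF V this]
    obtain S where S: "S \<subseteq> V" "card S \<le> m"
      "hits_large_sets (\<epsilon> / 2) (n * n) \<X> V S"
      by (elim exE conjE) (rule that)
    define Q where "Q = unit_normals (p ` S \<union> Basis)"
    have finQ: "finite Q" and cQ: "card Q \<le> N2" using cU[OF S(1,2)] by (auto simp: Q_def N2_def)
    define J where "J = (SIGMA I:{I\<in>Pow Q. independent I}. extend_basis I)"
    have ext: "independent (extend_basis I)" "span (extend_basis I) = UNIV" "I \<subseteq> extend_basis I"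
      "finite (extend_basis I)" "card (extend_basis I) = n" if "independent I" for I :: "'a set"
    proof -
      show *: "independent (extend_basis I)" "span (extend_basis I) = UNIV" "I \<subseteq> extend_basis I"
        using that independent_extend_basis extend_basis_superset span_extend_basis by auto
      show "finite (extend_basis I)" using *(1) independent_imp_finite by blast
      show "card (extend_basis I) = n" using * dim_eq_card[of "extend_basis I" UNIV] by (simp add: n_def)
    qed
    have finJ: "finite J" unfolding J_def using finQ ext by (intro finite_SigmaI) auto
    have "card J = (\<Sum>I\<in>{I\<in>Pow Q. independent I}. card (extend_basis I))"
      unfolding J_def using finQ ext by (intro card_SigmaI) auto
    also have "\<dots> = card {I\<in>Pow Q. independent I} * n" using ext by simp
    also have "\<dots> \<le> card (Pow Q) * n" using finQ by (intro mult_right_mono card_mono) auto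
    also have "\<dots> \<le> q" using finQ cQ by (simp add: q_def card_Pow)
    finally have cJ: "card J \<le> q" .
    \<comment> \<open>The coordinate of \<open>\<phi> vs\<close> at \<open>snd j\<close> is
      \<open>wv j \<bullet> \<phi> vs\<close>, that is, \<open>M\<close> with its first argument
      frozen to \<open>wv j\<close>. So membership in a cone becomes a condition on forms of arity
      \<open>k\<close>, and the induction hypothesis applies.\<close>
    define wv where "wv j = (\<Sum>e\<in>Basis. representation (extend_basis (fst j)) e (snd j) *\<^sub>R e)" for j :: "'a set \<times> 'a"
    define F where "F j vs = sgn (M (wv j # map p vs))" for j vs
    define \<phi> where "\<phi> vs = (\<Sum>e\<in>Basis. M (e # map p vs) *\<^sub>R e)" for vs
    have Min: "M (x # map p vs) = x \<bullet> \<phi> vs" if "vs \<in> tuples k V" for x vs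
    proof -
      have "linear (\<lambda>x. M (x # map p vs))" using that by (intro multilin_hd[OF M]) (simp add: tuples_def)
      from linear_eq_inner[OF this, of x] show ?thesis by (simp add: \<phi>_def)
    qed
    have rep: "representation (extend_basis I) y b = wv (I, b) \<bullet> y" if "independent I" for I y b
    proof -
      have "linear (\<lambda>v. representation (extend_basis I) v b)"
        using ext[OF that] by (intro linearI) (simp_all add: representation_add representation_scale)
      from linear_eq_inner[OF this, of y] show ?thesis by (simp add: wv_def inner_commute)
    qed
    have Frep: "F (I, b) vs = sgn (representation (extend_basis I) (\<phi> vs) b)"
      if "independent I" "vs \<in> tuples k V" for I b vs
      using rep[OF that(1)] Min[OF that(2)] by (simp add: F_def)
    have "block_colorable K0 \<epsilon>0 k V (F j)" if "j \<in> J" for j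
      unfolding F_def by (rule K0[OF V multilin_Cons[OF M]])
    then obtain c1 :: "'v \<Rightarrow> nat" where c1: "c1 ` V \<subseteq> {..<K0 ^ card J}"
       "\<And>j. j \<in> J \<Longrightarrow> real (card (mixed k V c1 (F j))) \<le> \<epsilon>0 * real (card V) ^ k"
      using block_colorable_joint[OF V(1) finJ, of K0 \<epsilon>0 k F] by blast
    define g where "g v = (c1 v, restrict (\<lambda>a. sgn (p v \<bullet> a)) Q)" for v
    have "g ` V \<subseteq> {..<K0 ^ card J} \<times> (Q \<rightarrow>\<^sub>E {-1, 0, 1})"
      using c1(1) by (auto simp: g_def sgn_if split: if_splits)
    then have "card (g ` V) \<le> card ({..<K0 ^ card J} \<times> (Q \<rightarrow>\<^sub>E {-1, 0, 1::real}))"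
      by (rule card_mono[rotated]) (simp add: finite_PiE finQ)
    also have "\<dots> = K0 ^ card J * 3 ^ card Q" by (simp add: card_cartesian_product card_PiE finQ numeral_3_eq_3)
    also have "\<dots> \<le> K"
    proof -
      have "K0 ^ card J \<le> (K0 + 1) ^ card J" by (rule power_mono) auto
      also have "\<dots> \<le> (K0 + 1) ^ q" using cJ by (rule power_increasing) simp
      finally have "K0 ^ card J \<le> (K0 + 1) ^ q" .
      moreover have "(3::nat) ^ card Q \<le> 3 ^ N2" using cQ by (rule power_increasing) simp
      ultimately show ?thesis unfolding K_def by (rule mult_le_mono)
    qed
    finally have cg: "card (g ` V) \<le> K" .
    define cell where "cell I \<mu> vs \<longleftrightarrow> independent I \<and> (\<forall>a\<in>I. \<mu> a > 0) \<and> \<phi> vs = (\<Sum>a\<in>I. \<mu> a *\<^sub>R a) \<and>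
     (\<forall>a\<in>I. \<exists>B\<subseteq>p ` S \<union> Basis. card B \<le> DIM('a) \<and> (a = unit_normal B \<or> a = - unit_normal B)) \<and>
     (\<forall>s\<in>p ` S \<union> Basis. (\<forall>a\<in>I. s \<bullet> a \<ge> 0) \<or> (\<forall>a\<in>I. s \<bullet> a \<le> 0))" for I \<mu> vs
    have finS: "finite S" using S(1) V finite_subset by blast
    have "\<forall>vs. \<exists>I \<mu>. cell I \<mu> vs"
      unfolding cell_def using finS by (intro allI simplicial_cone_in_cell) auto
    then obtain Ic \<mu>c where cell: "\<And>vs. cell (Ic vs) (\<mu>c vs) vs" by metis
    \<comment> \<open>Every sample point sees all rays of the cone weakly on one side, so
      \<open>X (Ic vs)\<close> misses \<open>S\<close>. Being determined by at most
      \<open>n * n\<close> sample points, it is one of the sets that the sample would have hit if it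
      were large.\<close>
    have XI: "real (card (X (Ic vs))) \<le> \<epsilon> / 2 * card V" for vs
    proof -
      have c: "independent (Ic vs)" 
        "\<forall>a\<in>Ic vs. \<exists>B. B\<subseteq>p ` S \<union> Basis \<and> card B \<le> n \<and> (a = unit_normal B \<or> a = - unit_normal B)"
        "\<forall>s\<in>p ` S \<union> Basis. (\<forall>a\<in>Ic vs. s \<bullet> a \<ge> 0) \<or> (\<forall>a\<in>Ic vs. s \<bullet> a \<le> 0)"
        using cell[of vs] by (auto simp: cell_def n_def)
      obtain B where B: "\<And>a. a \<in> Ic vs \<Longrightarrow> B a \<subseteq> p ` S \<union> Basis \<and> card (B a) \<le> n \<and> (a = unit_normal (B a) \<or> a = - unit_normal (B a))"
        using bchoice[OF c(2)] by blast
      define B' where "B' = (\<Union>a\<in>Ic vs. B a) \<inter> p ` S"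
      have finI: "finite (Ic vs)" and cI: "card (Ic vs) \<le> n"
        using independent_bound[OF c(1)] by (auto simp: n_def)
      have BS: "(\<Union>a\<in>Ic vs. B a) \<subseteq> p ` S \<union> Basis" using B by blast
      have finB: "finite (\<Union>a\<in>Ic vs. B a)"
        by (rule finite_subset[OF BS]) (simp add: finS)
      have "card B' \<le> card (\<Union>a\<in>Ic vs. B a)" unfolding B'_def by (rule card_mono[OF finB]) auto
      also have "\<dots> \<le> (\<Sum>a\<in>Ic vs. card (B a))" by (rule card_UN_le[OF finI])
      also have "\<dots> \<le> (\<Sum>a\<in>Ic vs. n)" by (rule sum_mono) (use B in blast)
      also have "\<dots> \<le> n * n" using cI by simp
      finally have cB': "card B' \<le> n * n" .
      have "B' \<subseteq> p ` S" by (auto simp: B'_def)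
      then obtain S0 where S0: "S0 \<subseteq> S" "inj_on p S0" "B' = p ` S0" by (auto simp: subset_image_inj)
      have cS0: "card S0 \<le> n * n" using cB' S0 by (simp add: card_image)
      have "a \<in> unit_normals (p ` S0 \<union> Basis)" if "a \<in> Ic vs" for a
      proof -
        have "B a \<subseteq> p ` S0 \<union> Basis" using BS that unfolding S0(3)[symmetric] B'_def by blast
        then show ?thesis using B[OF that] unfolding unit_normals_def by blast
      qed
      then have "X (Ic vs) \<in> \<X> S0" by (auto simp: \<X>_def)
      moreover have "X (Ic vs) \<inter> S = {}"
      proof -
        have "s \<notin> X (Ic vs)" if "s \<in> S" for s using c(3)[rule_format, of "p s"] that by (force simp: X_def)
        then show ?thesis by blast
      qed
      moreover have "X (Ic vs) \<subseteq> V" by (auto simp: X_def)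
      ultimately show ?thesis using S(3)[unfolded hits_large_sets_def, rule_format, OF S0(1) cS0] by simp
    qed
    define A1 where "A1 = (\<lambda>(v, vs). v # vs) ` (V \<times> (\<Union>j\<in>J. mixed k V c1 (F j)))"
    define A2 where "A2 = (\<lambda>(vs, v). v # vs) ` (SIGMA vs:tuples k V. X (Ic vs))"
    have sub: "mixed (Suc k) V g (\<lambda>vs. sgn (M (map p vs))) \<subseteq> A1 \<union> A2"
    proof
      fix xs assume xs: "xs \<in> mixed (Suc k) V g (\<lambda>vs. sgn (M (map p vs)))"
      then obtain v vs where vs: "xs = v # vs" "v \<in> V" "vs \<in> tuples k V"
        by (auto simp: mixed_def tuples_Suc)
      obtain ys where ys: "ys \<in> tuples (Suc k) V" "map g ys = map g xs" "sgn (M (map p ys)) \<noteq> sgn (M (map p xs))"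
        using xs unfolding mixed_def by blast
      then obtain u us where us: "ys = u # us" "u \<in> V" "us \<in> tuples k V" by (auto simp: tuples_Suc)
      show "xs \<in> A1 \<union> A2"
      proof (rule ccontr)
        assume no: "xs \<notin> A1 \<union> A2"
        let ?I = "Ic vs" and ?\<mu> = "\<mu>c vs"
        have nm: "vs \<notin> mixed k V c1 (F j)" if "j \<in> J" for j
          using no vs that by (auto simp: A1_def)
        have nX: "v \<notin> X ?I" using no vs by (force simp: A2_def)
        have gm: "map g us = map g vs" "g u = g v" using ys(2) us vs by auto
        have "map c1 us = map c1 vs"
          by (rule map_eq_coarsen[of V g]) (use gm us vs in \<open>auto simp: g_def tuples_def\<close>)
        then have Feq: "F j us = F j vs" if "j \<in> J" for j
          using nm[OF that] us(3) vs(3) unfolding mixed_def by blast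
        have I: "independent ?I" "\<And>a. a \<in> ?I \<Longrightarrow> ?\<mu> a > 0" "\<phi> vs = (\<Sum>a\<in>?I. ?\<mu> a *\<^sub>R a)"
          using cell[of vs] by (auto simp: cell_def)
        have IQ: "?I \<subseteq> Q"
        proof
          fix a assume "a \<in> ?I"
          then obtain B where "B \<subseteq> p ` S \<union> Basis" "a = unit_normal B \<or> a = - unit_normal B"
            using cell[of vs] unfolding cell_def by blast
          then show "a \<in> Q" unfolding Q_def unit_normals_def by blast
        qed
        have finI: "finite ?I" using IQ finQ finite_subset by blast
        let ?E = "extend_basis ?I"
        define \<nu> where "\<nu> b = representation ?E (\<phi> us) b" for b
        \<comment> \<open>Equal signs of all coordinates put \<open>\<phi> us\<close> into the
          relative interior of the very cone that contains \<open>\<phi> vs\<close>.\<close>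
        have sg: "sgn (\<nu> b) = sgn (if b \<in> ?I then ?\<mu> b else 0)" if "b \<in> ?E" for b
        proof -
          have "(?I, b) \<in> J" using that IQ I(1) by (simp add: J_def)
          from Feq[OF this] have "sgn (\<nu> b) = sgn (representation ?E (\<phi> vs) b)"
            using Frep[OF I(1) us(3)] Frep[OF I(1) vs(3)] by (simp add: \<nu>_def)
          then show ?thesis
            unfolding I(3) using representation_positive_combination[OF ext(1)[OF I(1)] ext(3)[OF I(1)] ext(4)[OF I(1)]]
            by simp
        qed
        have \<nu>pos: "\<nu> b > 0" if "b \<in> ?I" for b
          using sg[of b] I(2)[OF that] that ext(3)[OF I(1)] by (auto simp: sgn_1_pos)
        have "\<phi> us = (\<Sum>b\<in>?E. \<nu> b *\<^sub>R b)"
          unfolding \<nu>_def using ext[OF I(1)] by (intro sum_representation_eq[symmetric]) auto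
        also have "\<dots> = (\<Sum>b\<in>?I. \<nu> b *\<^sub>R b)"
        proof (rule sum.mono_neutral_right)
          have "\<nu> i = 0" if "i \<in> ?E - ?I" for i using sg[of i] that by (simp add: sgn_0_0)
          then show "\<forall>i\<in>?E - ?I. \<nu> i *\<^sub>R i = 0" by simp
        qed (use ext[OF I(1)] in auto)
        finally have \<phi>us: "\<phi> us = (\<Sum>b\<in>?I. \<nu> b *\<^sub>R b)" .
        have sgp: "sgn (p v \<bullet> a) = sgn (p u \<bullet> a)" if "a \<in> ?I" for a
        proof -
          have "restrict (\<lambda>a. sgn (p u \<bullet> a)) Q a = restrict (\<lambda>a. sgn (p v \<bullet> a)) Q a"
            using gm(2) by (simp add: g_def)
          then show ?thesis using that IQ by auto
        qed
        \<comment> \<open>Since \<open>v\<close> is outside \<open>X ?I\<close>, neither inner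
          product involves cancellation, although the weights of \<open>\<phi> us\<close> and
          \<open>\<phi> vs\<close> differ.\<close>
        have "(\<forall>a\<in>?I. p v \<bullet> a \<ge> 0) \<or> (\<forall>a\<in>?I. p v \<bullet> a \<le> 0)"
          using nX vs(2) unfolding X_def by (smt (verit) mem_Collect_eq)
        from sgn_sum_cong[OF finI this sgp I(2) \<nu>pos]
        have "sgn (p v \<bullet> \<phi> vs) = sgn (p u \<bullet> \<phi> us)"
          unfolding I(3) \<phi>us by (simp add: inner_sum_right)
        then show False using ys(3) us vs Min by simp
      qed
    qed
    have fm: "finite (\<Union>j\<in>J. mixed k V c1 (F j))" using finJ V finite_mixed by blast
    have fX: "finite (X I)" for I using V by (simp add: X_def)
    have fS: "finite (SIGMA vs:tuples k V. X (Ic vs))" using V finite_tuples fX by blast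
    have "real (card A1) \<le> real (card (V \<times> (\<Union>j\<in>J. mixed k V c1 (F j))))"
      unfolding A1_def using V fm by (intro of_nat_mono card_image_le) simp
    also have "\<dots> = real (card V) * card (\<Union>j\<in>J. mixed k V c1 (F j))" by (simp add: card_cartesian_product)
    also have "\<dots> \<le> real (card V) * (\<Sum>j\<in>J. card (mixed k V c1 (F j)))"
      by (intro mult_left_mono of_nat_mono card_UN_le[OF finJ]) simp
    also have "\<dots> = real (card V) * (\<Sum>j\<in>J. real (card (mixed k V c1 (F j))))" by simp
    also have "\<dots> \<le> real (card V) * (\<Sum>j\<in>J. \<epsilon>0 * real (card V) ^ k)"
      using c1(2) by (intro mult_left_mono sum_mono) auto
    also have "\<dots> = (card J * \<epsilon>0) * real (card V) ^ Suc k" by simp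
    also have "\<dots> \<le> \<epsilon> / 2 * real (card V) ^ Suc k"
    proof (rule mult_right_mono)
      have "card J * \<epsilon>0 \<le> (real q + 1) * \<epsilon>0" using cJ e0 by (intro mult_right_mono) auto
      also have "\<dots> = \<epsilon> / 2" by (simp add: \<epsilon>0_def field_simps)
      finally show "card J * \<epsilon>0 \<le> \<epsilon> / 2" .
    qed simp
    finally have A1: "real (card A1) \<le> \<epsilon> / 2 * real (card V) ^ Suc k" .
    have "real (card A2) \<le> real (card (SIGMA vs:tuples k V. X (Ic vs)))"
      unfolding A2_def using fS by (intro of_nat_mono card_image_le)
    also have "\<dots> = (\<Sum>vs\<in>tuples k V. real (card (X (Ic vs))))"
      using V finite_tuples[OF V(1)] fX by (subst card_SigmaI) auto
    also have "\<dots> \<le> (\<Sum>vs\<in>tuples k V. \<epsilon> / 2 * card V)" by (intro sum_mono XI)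
    also have "\<dots> = \<epsilon> / 2 * real (card V) ^ Suc k" by (simp add: card_tuples V)
    finally have A2: "real (card A2) \<le> \<epsilon> / 2 * real (card V) ^ Suc k" .
    have fA: "finite (A1 \<union> A2)" unfolding A1_def A2_def using V fm fS by auto
    have "card (mixed (Suc k) V g (\<lambda>vs. sgn (M (map p vs)))) \<le> card A1 + card A2"
      using card_mono[OF fA sub] card_Un_le[of A1 A2] by linarith
    then have "real (card (mixed (Suc k) V g (\<lambda>vs. sgn (M (map p vs))))) \<le> \<epsilon> * real (card V) ^ Suc k"
      using A1 A2 by linarith
    then show ?thesis by (rule block_colorableI[OF V(1) cg])
  qed
  then show ?case by blast
qed

section \<open>Containment in a convex hull\<close>

definition in_cone :: "'a::real_vector \<Rightarrow> 'a set \<Rightarrow> bool" where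
  "in_cone b A \<longleftrightarrow> (\<exists>l. (\<forall>a\<in>A. l a \<ge> 0) \<and> b = (\<Sum>a\<in>A. l a *\<^sub>R a))"

lemma in_coneI:
  assumes "finite R" "finite A" "g ` R \<subseteq> A" "\<And>i. i \<in> R \<Longrightarrow> (l i :: real) \<ge> 0"
  shows "in_cone (\<Sum>i\<in>R. l i *\<^sub>R g i) A"
proof -
  have "(\<Sum>i\<in>R. l i *\<^sub>R g i) = (\<Sum>a\<in>A. \<Sum>i\<in>{i\<in>R. g i = a}. l i *\<^sub>R g i)"
    using sum.group[OF assms(1,2,3), of "\<lambda>i. l i *\<^sub>R g i"] by simp
  also have "\<dots> = (\<Sum>a\<in>A. (\<Sum>i\<in>{i\<in>R. g i = a}. l i) *\<^sub>R a)"
    unfolding scaleR_sum_left by (intro sum.cong) auto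
  finally show ?thesis unfolding in_cone_def
    using assms(4) by (intro exI[of _ "\<lambda>a. \<Sum>i\<in>{i\<in>R. g i = a}. l i"]) (auto intro!: sum_nonneg)
qed

definition row_matrix :: "('n \<Rightarrow> nat + 'n) \<Rightarrow> (real ^ 'n) list \<Rightarrow> real ^ 'n ^ 'n::finite" where
  "row_matrix \<rho> zs = (\<chi> i. case \<rho> i of Inl j \<Rightarrow> zs ! j | Inr k \<Rightarrow> axis k 1)"

text \<open>A list entry may serve as at most one row, so that the determinant is linear in it. Axes
  may repeat, which merely makes the determinant zero.\<close>

definition row_choices :: "nat \<Rightarrow> ('n \<Rightarrow> nat + 'n) set" where
  "row_choices D = {\<rho>. (\<forall>i j. \<rho> i = Inl j \<longrightarrow> j < D) \<and> (\<forall>i i' j. \<rho> i = Inl j \<longrightarrow> \<rho> i' = Inl j \<longrightarrow> i = i')}"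

lemma finite_row_choices: "finite (row_choices D :: ('n::finite \<Rightarrow> nat + 'n) set)"
proof (rule finite_subset)
  show "(row_choices D :: ('n \<Rightarrow> nat + 'n) set) \<subseteq> UNIV \<rightarrow>\<^sub>E (Inl ` {..<D} \<union> range Inr)"
  proof
    fix \<rho> :: "'n \<Rightarrow> nat + 'n" assume \<rho>: "\<rho> \<in> row_choices D"
    have "\<rho> i \<in> Inl ` {..<D} \<union> range Inr" for i
      using \<rho> by (cases "\<rho> i") (auto simp: row_choices_def)
    then show "\<rho> \<in> UNIV \<rightarrow>\<^sub>E (Inl ` {..<D} \<union> range Inr)" by (auto simp: PiE_iff)
  qed
qed (simp add: finite_PiE)

lemma row_combination_exists:
  fixes A :: "real ^ 'n ^ 'n"
  assumes "det A \<noteq> 0"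
  shows "\<exists>x. (\<Sum>i\<in>UNIV. x $ i *\<^sub>R row i A) = b"
proof -
  have "det (transpose A) \<noteq> 0" using assms by simp
  from cramer[OF this] obtain x where "transpose A *v x = b" by blast
  then show ?thesis unfolding matrix_mult_sum by (auto simp: scalar_mult_eq_scaleR)
qed

text \<open>Write the axis as a positive combination of independent \<open>zs\<close> and complete these to a basis by other axes; by
  Cramer's rule the coefficients are quotients of determinants of matrices \<open>row_matrix \<rho> zs\<close>.\<close>

lemma in_cone_determined_by_signs:
  fixes zs ws :: "(real ^ 'n::finite) list"
  assumes len: "length zs = D" "length ws = D"
    and sgn: "\<And>\<rho>. \<rho> \<in> row_choices D \<Longrightarrow> sgn (det (row_matrix \<rho> zs)) = sgn (det (row_matrix \<rho> ws))"
    and z: "in_cone (axis k0 1) (set zs)"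
  shows "in_cone (axis k0 1) (set ws)"
proof -
  let ?b = "axis k0 1 :: real ^ 'n"
  obtain l where l: "\<forall>a\<in>set zs. l a \<ge> 0" "?b = (\<Sum>a\<in>set zs. l a *\<^sub>R a)" using z by (auto simp: in_cone_def)
  obtain I \<mu> where I: "I \<subseteq> set zs" "independent I" "\<forall>a\<in>I. \<mu> a > 0" "?b = (\<Sum>a\<in>I. \<mu> a *\<^sub>R a)"
    using cone_caratheodory[OF finite_set l(2)] l(1) by blast
  \<comment> \<open>The basis is completed by axes only, so that all its members are available as
    rows of some \<open>row_matrix\<close>.\<close>
  obtain E where E: "I \<subseteq> E" "E \<subseteq> I \<union> Basis" "independent E" "I \<union> Basis \<subseteq> span E"
    using maximal_independent_subset_extend[of I "I \<union> Basis"] I(2) by blast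
  have "span E = UNIV"
  proof -
    have "span Basis \<subseteq> span (span E)" using E(4) by (intro span_mono) auto
    then show ?thesis by (auto simp: span_span)
  qed
  then have cE: "card E = CARD('n)" using dim_eq_card[of E UNIV] E(3) by simp
  have finE: "finite E" using E(3) independent_imp_finite by blast
  obtain h where h: "bij_betw h (UNIV :: 'n set) E"
    using finite_same_card_bij[of "UNIV :: 'n set" E] finE cE by auto
  have hE: "h i \<in> E" for i using h by (auto simp: bij_betw_def)
  have inj: "h i = h i' \<Longrightarrow> i = i'" for i i' using h by (auto simp: bij_betw_def inj_on_def)
  have "\<exists>r. (h i \<in> I \<longrightarrow> (\<exists>j<D. r = Inl j \<and> zs ! j = h i)) \<and> (h i \<notin> I \<longrightarrow> (\<exists>k. r = Inr k \<and> h i = axis k 1))" for i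
  proof (cases "h i \<in> I")
    case True
    then show ?thesis using I(1) len(1) by (auto simp: in_set_conv_nth subset_iff)
  next
    case False
    then have "h i \<in> Basis" using hE E(2) by blast
    then show ?thesis using False by (auto simp: Basis_vec_def)
  qed
  then obtain \<rho> where \<rho>: "\<And>i. (h i \<in> I \<longrightarrow> (\<exists>j<D. \<rho> i = Inl j \<and> zs ! j = h i)) \<and> (h i \<notin> I \<longrightarrow> (\<exists>k. \<rho> i = Inr k \<and> h i = axis k 1))"
    by metis
  have \<rho>Inl: "j < D \<and> zs ! j = h i \<and> h i \<in> I" if "\<rho> i = Inl j" for i j
    using \<rho>[of i] that by auto
  have \<rho>I: "\<exists>j<D. \<rho> i = Inl j" if "h i \<in> I" for i using \<rho>[of i] that by blast
  have valid: "\<rho> \<in> row_choices D" using \<rho>Inl inj unfolding row_choices_def by auto metis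
  have valid': "\<rho>(k := Inr k0) \<in> row_choices D" for k
    using valid by (auto simp: row_choices_def split: if_splits)
  define A where "A = row_matrix \<rho> zs"
  define A' where "A' = row_matrix \<rho> ws"
  have rowA: "row i A = h i" for i
  proof (cases "h i \<in> I")
    case True
    then obtain j where "\<rho> i = Inl j" "zs ! j = h i" using \<rho>[of i] by auto
    then show ?thesis by (simp add: A_def row_matrix_def row_def vec_eq_iff)
  next
    case False
    then obtain k where "\<rho> i = Inr k" "h i = axis k 1" using \<rho>[of i] by auto
    then show ?thesis by (simp add: A_def row_matrix_def row_def vec_eq_iff)
  qed
  have detA: "det A \<noteq> 0"
    unfolding invertible_det_nz[symmetric] invertible_right_inverse matrix_right_invertible_independent_rows
  proof (intro allI impI)
    fix c and i :: 'n
    assume "(\<Sum>i\<in>UNIV. c i *s row i A) = 0"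
    then have "(\<Sum>i\<in>UNIV. c i *\<^sub>R h i) = 0" by (simp add: rowA scalar_mult_eq_scaleR)
    moreover have "(\<Sum>i\<in>UNIV. c i *\<^sub>R h i) = (\<Sum>e\<in>E. c (inv h e) *\<^sub>R e)"
    proof -
      have "inv h (h i) = i" for i using inj by (intro inv_f_f) (auto simp: inj_def)
      then show ?thesis using sum.reindex_bij_betw[OF h, of "\<lambda>e. c (inv h e) *\<^sub>R e"] by simp
    qed
    ultimately have "c (inv h (h i)) = 0" using independentD[OF E(3) finE subset_refl, of "\<lambda>e. c (inv h e)" "h i"] hE by simp
    then show "c i = 0" using inj by (simp add: inv_f_f inj_def)
  qed
  then have detA': "det A' \<noteq> 0" "sgn (det A') = sgn (det A)"
    using sgn[OF valid] by (auto simp: A_def A'_def sgn_0_0)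
  obtain y where y: "(\<Sum>i\<in>UNIV. y $ i *\<^sub>R row i A') = ?b" using row_combination_exists[OF detA'(1)] by blast
  define x :: "real ^ 'n" where "x = (\<chi> i. if h i \<in> I then \<mu> (h i) else 0)"
  have "(\<Sum>i\<in>UNIV. x $ i *\<^sub>R row i A) = (\<Sum>i\<in>UNIV. (if h i \<in> I then \<mu> (h i) else 0) *\<^sub>R h i)"
    by (simp add: x_def rowA)
  also have "\<dots> = (\<Sum>e\<in>E. (if e \<in> I then \<mu> e else 0) *\<^sub>R e)"
    by (rule sum.reindex_bij_betw[OF h])
  also have "\<dots> = (\<Sum>e\<in>I. \<mu> e *\<^sub>R e)"
    using E(1) finE by (intro sum.mono_neutral_cong_right) auto
  finally have x: "(\<Sum>i\<in>UNIV. x $ i *\<^sub>R row i A) = ?b" using I(4) by simp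
  \<comment> \<open>The numerators in Cramer's rule replace row \<open>k\<close> by the target. As
    the target is an axis, the result is again given by a row choice, so its sign is covered by the
    assumption.\<close>
  have upd: "(\<chi> i. if i = k then ?b else row i (row_matrix \<rho> vs)) = row_matrix (\<rho>(k := Inr k0)) vs" for k vs
    by (simp add: row_matrix_def row_def vec_eq_iff)
  have "det (row_matrix (\<rho>(k := Inr k0)) zs) = x $ k * det A" for k
    using cramer_lemma_transpose[of k x A, unfolded scalar_mult_eq_scaleR x] unfolding A_def upd .
  moreover have "det (row_matrix (\<rho>(k := Inr k0)) ws) = y $ k * det A'" for k
    using cramer_lemma_transpose[of k y A', unfolded scalar_mult_eq_scaleR y] unfolding A'_def upd .
  ultimately have "sgn (x $ k * det A) = sgn (y $ k * det A')" for k using sgn[OF valid', of k] by simp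
  then have sg: "sgn (x $ k) = sgn (y $ k)" for k using detA'(2) detA by (simp add: sgn_mult sgn_0_0)
  \<comment> \<open>Outside \<open>R\<close> the coefficient \<open>x $ i\<close> is zero, hence so
    is \<open>y $ i\<close>, and the axes drop out of the combination. The default \<open>0\<close>
    in \<open>g\<close> is not reached on \<open>R\<close>.\<close>
  define R where "R = {i. h i \<in> I}"
  define g where "g i = (case \<rho> i of Inl j \<Rightarrow> ws ! j | Inr k \<Rightarrow> 0)" for i
  have "?b = (\<Sum>i\<in>UNIV. y $ i *\<^sub>R row i A')" using y by simp
  also have "\<dots> = (\<Sum>i\<in>R. y $ i *\<^sub>R g i)"
  proof (rule sum.mono_neutral_cong_right)
    show "\<forall>i\<in>UNIV - R. y $ i *\<^sub>R row i A' = 0"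
    proof
      fix i assume "i \<in> UNIV - R"
      then have "sgn (y $ i) = 0" using sg[of i] by (simp add: x_def R_def)
      then show "y $ i *\<^sub>R row i A' = 0" by (simp add: sgn_0_0)
    qed
    show "y $ i *\<^sub>R row i A' = y $ i *\<^sub>R g i" if iR: "i \<in> R" for i
    proof -
      obtain j where "\<rho> i = Inl j" using \<rho>I[of i] iR by (auto simp: R_def)
      then show ?thesis by (simp add: A'_def row_matrix_def row_def g_def vec_eq_iff)
    qed
  qed auto
  finally have b: "?b = (\<Sum>i\<in>R. y $ i *\<^sub>R g i)" .
  show ?thesis unfolding b
  proof (rule in_coneI)
    show "g ` R \<subseteq> set ws"
    proof
      fix z assume "z \<in> g ` R"
      then obtain i where i: "h i \<in> I" "z = g i" by (auto simp: R_def)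
      obtain j where "j < D" "\<rho> i = Inl j" using \<rho>I[OF i(1)] by auto
      then show "z \<in> set ws" using i len(2) by (simp add: g_def)
    qed
    show "y $ i \<ge> 0" if "i \<in> R" for i
    proof -
      have "x $ i > 0" using that I(3) by (simp add: x_def R_def)
      then have "sgn (y $ i) = 1" using sg[of i] by simp
      then show ?thesis by (simp add: sgn_1_pos)
    qed
  qed auto
qed

text \<open>The product makes the determinant multilinear in all \<open>zs\<close>, including those that are not rows; it is \<open>1\<close> on
  the vectors of interest, whose coordinate \<open>k0\<close> is \<open>1\<close>.\<close>

lemma multilin_det_row_matrix:
  fixes \<rho> :: "'n::finite \<Rightarrow> nat + 'n"
  assumes \<rho>: "\<rho> \<in> row_choices D"
  shows "multilin D (\<lambda>zs. det (row_matrix \<rho> zs) * (\<Prod>j\<in>{j\<in>{..<D}. Inl j \<notin> range \<rho>}. zs ! j $ k0))"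
  unfolding multilin_def
proof (intro allI impI)
  fix zs :: "(real ^ 'n) list" and j0
  assume len: "length zs = D" and j0: "j0 < D"
  define P where "P = {j\<in>{..<D}. Inl j \<notin> range \<rho>}"
  have finP: "finite P" by (simp add: P_def)
  show "linear (\<lambda>x. det (row_matrix \<rho> (zs[j0 := x])) * (\<Prod>j\<in>{j\<in>{..<D}. Inl j \<notin> range \<rho>}. zs[j0 := x] ! j $ k0))"
    unfolding P_def[symmetric]
  proof (cases "Inl j0 \<in> range \<rho>")
    case True
    then obtain i0 where i0: "\<rho> i0 = Inl j0" by (metis rangeE)
    have ne: "\<rho> i \<noteq> Inl j0" if "i \<noteq> i0" for i
      using \<rho> i0 that by (auto simp: row_choices_def)
    have mat: "row_matrix \<rho> (zs[j0 := x]) = (\<chi> i. if i = i0 then x else row_matrix \<rho> zs $ i)" for x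
    proof -
      have "(case \<rho> i of Inl j \<Rightarrow> zs[j0 := x] ! j | Inr k \<Rightarrow> axis k 1) = (if i = i0 then x else (case \<rho> i of Inl j \<Rightarrow> zs ! j | Inr k \<Rightarrow> axis k 1))" for i
        using i0 ne[of i] j0 len by (cases "\<rho> i") auto
      then show ?thesis unfolding row_matrix_def by (simp only: vec_lambda_beta)
    qed
    have prd: "(\<Prod>j\<in>P. zs[j0 := x] ! j $ k0) = (\<Prod>j\<in>P. zs ! j $ k0)" for x
    proof (rule prod.cong[OF refl])
      fix j assume "j \<in> P"
      then have "j0 \<noteq> j" using True by (auto simp: P_def)
      then show "zs[j0 := x] ! j $ k0 = zs ! j $ k0" by simp
    qed
    define R where "R = row_matrix \<rho> zs"
    have "linear (\<lambda>x. det ((\<chi> i. if i = i0 then x else R $ i) :: real^'n^'n))"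
    proof (rule linearI)
      show "det ((\<chi> i. if i = i0 then x + y else R $ i) :: real^'n^'n) = det ((\<chi> i. if i = i0 then x else R $ i) :: real^'n^'n) + det ((\<chi> i. if i = i0 then y else R $ i) :: real^'n^'n)" for x y
        by (rule det_row_add[of i0 "\<lambda>_. x" "\<lambda>_. y" "\<lambda>i. R $ i"])
      show "det ((\<chi> i. if i = i0 then c *\<^sub>R x else R $ i) :: real^'n^'n) = c *\<^sub>R det ((\<chi> i. if i = i0 then x else R $ i) :: real^'n^'n)" for c x
        using det_row_mul[of i0 c "\<lambda>_. x" "\<lambda>i. R $ i", unfolded scalar_mult_eq_scaleR] by simp
    qed
    then show "linear (\<lambda>x. det (row_matrix \<rho> (zs[j0 := x])) * (\<Prod>j\<in>P. zs[j0 := x] ! j $ k0))"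
      unfolding mat prd R_def[symmetric] by (auto simp: linear_iff algebra_simps)
  next
    case False
    then have j0P: "j0 \<in> P" using j0 by (auto simp: P_def)
    have mat: "row_matrix \<rho> (zs[j0 := x]) = row_matrix \<rho> zs" for x
    proof -
      have "(case \<rho> i of Inl j \<Rightarrow> zs[j0 := x] ! j | Inr k \<Rightarrow> axis k 1) = (case \<rho> i of Inl j \<Rightarrow> zs ! j | Inr k \<Rightarrow> axis k 1)" for i
      proof (cases "\<rho> i")
        case (Inl j)
        then have "j \<noteq> j0" using False by (metis rangeI)
        then show ?thesis using Inl by simp
      qed simp
      then show ?thesis by (simp add: row_matrix_def)
    qed
    have prd: "(\<Prod>j\<in>P. zs[j0 := x] ! j $ k0) = x $ k0 * (\<Prod>j\<in>P - {j0}. zs ! j $ k0)" for x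
    proof -
      have "(\<Prod>j\<in>P. zs[j0 := x] ! j $ k0) = zs[j0 := x] ! j0 $ k0 * (\<Prod>j\<in>P - {j0}. zs[j0 := x] ! j $ k0)"
        by (rule prod.remove[OF finP j0P])
      also have "(\<Prod>j\<in>P - {j0}. zs[j0 := x] ! j $ k0) = (\<Prod>j\<in>P - {j0}. zs ! j $ k0)"
        by (intro prod.cong) auto
      finally show ?thesis using j0 len by simp
    qed
    show "linear (\<lambda>x. det (row_matrix \<rho> (zs[j0 := x])) * (\<Prod>j\<in>P. zs[j0 := x] ! j $ k0))"
      unfolding mat prd by (auto simp: linear_iff algebra_simps)
  qed
qed

text \<open>The usual lift to one more dimension after moving \<open>x\<close> to the origin. The
  point \<open>x\<close> itself becomes the axis \<open>None\<close>, the fixed target of the cone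
  condition.\<close>

definition homogenize :: "real ^ 'd \<Rightarrow> real ^ 'd \<Rightarrow> real ^ 'd::finite option" where
  "homogenize x y = (\<chi> i. case i of None \<Rightarrow> 1 | Some j \<Rightarrow> (y - x) $ j)"

text \<open>Coordinate \<open>None\<close> of the combination says that the weights sum to 1, the
  other coordinates that the weighted mean of the differences \<open>y - x\<close> vanishes.\<close>

lemma in_convex_hull_iff_in_cone:
  fixes S :: "(real ^ 'd::finite) set"
  assumes "finite S"
  shows "x \<in> convex hull S \<longleftrightarrow> in_cone (axis None 1) (homogenize x ` S)"
proof -
  have inj: "inj_on (homogenize x) S"
  proof (rule inj_onI)
    fix y z assume e: "homogenize x y = homogenize x z"
    have "(y - x) $ j = (z - x) $ j" for j
      using arg_cong[OF e, of "\<lambda>v. v $ Some j"] by (simp add: homogenize_def)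
    then show "y = z" by (simp add: vec_eq_iff)
  qed
  have eq: "axis None 1 = (\<Sum>y\<in>S. u y *\<^sub>R homogenize x y) \<longleftrightarrow> sum u S = 1 \<and> (\<Sum>y\<in>S. u y *\<^sub>R y) = x" for u
  proof -
    have "axis None 1 = (\<Sum>y\<in>S. u y *\<^sub>R homogenize x y) \<longleftrightarrow>
      1 = sum u S \<and> (\<forall>j. 0 = (\<Sum>y\<in>S. u y * (y - x) $ j))"
      unfolding vec_eq_iff split_option_all by (simp add: homogenize_def axis_def)
    also have "\<dots> \<longleftrightarrow> sum u S = 1 \<and> (\<forall>j. (\<Sum>y\<in>S. u y *\<^sub>R y) $ j = sum u S * x $ j)"
    proof -
      have "(\<Sum>y\<in>S. u y * (y - x) $ j) = (\<Sum>y\<in>S. u y *\<^sub>R y) $ j - sum u S * x $ j" for j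
        by (simp add: right_diff_distrib sum_subtractf sum_distrib_right)
      then show ?thesis by (auto simp: eq_commute[of 0])
    qed
    also have "\<dots> \<longleftrightarrow> sum u S = 1 \<and> (\<Sum>y\<in>S. u y *\<^sub>R y) = x"
      by (auto simp: vec_eq_iff)
    finally show ?thesis .
  qed
  have "x \<in> convex hull S \<longleftrightarrow> (\<exists>u. (\<forall>y\<in>S. 0 \<le> u y) \<and> sum u S = 1 \<and> (\<Sum>y\<in>S. u y *\<^sub>R y) = x)"
    by (simp add: convex_hull_finite[OF assms])
  also have "\<dots> \<longleftrightarrow> (\<exists>u. (\<forall>y\<in>S. 0 \<le> u y) \<and> axis None 1 = (\<Sum>y\<in>S. u y *\<^sub>R homogenize x y))"
    unfolding eq ..
  also have "\<dots> \<longleftrightarrow> in_cone (axis None 1) (homogenize x ` S)"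
  proof
    assume "\<exists>u. (\<forall>y\<in>S. 0 \<le> u y) \<and> axis None 1 = (\<Sum>y\<in>S. u y *\<^sub>R homogenize x y)"
    then obtain u where u: "\<forall>y\<in>S. 0 \<le> u y" "axis None 1 = (\<Sum>y\<in>S. u y *\<^sub>R homogenize x y)" by blast
    show "in_cone (axis None 1) (homogenize x ` S)"
      unfolding u(2) by (rule in_coneI) (use assms u in auto)
  next
    assume "in_cone (axis None 1) (homogenize x ` S)"
    then obtain l where l: "\<forall>a\<in>homogenize x ` S. l a \<ge> 0" "axis None 1 = (\<Sum>a\<in>homogenize x ` S. l a *\<^sub>R a)"
      by (auto simp: in_cone_def)
    then show "\<exists>u. (\<forall>y\<in>S. 0 \<le> u y) \<and> axis None 1 = (\<Sum>y\<in>S. u y *\<^sub>R homogenize x y)"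
      by (intro exI[of _ "l \<circ> homogenize x"]) (simp add: sum.reindex[OF inj])
  qed
  finally show ?thesis .
qed

text \<open>If containment differs between two tuples of the same pattern, some determinant sign
  differs as well. The mixed tuples are thus covered by those of finitely many multilinear forms,
  whose number depends only on \<open>D\<close> and the dimension.\<close>

lemma convex_hull_colorable:
  fixes \<epsilon> :: real
  assumes "\<epsilon> > 0"
  shows "\<exists>K. \<forall>(V :: 'v set) (f :: 'v \<Rightarrow> real ^ 'd::finite) x. finite V \<longrightarrow> V \<noteq> {} \<longrightarrow>
     block_colorable K \<epsilon> D V (\<lambda>vs. x \<in> convex hull (f ` set vs))"
proof -
  define P where "P = (row_choices D :: ('d option \<Rightarrow> nat + 'd option) set)"
  have finP: "finite P" by (simp add: P_def finite_row_choices)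
  define \<epsilon>0 where "\<epsilon>0 = \<epsilon> / (real (card P) + 1)"
  have e0: "\<epsilon>0 > 0" using assms by (simp add: \<epsilon>0_def)
  obtain K where K: "\<forall>(V :: 'v set) (p :: 'v \<Rightarrow> real ^ 'd option) M. finite V \<longrightarrow> V \<noteq> {} \<longrightarrow> multilin D M \<longrightarrow>
     block_colorable K \<epsilon>0 D V (\<lambda>vs. sgn (M (map p vs)))"
    using sgn_multilin_colorable[OF e0, where 'v = 'v and 'a = "real ^ 'd option"] ..
  have "block_colorable (K ^ card P) \<epsilon> D V (\<lambda>vs. x \<in> convex hull (f ` set vs))"
    if V: "finite V" "V \<noteq> {}" for V :: "'v set" and f :: "'v \<Rightarrow> real ^ 'd" and x
  proof -
    define p where "p v = homogenize x (f v)" for v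
    define M where "M \<rho> zs = det (row_matrix \<rho> zs) * (\<Prod>j\<in>{j\<in>{..<D}. Inl j \<notin> range \<rho>}. zs ! j $ None)"
      for \<rho> and zs :: "(real ^ 'd option) list"
    have Mdet: "M \<rho> (map p vs) = det (row_matrix \<rho> (map p vs))" if "length vs = D" for \<rho> vs
    proof -
      have "(\<Prod>j\<in>{j\<in>{..<D}. Inl j \<notin> range \<rho>}. map p vs ! j $ None) = 1"
        using that by (intro prod.neutral) (auto simp: p_def homogenize_def)
      then show ?thesis by (simp add: M_def)
    qed
    have bc: "block_colorable K \<epsilon>0 D V (\<lambda>vs. sgn (M \<rho> (map p vs)))" if "\<rho> \<in> P" for \<rho>
      using K[THEN spec, of V, THEN spec, of p, THEN spec, of "M \<rho>"] V
        multilin_det_row_matrix[of \<rho> D None] that unfolding M_def P_def by blast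
    from block_colorable_joint[OF V(1) finP, of K \<epsilon>0 D "\<lambda>\<rho> vs. sgn (M \<rho> (map p vs))", OF bc]
    obtain c :: "'v \<Rightarrow> nat" where c: "c ` V \<subseteq> {..<K ^ card P}"
      "\<forall>\<rho>\<in>P. real (card (mixed D V c (\<lambda>vs. sgn (M \<rho> (map p vs))))) \<le> \<epsilon>0 * real (card V) ^ D"
      by blast
    have key: "x \<in> convex hull (f ` set us)" if us: "us \<in> tuples D V" "vs \<in> tuples D V"
      "x \<in> convex hull (f ` set vs)" "\<forall>\<rho>\<in>P. sgn (M \<rho> (map p us)) = sgn (M \<rho> (map p vs))" for us vs
    proof -
      have len: "length us = D" "length vs = D" using us by (auto simp: tuples_def)
      have im: "homogenize x ` f ` set ys = set (map p ys)" for ys by (auto simp: p_def)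
      have cone: "in_cone (axis None 1) (set (map p vs))" using us(3) in_convex_hull_iff_in_cone[of "f ` set vs" x] im by simp
      have sg: "sgn (det (row_matrix \<rho> (map p vs))) = sgn (det (row_matrix \<rho> (map p us)))"
        if "\<rho> \<in> row_choices D" for \<rho>
        using us(4)[rule_format, of \<rho>] that Mdet[OF len(1)] Mdet[OF len(2)] by (simp add: P_def)
      have "in_cone (axis None 1) (set (map p us))"
        using len by (intro in_cone_determined_by_signs[OF _ _ sg cone]) auto
      then show ?thesis using in_convex_hull_iff_in_cone[of "f ` set us" x] im by simp
    qed
    have "mixed D V c (\<lambda>vs. x \<in> convex hull (f ` set vs)) \<subseteq> (\<Union>\<rho>\<in>P. mixed D V c (\<lambda>vs. sgn (M \<rho> (map p vs))))"
    proof
      fix vs assume "vs \<in> mixed D V c (\<lambda>vs. x \<in> convex hull (f ` set vs))"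
      then obtain us where us: "vs \<in> tuples D V" "us \<in> tuples D V" "map c us = map c vs"
          "x \<in> convex hull (f ` set us) \<longleftrightarrow> x \<notin> convex hull (f ` set vs)"
        unfolding mixed_def by blast
      have "\<exists>\<rho>\<in>P. sgn (M \<rho> (map p us)) \<noteq> sgn (M \<rho> (map p vs))"
      proof (rule ccontr)
        assume "\<not> ?thesis"
        then have *: "\<forall>\<rho>\<in>P. sgn (M \<rho> (map p us)) = sgn (M \<rho> (map p vs))"
          "\<forall>\<rho>\<in>P. sgn (M \<rho> (map p vs)) = sgn (M \<rho> (map p us))" by auto
        show False using key[OF us(2,1) _ *(1)] key[OF us(1,2) _ *(2)] us(4) by blast
      qed
      then show "vs \<in> (\<Union>\<rho>\<in>P. mixed D V c (\<lambda>vs. sgn (M \<rho> (map p vs))))"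
        using us unfolding mixed_def by blast
    qed
    then have "card (mixed D V c (\<lambda>vs. x \<in> convex hull (f ` set vs))) \<le> card (\<Union>\<rho>\<in>P. mixed D V c (\<lambda>vs. sgn (M \<rho> (map p vs))))"
      by (rule card_mono[rotated]) (use finP finite_mixed[OF V(1)] in blast)
    also have "\<dots> \<le> (\<Sum>\<rho>\<in>P. card (mixed D V c (\<lambda>vs. sgn (M \<rho> (map p vs)))))" by (rule card_UN_le[OF finP])
    finally have "real (card (mixed D V c (\<lambda>vs. x \<in> convex hull (f ` set vs)))) \<le> (\<Sum>\<rho>\<in>P. real (card (mixed D V c (\<lambda>vs. sgn (M \<rho> (map p vs))))))"
      by (simp flip: of_nat_sum)
    also have "\<dots> \<le> (\<Sum>\<rho>\<in>P. \<epsilon>0 * real (card V) ^ D)" using c(2) by (intro sum_mono) auto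
    also have "\<dots> = (real (card P) * \<epsilon>0) * real (card V) ^ D" by simp
    also have "\<dots> \<le> \<epsilon> * real (card V) ^ D"
    proof (rule mult_right_mono)
      have "real (card P) * \<epsilon>0 \<le> (real (card P) + 1) * \<epsilon>0" using e0 by (intro mult_right_mono) auto
      also have "\<dots> = \<epsilon>" by (simp add: \<epsilon>0_def)
      finally show "real (card P) * \<epsilon>0 \<le> \<epsilon>" .
    qed simp
    finally show ?thesis unfolding block_colorable_def using c(1) by blast
  qed
  then show ?thesis by blast
qed

section \<open>Perfect matchings avoiding given edges\<close>

lemma exists_uniform_partition:
  assumes "finite U" "card U = m * D"
  shows "\<exists>\<P>. (\<forall>e\<in>\<P>. card e = D) \<and> disjoint \<P> \<and> \<Union>\<P> = U"
  using assms
proof (induction m arbitrary: U)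
  case 0
  then show ?case by (intro exI[of _ "{}"]) auto
next
  case (Suc m)
  show ?case
  proof (cases "D = 0")
    case True
    then show ?thesis using Suc.prems by (intro exI[of _ "{}"]) auto
  next
    case False
    obtain e where e: "e \<subseteq> U" "card e = D" "finite e"
      using obtain_subset_with_card_n[of D U] Suc.prems by auto
    then have "card (U - e) = m * D" using Suc.prems by (simp add: card_Diff_subset)
    then obtain \<P> where P: "\<forall>e\<in>\<P>. card e = D" "disjoint \<P>" "\<Union>\<P> = U - e"
      using Suc.IH[of "U - e"] Suc.prems by auto
    have "disjoint (insert e \<P>)" using P by (auto simp: pairwise_insert disjnt_def)
    then show ?thesis using P e by (intro exI[of _ "insert e \<P>"]) auto
  qed
qed

text \<open>In a partition with the fewest forbidden blocks there are none: otherwise a vertex of a forbidden block can be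
  exchanged with a vertex of another block without creating a new forbidden block.\<close>

lemma exists_avoiding_partition:
  fixes U :: "'v set"
  assumes U: "finite U" "card U = m * D" and D: "D \<ge> 2"
    and F: "finite F" "\<And>e. e \<in> F \<Longrightarrow> card e = D" "\<And>v. v \<in> U \<Longrightarrow> card {e\<in>F. v \<in> e} \<le> r"
    and large: "card U > D + r + r * D * D"
  shows "\<exists>\<P>. (\<forall>e\<in>\<P>. card e = D) \<and> disjoint \<P> \<and> \<Union>\<P> = U \<and> \<P> \<inter> F = {}"
proof -
  define ok where "ok \<P> \<longleftrightarrow> (\<forall>e\<in>\<P>. card e = D) \<and> disjoint \<P> \<and> \<Union>\<P> = U" for \<P>
  obtain \<P>0 where "ok \<P>0" using exists_uniform_partition[OF U] by (auto simp: ok_def)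
  then obtain \<P> where P: "ok \<P>" and min: "\<And>\<Q>. ok \<Q> \<Longrightarrow> card (\<P> \<inter> F) \<le> card (\<Q> \<inter> F)"
    using ex_has_least_nat[of ok \<P>0 "\<lambda>\<P>. card (\<P> \<inter> F)"] by blast
  have Pc: "\<And>e. e \<in> \<P> \<Longrightarrow> card e = D" and PU: "\<Union>\<P> = U"
    and Pd: "\<And>e e'. e \<in> \<P> \<Longrightarrow> e' \<in> \<P> \<Longrightarrow> e \<noteq> e' \<Longrightarrow> e \<inter> e' = {}"
    using P by (auto simp: ok_def pairwise_def disjnt_def)
  have "\<P> \<inter> F = {}"
  proof (rule ccontr)
    assume "\<P> \<inter> F \<noteq> {}"
    then obtain e where e: "e \<in> \<P>" "e \<in> F" by blast
    have eU: "e \<subseteq> U" using e PU by auto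
    have fe: "finite e" by (rule finite_subset[OF eU U(1)])
    have ce: "card e = D" using Pc e by simp
    obtain u where u: "u \<in> e" using ce D by (metis card.empty equals0I not_numeral_le_zero)
    have "card (e - {u}) = D - 1" using ce u fe by simp
    then have "e - {u} \<noteq> {}" using D by (metis card.empty diff_is_0_eq not_less_eq_eq numeral_2_eq_2 One_nat_def)
    then obtain u' where u': "u' \<in> e" "u' \<noteq> u" by blast
    \<comment> \<open>Vertices that must not replace \<open>u\<close> in \<open>e\<close>. The block
      obtained still contains \<open>u'\<close>, so distinct \<open>w\<close> give distinct
      forbidden edges at \<open>u'\<close>, at most \<open>r\<close> in number.\<close>
    define B2 where "B2 = {w \<in> U - e. insert w (e - {u}) \<in> F}"
    define blk where "blk w = (THE e. e \<in> \<P> \<and> w \<in> e)" for w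
    have blk: "blk w = e'" if "e' \<in> \<P>" "w \<in> e'" for w e'
      unfolding blk_def using that Pd by (intro the_equality) blast+
    have blkP: "blk w \<in> \<P>" "w \<in> blk w" if w: "w \<in> U" for w
    proof -
      obtain e' where "e' \<in> \<P>" "w \<in> e'" using w PU by blast
      then show "blk w \<in> \<P>" "w \<in> blk w" using blk by auto
    qed
    \<comment> \<open>Vertices whose block must not receive \<open>u\<close> in their place. Such a
      \<open>w\<close> is found from a forbidden edge at \<open>u\<close>, a vertex
      \<open>w'\<close> of it, and the block of \<open>w'\<close>: at most \<open>r * D * D\<close>
      choices.\<close>
    define B3 where "B3 = {w \<in> U - e. insert u (blk w - {w}) \<in> F}"
    have "card B2 \<le> card {f\<in>F. u' \<in> f}"
    proof (rule card_inj_on_le)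
      show "inj_on (\<lambda>w. insert w (e - {u})) B2" by (rule inj_onI) (auto simp: B2_def)
      show "(\<lambda>w. insert w (e - {u})) ` B2 \<subseteq> {f\<in>F. u' \<in> f}" using u' by (auto simp: B2_def)
      show "finite {f\<in>F. u' \<in> f}" using F by simp
    qed
    also have "\<dots> \<le> r" using F(3) u' eU by blast
    finally have B2: "card B2 \<le> r" .
    define C where "C = {f\<in>F. u \<in> f}"
    have finC: "finite C" and cC: "card C \<le> r" using F u eU by (auto simp: C_def)
    have finf: "finite f" if "f \<in> C" for f using F(2)[of f] that D by (auto simp: C_def intro: card_ge_0_finite)
    have sub: "B3 \<subseteq> (\<Union>f\<in>C. \<Union>w'\<in>f \<inter> U. blk w')"
    proof
      fix w assume w: "w \<in> B3"
      then have wU: "w \<in> U" "w \<notin> e" "insert u (blk w - {w}) \<in> F" by (auto simp: B3_def)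
      have "card (blk w) = D" using blkP[OF wU(1)] Pc by simp
      moreover have fb: "finite (blk w)" by (rule finite_subset[OF _ U(1)]) (use blkP[OF wU(1)] PU in blast)
      ultimately have "card (blk w - {w}) = D - 1" using blkP[OF wU(1)] by simp
      then have "blk w - {w} \<noteq> {}" using D by (metis card.empty diff_is_0_eq not_less_eq_eq numeral_2_eq_2 One_nat_def)
      then obtain w' where w': "w' \<in> blk w" "w' \<noteq> w" by blast
      then have "w' \<in> U" using blkP[OF wU(1)] PU by blast
      moreover have "blk w' = blk w" using blk[OF blkP(1)[OF wU(1)] w'(1)] .
      ultimately show "w \<in> (\<Union>f\<in>C. \<Union>w'\<in>f \<inter> U. blk w')"
        using wU w' blkP[OF wU(1)] by (intro UN_I[of "insert u (blk w - {w})"] UN_I[of w']) (auto simp: C_def)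
    qed
    have "finite (\<Union>f\<in>C. \<Union>w'\<in>f \<inter> U. blk w')"
    proof (rule finite_subset[OF _ U(1)])
      show "(\<Union>f\<in>C. \<Union>w'\<in>f \<inter> U. blk w') \<subseteq> U" using blkP PU by blast
    qed
    then have "card B3 \<le> card (\<Union>f\<in>C. \<Union>w'\<in>f \<inter> U. blk w')" using sub by (rule card_mono)
    also have "\<dots> \<le> (\<Sum>f\<in>C. card (\<Union>w'\<in>f \<inter> U. blk w'))" by (rule card_UN_le[OF finC])
    also have "\<dots> \<le> (\<Sum>f\<in>C. D * D)"
    proof (rule sum_mono)
      fix f assume f: "f \<in> C"
      have "card (\<Union>w'\<in>f \<inter> U. blk w') \<le> (\<Sum>w'\<in>f \<inter> U. card (blk w'))" using finf[OF f] by (intro card_UN_le) simp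
      also have "\<dots> = (\<Sum>w'\<in>f \<inter> U. D)" using blkP Pc by (intro sum.cong) auto
      also have "\<dots> \<le> D * D" using F(2)[of f] f finf[OF f] card_mono[of f "f \<inter> U"] by (simp add: C_def)
      finally show "card (\<Union>w'\<in>f \<inter> U. blk w') \<le> D * D" .
    qed
    also have "\<dots> \<le> r * D * D" using cC by simp
    finally have B3: "card B3 \<le> r * D * D" .
    have "card (e \<union> B2 \<union> B3) \<le> D + r + r * D * D"
      using card_Un_le[of "e \<union> B2" B3] card_Un_le[of e B2] B2 B3 ce by linarith
    then have "\<not> U \<subseteq> e \<union> B2 \<union> B3"
      using large card_mono[of "e \<union> B2 \<union> B3" U] U fe by (auto simp: B2_def B3_def)
    then obtain w where w: "w \<in> U" "w \<notin> e" "insert w (e - {u}) \<notin> F" "insert u (blk w - {w}) \<notin> F"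
      by (auto simp: B2_def B3_def)
    define e' where "e' = blk w"
    have e': "e' \<in> \<P>" "w \<in> e'" "e' \<noteq> e" using blkP[OF w(1)] w(2) by (auto simp: e'_def)
    have dis: "e \<inter> e' = {}" using Pd e e' by blast
    have fe': "finite e'" by (rule finite_subset[OF _ U(1)]) (use e' PU in blast)
    define e1 where "e1 = insert w (e - {u})"
    define e2 where "e2 = insert u (e' - {w})"
    define \<Q> where "\<Q> = insert e1 (insert e2 (\<P> - {e, e'}))"
    have un: "e1 \<union> e2 = e \<union> e'" using u e' dis by (auto simp: e1_def e2_def)
    have d12: "e1 \<inter> e2 = {}" using u e' dis w by (auto simp: e1_def e2_def)
    have rest: "a \<inter> (e \<union> e') = {}" if "a \<in> \<P> - {e, e'}" for a using Pd[of a e] Pd[of a e'] that e e' by blast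
    have "ok \<Q>"
      unfolding ok_def
    proof (intro conjI)
      have "card e1 = D" "card e2 = D" using ce Pc e' fe fe' u w dis D by (auto simp: e1_def e2_def card_insert_if)
      then show "\<forall>e\<in>\<Q>. card e = D" using Pc by (auto simp: \<Q>_def)
      have r1: "a \<inter> e1 = {} \<and> a \<inter> e2 = {}" if "a \<in> \<P> - {e, e'}" for a
        using rest[OF that] un by blast
      show "disjoint \<Q>"
      proof (rule pairwiseI)
        fix a b assume ab: "a \<in> \<Q>" "b \<in> \<Q>" "a \<noteq> b"
        have "a = e1 \<or> a = e2 \<or> a \<in> \<P> - {e, e'}" "b = e1 \<or> b = e2 \<or> b \<in> \<P> - {e, e'}"
          using ab unfolding \<Q>_def by blast+
        then have "a \<inter> b = {}"
        proof (elim disjE)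
          assume "a \<in> \<P> - {e, e'}" "b \<in> \<P> - {e, e'}"
          then show ?thesis using Pd[of a b] ab(3) by blast
        qed (use r1[of a] r1[of b] d12 ab(3) in \<open>simp_all add: Int_commute\<close>)
        then show "disjnt a b" by (simp add: disjnt_def)
      qed
      have "\<Union>\<Q> = e1 \<union> e2 \<union> \<Union>(\<P> - {e, e'})" by (auto simp: \<Q>_def)
      also have "\<dots> = \<Union>\<P>" unfolding un using e e' by blast
      finally show "\<Union>\<Q> = U" using PU by simp
    qed
    then have "card (\<P> \<inter> F) \<le> card (\<Q> \<inter> F)" by (rule min)
    also have "\<dots> \<le> card (\<P> \<inter> F - {e})"
      using w F(1) by (intro card_mono) (auto simp: \<Q>_def e1_def e2_def e'_def)
    also have "\<dots> < card (\<P> \<inter> F)" using e F(1) by (intro card_Diff1_less) auto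
    finally show False by simp
  qed
  then show ?thesis using P unfolding ok_def by blast
qed

text \<open>Blocks and their sequence are ordered: a matching is a linear ordering of
  \<open>U\<close> cut into pieces of length \<open>D\<close>. For positive \<open>D\<close>
  dividing \<open>card U\<close> there are thus exactly \<open>fact (card U)\<close> of them, the
  benchmark in the count below.\<close>

definition matchings :: "nat \<Rightarrow> 'v set \<Rightarrow> 'v list list set" where
  "matchings D U = {bs. (\<forall>b\<in>set bs. length b = D) \<and> distinct (concat bs) \<and> set (concat bs) = U}"

definition avoiding :: "nat \<Rightarrow> 'v set set \<Rightarrow> 'v set \<Rightarrow> 'v list list set" where
  "avoiding D F U = {bs \<in> matchings D U. \<forall>b\<in>set bs. set b \<notin> F}"

lemma length_concat_uniform: "(\<forall>b\<in>set bs. length b = D) \<Longrightarrow> length (concat bs) = D * length bs"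
  by (induction bs) auto

lemma length_matching:
  assumes "bs \<in> matchings D U" shows "D * length bs = card U"
proof -
  have "card U = length (concat bs)" using assms distinct_card[of "concat bs"] by (auto simp: matchings_def)
  then show ?thesis using assms length_concat_uniform[of bs D] by (simp add: matchings_def)
qed

lemma finite_matchings:
  assumes "finite U" "D > 0"
  shows "finite (matchings D U)"
proof (rule finite_subset)
  show "matchings D U \<subseteq> {bs. set bs \<subseteq> {b. set b \<subseteq> U \<and> length b = D} \<and> length bs = card U div D}"
  proof
    fix bs assume bs: "bs \<in> matchings D U"
    then have "length bs = card U div D" using length_matching[OF bs] assms by (metis nonzero_mult_div_cancel_left less_irrefl)
    then show "bs \<in> {bs. set bs \<subseteq> {b. set b \<subseteq> U \<and> length b = D} \<and> length bs = card U div D}"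
      using bs by (auto simp: matchings_def)
  qed
  show "finite {bs. set bs \<subseteq> {b. set b \<subseteq> U \<and> length b = D} \<and> length bs = card U div D}"
    by (intro finite_lists_length_eq assms)
qed

lemma avoiding_nonempty:
  fixes U :: "'v::linorder set"
  assumes U: "finite U" "card U = m * D" and D: "D \<ge> 2"
    and F: "finite F" "\<And>e. e \<in> F \<Longrightarrow> card e = D" "\<And>v. v \<in> U \<Longrightarrow> card {e\<in>F. v \<in> e} \<le> r"
    and large: "card U > D + r + r * D * D"
  shows "avoiding D F U \<noteq> {}"
proof -
  obtain \<P> where P: "\<forall>e\<in>\<P>. card e = D" "disjoint \<P>" "\<Union>\<P> = U" "\<P> \<inter> F = {}"
    using exists_avoiding_partition[OF assms] by blast
  have fin: "finite \<P>" using P(3) U(1) by (metis finite_UnionD)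
  have fine: "finite e" if "e \<in> \<P>" for e using that P(3) U(1) by (metis Union_upper finite_subset)
  obtain ps where ps: "set ps = \<P>" "distinct ps" using finite_distinct_list[OF fin] by blast
  define bs where "bs = map sorted_list_of_set ps"
  have "distinct (concat bs)"
  proof (rule distinct_concat)
    show "distinct bs" unfolding bs_def using ps fine
      by (auto simp: distinct_map intro!: inj_onI) (metis sorted_list_of_set.set_sorted_key_list_of_set)+
    show "distinct ys" if "ys \<in> set bs" for ys using that by (auto simp: bs_def)
    show "set ys \<inter> set zs = {}" if "ys \<in> set bs" "zs \<in> set bs" "ys \<noteq> zs" for ys zs
    proof -
      have "ys \<in> sorted_list_of_set ` \<P>" "zs \<in> sorted_list_of_set ` \<P>" using that ps by (auto simp: bs_def)
      then obtain e e' where e: "ys = sorted_list_of_set e" "zs = sorted_list_of_set e'" "e \<in> \<P>" "e' \<in> \<P>"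
        unfolding image_iff by blast
      then have "disjnt e e'" using P(2) that(3) by (auto simp: pairwise_def)
      then show ?thesis using e fine by (simp add: disjnt_def)
    qed
  qed
  moreover have "set (concat bs) = U" using P(3) ps fine by (auto simp: bs_def)
  ultimately have "bs \<in> avoiding D F U"
    using P fine ps by (auto simp: avoiding_def matchings_def bs_def)
  then show ?thesis by blast
qed

section \<open>Counting ordered blocks and avoiding matchings\<close>

lemma card_distinct_lists_fact:
  assumes "finite U" "D \<le> card U"
  shows "card {b. length b = D \<and> distinct b \<and> set b \<subseteq> U} * fact (card U - D) = (fact (card U) :: nat)"
proof -
  have "card {b. length b = D \<and> distinct b \<and> set b \<subseteq> U} = \<Prod>{card U - D + 1..card U}"
    by (rule card_lists_distinct_length_eq) (use assms in auto)
  also have "\<dots> = fact (card U) div fact (card U - D)"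
    using fact_div_fact[of "card U - D" "card U"] by simp
  finally show ?thesis by (simp add: fact_dvd)
qed

lemma card_orderings:
  assumes "finite e" "card e = D"
  shows "card {b. length b = D \<and> distinct b \<and> set b = e} = fact D"
proof -
  have "{b. length b = D \<and> distinct b \<and> set b = e} = {b. length b = D \<and> distinct b \<and> set b \<subseteq> e}"
  proof -
    have "set b = e" if "length b = D" "distinct b" "set b \<subseteq> e" for b
      using card_subset_eq[OF assms(1) that(3)] distinct_card[OF that(2)] that(1) assms(2) by simp
    then show ?thesis by auto
  qed
  then show ?thesis using card_distinct_lists_fact[of e D] assms by simp
qed

lemma card_avoiding_Suc:
  assumes U: "finite U" and D: "D > 0" and ne: "U \<noteq> {}"
  shows "card (avoiding D F U) =
    (\<Sum>b\<in>{b. length b = D \<and> distinct b \<and> set b \<subseteq> U \<and> set b \<notin> F}. card (avoiding D F (U - set b)))"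
proof -
  let ?FB = "{b. length b = D \<and> distinct b \<and> set b \<subseteq> U \<and> set b \<notin> F}"
  have fin: "finite ?FB" by (rule finite_subset[OF _ finite_lists_length_eq[OF U, of D]]) auto
  have "avoiding D F U = (\<lambda>(b, bs). b # bs) ` (SIGMA b:?FB. avoiding D F (U - set b))"
  proof (intro subset_antisym subsetI)
    fix xs assume xs: "xs \<in> avoiding D F U"
    then have "xs \<noteq> []" using ne by (auto simp: avoiding_def matchings_def)
    then obtain b bs where "xs = b # bs" by (cases xs) auto
    then show "xs \<in> (\<lambda>(b, bs). b # bs) ` (SIGMA b:?FB. avoiding D F (U - set b))"
      using xs by (auto simp: avoiding_def matchings_def image_iff)
  next
    fix xs assume "xs \<in> (\<lambda>(b, bs). b # bs) ` (SIGMA b:?FB. avoiding D F (U - set b))"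
    then obtain b bs where b: "xs = b # bs" "b \<in> ?FB" "bs \<in> avoiding D F (U - set b)" by auto
    then show "xs \<in> avoiding D F U" by (auto simp: avoiding_def matchings_def)
  qed
  moreover have "inj_on (\<lambda>(b, bs). b # bs) (SIGMA b:?FB. avoiding D F (U - set b))" by (auto simp: inj_on_def)
  ultimately have "card (avoiding D F U) = card (SIGMA b:?FB. avoiding D F (U - set b))" by (simp add: card_image)
  also have "\<dots> = (\<Sum>b\<in>?FB. card (avoiding D F (U - set b)))"
    using fin finite_matchings[of "U - set _" D] U D by (intro card_SigmaI) (auto simp: avoiding_def)
  finally show ?thesis .
qed

text \<open>Choosing blocks greedily, each step loses only a factor close to one as long as many vertices remain.\<close>

lemma card_avoiding_lower:
  fixes \<delta> :: real
  assumes D: "D \<ge> 2" and "\<delta> > 0"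
  shows "\<exists>R. \<forall>(U :: 'v::linorder set) F. finite U \<longrightarrow> D dvd card U \<longrightarrow> card U \<ge> R \<longrightarrow> finite F \<longrightarrow>
     (\<forall>e\<in>F. card e = D) \<longrightarrow> (\<forall>v\<in>U. card {e\<in>F. v \<in> e} \<le> r) \<longrightarrow>
     fact (card U) \<le> real (card (avoiding D F U)) * (fact (R + D) * exp (\<delta> * card U))"
proof -
  \<comment> \<open>The fraction of first blocks that one step may lose. Keeping a factor
    \<open>exp (- \<delta> * D)\<close> in each of \<open>card U / D\<close> steps gives
    \<open>exp (- \<delta> * card U)\<close> overall.\<close>
  define \<theta> where "\<theta> = 1 - exp (- \<delta> * D)"
  have \<theta>: "\<theta> > 0" using assms by (simp add: \<theta>_def)
  \<comment> \<open>The first summands make \<open>avoiding_nonempty\<close> applicable; the last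
    makes the forbidden blocks at most a fraction \<theta> of all blocks.\<close>
  define R where "R = D + r + r * D * D + 2 + nat \<lceil>fact D * real r / \<theta>\<rceil>"
  have R1: "fact D * real r \<le> \<theta> * (real n - 1)" if "n \<ge> R" for n
  proof -
    have "fact D * real r / \<theta> \<le> real (nat \<lceil>fact D * real r / \<theta>\<rceil>)" by (rule real_nat_ceiling_ge)
    also have "\<dots> \<le> real n - 1" using that unfolding R_def by linarith
    finally show ?thesis using \<theta> by (simp add: field_simps)
  qed
  have main: "fact (card U) \<le> real (card (avoiding D F U)) * (fact (R + D) * exp (\<delta> * card U))"
    if U: "finite U" "D dvd card U" "card U \<ge> R" and F: "finite F" "\<forall>e\<in>F. card e = D" "\<forall>v\<in>U. card {e\<in>F. v \<in> e} \<le> r"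
    for U :: "'v set" and F
    using U F(3)
  proof (induction "card U" arbitrary: U rule: less_induct)
    case less
    let ?n = "card U"
    have large: "?n > D + r + r * D * D" using less.prems(3) by (simp add: R_def)
    show ?case
    proof (cases "?n < R + D")
      case True
      obtain m where m: "?n = m * D" using less.prems(2) by (metis dvd_div_mult_self)
      \<comment> \<open>When few vertices remain, greedy counting breaks down. One avoiding matching
        is enough here, at the price of the constant \<open>fact (R + D)\<close>.\<close>
      have "avoiding D F U \<noteq> {}"
        using avoiding_nonempty[OF less.prems(1) m D F(1) _ _ large] F(2) less.prems(4) by blast
      moreover have "finite (avoiding D F U)"
        using finite_matchings[OF less.prems(1), of D] D by (simp add: avoiding_def)
      ultimately have "1 \<le> real (card (avoiding D F U))" by (simp add: Suc_leI card_gt_0_iff)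
      moreover have "fact ?n \<le> (fact (R + D) :: real)" using True by (intro fact_mono) auto
      moreover have "1 \<le> exp (\<delta> * ?n)" using assms by simp
      ultimately have "1 * (fact ?n * 1) \<le> real (card (avoiding D F U)) * (fact (R + D) * exp (\<delta> * ?n))"
        by (intro mult_mono) auto
      then show ?thesis by simp
    next
      case False
      then have nR: "?n \<ge> R + D" by simp
      then have Dn: "D \<le> ?n" by simp
      define AB where "AB = {b. length b = D \<and> distinct b \<and> set b \<subseteq> U}"
      define FB where "FB = {b. length b = D \<and> distinct b \<and> set b \<subseteq> U \<and> set b \<notin> F}"
      define CB where "CB = {b. length b = D \<and> distinct b \<and> set b \<subseteq> U \<and> set b \<in> F}"
      define G where "G = (fact (R + D) :: real)"
      have finAB: "finite AB" unfolding AB_def by (rule finite_subset[OF _ finite_lists_length_eq[OF less.prems(1), of D]]) auto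
      have finFB: "finite FB" "finite CB" by (auto intro: finite_subset[OF _ finAB] simp: FB_def CB_def AB_def)
      have AB: "real (card AB) * fact (?n - D) = fact ?n"
        using arg_cong[OF card_distinct_lists_fact[OF less.prems(1) Dn], of real] unfolding AB_def by simp
      have "card AB = card FB + card CB"
        using finFB by (subst card_Un_disjoint[symmetric]) (auto simp: AB_def FB_def CB_def intro: arg_cong[of _ _ card])
      moreover have "card CB \<le> fact D * (r * ?n)"
      proof -
        define C where "C = {e\<in>F. e \<subseteq> U}"
        have "CB = (\<Union>e\<in>C. {b. length b = D \<and> distinct b \<and> set b = e})" by (auto simp: CB_def C_def)
        then have "card CB \<le> (\<Sum>e\<in>C. card {b. length b = D \<and> distinct b \<and> set b = e})"
          using F(1) by (simp add: card_UN_le C_def)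
        also have "\<dots> = (\<Sum>e\<in>C. fact D)"
          using F(2) less.prems(1) by (intro sum.cong card_orderings) (auto simp: C_def intro: finite_subset)
        also have "\<dots> = card C * fact D" by simp
        also have "card C \<le> r * ?n"
        proof -
          have "C \<subseteq> (\<Union>v\<in>U. {e\<in>F. v \<in> e})"
          proof
            fix e assume e: "e \<in> C"
            then have "e \<noteq> {}" using F(2) D by (auto simp: C_def)
            then show "e \<in> (\<Union>v\<in>U. {e\<in>F. v \<in> e})" using e by (auto simp: C_def)
          qed
          then have "card C \<le> card (\<Union>v\<in>U. {e\<in>F. v \<in> e})" using F(1) less.prems(1) by (intro card_mono) auto
          also have "\<dots> \<le> (\<Sum>v\<in>U. card {e\<in>F. v \<in> e})" by (rule card_UN_le[OF less.prems(1)])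
          also have "\<dots> \<le> (\<Sum>v\<in>U. r)" using less.prems(4) by (intro sum_mono) auto
          finally show ?thesis by (simp add: mult.commute)
        qed
        finally show ?thesis by (simp add: mult.commute)
      qed
      ultimately have "card AB \<le> card FB + fact D * (r * ?n)" by linarith
      from of_nat_mono[OF this, where 'a = real]
      have "real (card AB) \<le> real (card FB) + fact D * (real r * real ?n)" by simp
      \<comment> \<open>As \<open>D \<ge> 2\<close>, the number of blocks is at least quadratic in
        the number of vertices, while the forbidden ones are only linearly many.\<close>
      moreover have "real ?n * (real ?n - 1) \<le> real (card AB)"
      proof -
        have n2: "real ?n * (real ?n - 1) * fact (?n - 2) = fact ?n"
        proof -
          obtain k where "?n = Suc (Suc k)" using Dn D by (metis add_2_eq_Suc le_Suc_ex order_trans)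
          then show ?thesis by (simp add: algebra_simps)
        qed
        have "real ?n * (real ?n - 1) * fact (?n - D) \<le> real ?n * (real ?n - 1) * fact (?n - 2)"
          using D Dn by (intro mult_left_mono fact_mono) auto
        also have "\<dots> = fact ?n" by (rule n2)
        also have "\<dots> = real (card AB) * fact (?n - D)" using AB by simp
        finally show ?thesis by simp
      qed
      moreover have "fact D * (real r * real ?n) \<le> \<theta> * (real ?n * (real ?n - 1))"
      proof -
        have "(fact D * real r) * real ?n \<le> (\<theta> * (real ?n - 1)) * real ?n"
          using R1[OF less.prems(3)] by (intro mult_right_mono) auto
        then show ?thesis by (simp add: algebra_simps)
      qed
      moreover have "\<theta> * (real ?n * (real ?n - 1)) \<le> \<theta> * real (card AB)"
        using \<theta> calculation(2) by (intro mult_left_mono) auto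
      ultimately have "(1 - \<theta>) * real (card AB) \<le> real (card FB)" by (simp add: algebra_simps)
      then have FBAB: "exp (- \<delta> * D) * real (card AB) \<le> real (card FB)" by (simp add: \<theta>_def)
      have IH: "fact (?n - D) \<le> real (card (avoiding D F (U - set b))) * (G * exp (\<delta> * (real ?n - real D)))" if b: "b \<in> FB" for b
      proof -
        have bU: "set b \<subseteq> U" "card (set b) = D" using b by (auto simp: FB_def distinct_card)
        then have c: "card (U - set b) = ?n - D" using less.prems(1) by (simp add: card_Diff_subset)
        have "fact (card (U - set b)) \<le> real (card (avoiding D F (U - set b))) * (G * exp (\<delta> * card (U - set b)))"
          unfolding G_def
        proof (rule less.hyps)
          show "card (U - set b) < ?n" using c D Dn by simp
          show "D dvd card (U - set b)" using c less.prems(2) Dn by (simp add: dvd_diff_nat)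
          show "R \<le> card (U - set b)" using c nR by simp
        qed (use less.prems in auto)
        then show ?thesis using c Dn by (simp add: of_nat_diff)
      qed
      have "fact ?n = real (card AB) * fact (?n - D)" using AB by simp
      also have "\<dots> \<le> (exp (\<delta> * D) * real (card FB)) * fact (?n - D)"
      proof (rule mult_right_mono)
        have "exp (\<delta> * D) * (exp (- \<delta> * D) * real (card AB)) \<le> exp (\<delta> * D) * real (card FB)"
          using FBAB by (intro mult_left_mono) auto
        then show "real (card AB) \<le> exp (\<delta> * D) * real (card FB)" by (simp add: mult.assoc[symmetric] flip: exp_add)
      qed simp
      also have "\<dots> = exp (\<delta> * D) * (\<Sum>b\<in>FB. fact (?n - D))" by simp
      also have "\<dots> \<le> exp (\<delta> * D) * (\<Sum>b\<in>FB. real (card (avoiding D F (U - set b))) * (G * exp (\<delta> * (real ?n - real D))))"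
        by (intro mult_left_mono sum_mono IH) auto
      also have "\<dots> = (\<Sum>b\<in>FB. real (card (avoiding D F (U - set b)))) * (G * (exp (\<delta> * D) * exp (\<delta> * (real ?n - real D))))"
        by (simp add: sum_distrib_right sum_distrib_left algebra_simps)
      also have "(\<Sum>b\<in>FB. real (card (avoiding D F (U - set b)))) = real (card (avoiding D F U))"
      proof -
        have "U \<noteq> {}" using Dn D by auto
        then show ?thesis using card_avoiding_Suc[OF less.prems(1), of D F] D by (simp add: FB_def)
      qed
      also have "exp (\<delta> * D) * exp (\<delta> * (real ?n - real D)) = exp (\<delta> * ?n)"
        by (simp add: algebra_simps flip: exp_add)
      finally show ?thesis by (simp add: G_def)
    qed
  qed
  show ?thesis by (intro exI[of _ R] allI impI main) auto
qed

section \<open>Quasirandom unions of matchings\<close>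

text \<open>Weak Stirling bound, by induction from e \<le> (1 + 1/n)^(n+1). The factor
  \<open>real n + 1\<close> instead of \<open>real n\<close> covers \<open>n = 0\<close>.\<close>

lemma fact_mult_exp_le:
  "(fact n :: real) * exp (real n) \<le> exp 1 * (real n + 1) * real n ^ n"
proof (cases "n = 0")
  case False
  then have "n \<ge> 1" by simp
  then have "(fact n :: real) * exp (real n) \<le> exp 1 * real n * real n ^ n"
  proof (induction n rule: nat_induct_at_least)
    case base
    then show ?case by simp
  next
    case (Suc n)
    have n0: "real n > 0" using Suc.hyps by simp
    have "exp (1 / (real n + 1)) \<le> (real n + 1) / real n"
    proof -
      have "1 + - (1 / (real n + 1)) \<le> exp (- (1 / (real n + 1)))" by (rule exp_ge_add_one_self)
      then have "real n / (real n + 1) \<le> exp (- (1 / (real n + 1)))" by (simp add: field_simps)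
      then have "inverse (exp (- (1 / (real n + 1)))) \<le> inverse (real n / (real n + 1))"
        using n0 by (intro le_imp_inverse_le) auto
      then show ?thesis by (simp add: exp_minus)
    qed
    then have "exp (1 / (real n + 1)) ^ Suc n \<le> ((real n + 1) / real n) ^ Suc n" by (rule power_mono) simp
    moreover have "exp (1 / (real n + 1)) ^ Suc n = exp 1"
      unfolding exp_of_nat_mult[symmetric] by (simp add: add.commute)
    ultimately have "exp 1 \<le> (real n + 1) ^ Suc n / real n ^ Suc n" by (simp add: power_divide)
    then have e: "exp 1 * real n ^ Suc n \<le> (real n + 1) ^ Suc n" using n0 by (simp add: field_simps)
    have "(fact (Suc n) :: real) * exp (real (Suc n)) = (real n + 1) * exp 1 * (fact n * exp (real n))"
      by (simp add: exp_add algebra_simps)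
    also have "\<dots> \<le> (real n + 1) * exp 1 * (exp 1 * real n * real n ^ n)"
      using Suc.IH by (intro mult_left_mono) auto
    also have "\<dots> = (real n + 1) * exp 1 * (exp 1 * real n ^ Suc n)" by simp
    also have "\<dots> \<le> (real n + 1) * exp 1 * ((real n + 1) ^ Suc n)"
      using e by (intro mult_left_mono) auto
    finally show ?case by (simp add: algebra_simps)
  qed
  also have "\<dots> \<le> exp 1 * (real n + 1) * real n ^ n" by (intro mult_right_mono) auto
  finally show ?thesis .
qed simp

text \<open>The opposite Stirling bound, by induction from (1 + 1/n)^n \<le> e.\<close>

lemma power_self_le_fact_mult_exp: "real n ^ n \<le> fact n * exp (real n)"
proof (cases "n = 0")
  case False
  then have "n \<ge> 1" by simp
  then show ?thesis
  proof (induction n rule: nat_induct_at_least)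
    case base
    then show ?case by simp
  next
    case (Suc n)
    have n0: "real n > 0" using Suc.hyps by simp
    have "(real n + 1) / real n \<le> exp (1 / real n)"
      using exp_ge_add_one_self[of "1 / real n"] n0 by (simp add: field_simps)
    then have "((real n + 1) / real n) ^ n \<le> exp (1 / real n) ^ n" by (rule power_mono) simp
    also have "\<dots> = exp 1" unfolding exp_of_nat_mult[symmetric] using n0 by simp
    finally have e: "(real n + 1) ^ n \<le> exp 1 * real n ^ n" using n0 by (simp add: power_divide field_simps)
    have "real (Suc n) ^ Suc n = (real n + 1) * (real n + 1) ^ n" by (simp add: add.commute)
    also have "\<dots> \<le> (real n + 1) * (exp 1 * real n ^ n)" using e by (intro mult_left_mono) auto
    also have "\<dots> \<le> (real n + 1) * (exp 1 * (fact n * exp (real n)))"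
      using Suc.IH by (intro mult_left_mono) auto
    also have "\<dots> = fact (Suc n) * exp (real (Suc n))" by (simp add: exp_add algebra_simps)
    finally show ?case .
  qed
qed simp

text \<open>With the colour sequence prescribed, each colour class can only be permuted among the
  places of its colour.\<close>

lemma card_arrangements_with_colors_le:
  fixes c :: "'v \<Rightarrow> nat"
  assumes "finite U" "c ` U \<subseteq> {..<K}"
  shows "card {xs. distinct xs \<and> set xs = U \<and> map c xs = \<kappa>} \<le> (\<Prod>i<K. fact (card {u\<in>U. c u = i}))"
  using assms
proof (induction \<kappa> arbitrary: U)
  case Nil
  have "{xs. distinct xs \<and> set xs = U \<and> map c xs = []} \<subseteq> {[]}" by auto
  from card_mono[OF _ this] have "card {xs. distinct xs \<and> set xs = U \<and> map c xs = []} \<le> 1" by simp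
  also have "1 \<le> (\<Prod>i<K. fact (card {u\<in>U. c u = i}) :: nat)" by (rule prod_ge_1) simp
  finally show ?case .
next
  case (Cons i \<kappa>)
  define Ui where "Ui = {u\<in>U. c u = i}"
  define N where "N W = (\<Prod>j<K. fact (card {u\<in>W. c u = j}) :: nat)" for W
  define A where "A W = {xs. distinct xs \<and> set xs = W \<and> map c xs = \<kappa>}" for W
  have finA: "finite (A W)" if "finite W" for W
    by (rule finite_subset[OF _ finite_lists_length_eq[OF that, of "card W"]]) (auto simp: A_def distinct_card)
  have finUi: "finite Ui" using Cons.prems by (simp add: Ui_def)
  have "{xs. distinct xs \<and> set xs = U \<and> map c xs = i # \<kappa>} \<subseteq> (\<Union>x\<in>Ui. (#) x ` A (U - {x}))"
  proof
    fix ys assume ys: "ys \<in> {xs. distinct xs \<and> set xs = U \<and> map c xs = i # \<kappa>}"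
    then obtain x xs where x: "ys = x # xs" by (cases ys) auto
    then show "ys \<in> (\<Union>x\<in>Ui. (#) x ` A (U - {x}))" using ys by (auto simp: Ui_def A_def)
  qed
  then have "card {xs. distinct xs \<and> set xs = U \<and> map c xs = i # \<kappa>} \<le> card (\<Union>x\<in>Ui. (#) x ` A (U - {x}))"
    using finUi finA Cons.prems by (intro card_mono) auto
  also have "\<dots> \<le> (\<Sum>x\<in>Ui. card ((#) x ` A (U - {x})))" by (rule card_UN_le[OF finUi])
  also have "\<dots> \<le> (\<Sum>x\<in>Ui. card (A (U - {x})))"
    using finA Cons.prems by (intro sum_mono card_image_le) auto
  also have "\<dots> \<le> (\<Sum>x\<in>Ui. N (U - {x}))"
    unfolding A_def N_def using Cons.prems by (intro sum_mono Cons.IH) auto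
  also have "\<dots> \<le> N U"
  proof (cases "Ui = {}")
    case False
    have iK: "i < K" using False Cons.prems by (auto simp: Ui_def)
    have "card Ui * N (U - {x}) = N U" if x: "x \<in> Ui" for x
    proof -
      have "{u\<in>U - {x}. c u = j} = {u\<in>U. c u = j}" if "j \<noteq> i" for j using x that by (auto simp: Ui_def)
      then have "N (U - {x}) = fact (card {u\<in>U - {x}. c u = i}) * (\<Prod>j\<in>{..<K} - {i}. fact (card {u\<in>U. c u = j}))"
        unfolding N_def using iK by (subst prod.remove[of _ i]) auto
      moreover have "N U = fact (card Ui) * (\<Prod>j\<in>{..<K} - {i}. fact (card {u\<in>U. c u = j}))"
        unfolding N_def Ui_def using iK by (subst prod.remove[of _ i]) auto
      moreover have "fact (card Ui) = card Ui * (fact (card {u\<in>U - {x}. c u = i}) :: nat)"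
      proof -
        have "{u\<in>U - {x}. c u = i} = Ui - {x}" by (auto simp: Ui_def)
        then have "Suc (card {u\<in>U - {x}. c u = i}) = card Ui" using x finUi by (simp only: card_Suc_Diff1)
        then show ?thesis by (metis fact_Suc of_nat_id)
      qed
      ultimately show ?thesis by simp
    qed
    then have "(\<Sum>x\<in>Ui. card Ui * N (U - {x})) = card Ui * N U" by simp
    then have "card Ui * (\<Sum>x\<in>Ui. N (U - {x})) = card Ui * N U" by (simp add: sum_distrib_left)
    then show ?thesis using False finUi by simp
  qed simp
  finally show ?case by (simp add: N_def)
qed

lemma card_lists_with_image:
  assumes "finite A"
  shows "card {xs. set xs \<subseteq> A \<and> map f xs = \<kappa>} = prod_list (map (\<lambda>i. card {a\<in>A. f a = i}) \<kappa>)"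
proof (induction \<kappa>)
  case Nil
  have "{xs. set xs \<subseteq> A \<and> map f xs = []} = {[]}" by auto
  then show ?case by simp
next
  case (Cons i \<kappa>)
  have "{xs. set xs \<subseteq> A \<and> map f xs = i # \<kappa>} = (\<lambda>(x, xs). x # xs) ` ({a\<in>A. f a = i} \<times> {xs. set xs \<subseteq> A \<and> map f xs = \<kappa>})"
    by (auto simp: map_eq_Cons_conv image_iff)
  moreover have "inj_on (\<lambda>(x, xs). x # xs) ({a\<in>A. f a = i} \<times> {xs. set xs \<subseteq> A \<and> map f xs = \<kappa>})"
    by (auto simp: inj_on_def)
  ultimately show ?case using Cons.IH by (simp add: card_image card_cartesian_product)
qed

lemma prod_list_concat: "prod_list (map g (concat xss)) = prod_list (map (\<lambda>xs. prod_list (map g xs)) xss)"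
  for g :: "_ \<Rightarrow> 'b::comm_monoid_mult"
  by (induction xss) auto

text \<open>A sum over matchings of a function of the colours exceeds the corresponding sum over independently
  chosen blocks by at most a polynomial factor: the colour sequences of matchings are those in which every colour
  has its expected frequency, and for independent choices this is the most likely frequency vector.\<close>

lemma sum_matchings_le:
  fixes h :: "nat list list \<Rightarrow> real"
  assumes V: "finite V" "card V = m * D" "D > 0" "V \<noteq> {}" and c: "c ` V \<subseteq> {..<K}" and h: "\<And>x. h x \<ge> 0"
  shows "(\<Sum>bs\<in>matchings D V. h (map (map c) bs)) \<le>
     (exp 1 * (real (card V) + 1)) ^ K * fact (card V) / real (card V) ^ card V *
     (\<Sum>bs\<in>tuples m (tuples D V). h (map (map c) bs))"
proof -
  define n where "n = card V"
  have n0: "n > 0" using V(1,4) by (simp add: n_def card_gt_0_iff)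
  define g where "g i = card {v\<in>V. c v = i}" for i
  \<comment> \<open>Colour \<open>i\<close> occurs \<open>g i\<close> times in the colour sequence
    of a matching, so \<zeta> counts the independent choices with that sequence. At most
    \<open>\<Prod>i<K. fact (g i)\<close> matchings have it, and \<rho> bounds the quotient by
    Stirling.\<close>
  define \<zeta> where "\<zeta> = (\<Prod>i<K. real (g i) ^ g i)"
  define \<rho> where "\<rho> = (exp 1 * (real n + 1)) ^ K * fact n / real n ^ n"
  have \<rho>0: "\<rho> \<ge> 0" by (simp add: \<rho>_def)
  have sumg: "(\<Sum>i<K. g i) = n"
  proof -
    have "(\<Sum>i<K. \<Sum>v\<in>{v\<in>V. c v = i}. 1::nat) = (\<Sum>v\<in>V. 1)" using V(1) c by (intro sum.group) auto
    then show ?thesis by (simp add: g_def n_def)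
  qed
  have factprod: "(\<Prod>i<K. fact (g i) :: real) \<le> \<rho> * \<zeta>"
  proof -
    have "(\<Prod>i<K. fact (g i) :: real) * exp (real n) = (\<Prod>i<K. fact (g i) * exp (real (g i)))"
      by (simp add: prod.distrib exp_sum flip: sumg)
    also have "\<dots> \<le> (\<Prod>i<K. exp 1 * (real n + 1) * real (g i) ^ g i)"
    proof (rule prod_mono, intro conjI)
      fix i assume i: "i \<in> {..<K}"
      have "g i \<le> n" unfolding sumg[symmetric] using i by (intro member_le_sum) auto
      have "fact (g i) * exp (real (g i)) \<le> exp 1 * (real (g i) + 1) * real (g i) ^ g i" by (rule fact_mult_exp_le)
      also have "\<dots> \<le> exp 1 * (real n + 1) * real (g i) ^ g i"
        using \<open>g i \<le> n\<close> by (intro mult_right_mono mult_left_mono) auto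
      finally show "fact (g i) * exp (real (g i)) \<le> exp 1 * (real n + 1) * real (g i) ^ g i" .
    qed simp
    also have "\<dots> = (exp 1 * (real n + 1)) ^ K * \<zeta>" by (simp add: \<zeta>_def prod.distrib)
    finally have 1: "(\<Prod>i<K. fact (g i) :: real) * exp (real n) \<le> (exp 1 * (real n + 1)) ^ K * \<zeta>" .
    have "(\<Prod>i<K. fact (g i) :: real) * real n ^ n \<le> (\<Prod>i<K. fact (g i) :: real) * (fact n * exp (real n))"
      using power_self_le_fact_mult_exp[of n] by (intro mult_left_mono prod_nonneg) auto
    also have "\<dots> = fact n * ((\<Prod>i<K. fact (g i) :: real) * exp (real n))" by simp
    also have "\<dots> \<le> fact n * ((exp 1 * (real n + 1)) ^ K * \<zeta>)" using 1 by (intro mult_left_mono) auto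
    finally show ?thesis using n0 by (simp add: \<rho>_def field_simps)
  qed
  have finM: "finite (matchings D V)" using finite_matchings V by blast
  have MT: "matchings D V \<subseteq> tuples m (tuples D V)"
  proof
    fix bs assume bs: "bs \<in> matchings D V"
    then have "length bs = m" using length_matching[OF bs] V by simp
    then show "bs \<in> tuples m (tuples D V)" using bs by (auto simp: matchings_def tuples_def)
  qed
  have finT: "finite (tuples m (tuples D V))" using V by (intro finite_tuples)
  define X where "X = map (map c) ` matchings D V"
  have finX: "finite X" using finM by (simp add: X_def)
  have fibM: "real (card {bs\<in>matchings D V. map (map c) bs = \<kappa>}) \<le> \<rho> * \<zeta>" for \<kappa>
  proof -
    have "card {bs\<in>matchings D V. map (map c) bs = \<kappa>} \<le> card {xs. distinct xs \<and> set xs = V \<and> map c xs = concat \<kappa>}"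
    proof (rule card_inj_on_le)
      show "inj_on concat {bs\<in>matchings D V. map (map c) bs = \<kappa>}"
      proof (rule inj_onI)
        fix x y assume xy: "x \<in> {bs\<in>matchings D V. map (map c) bs = \<kappa>}" "y \<in> {bs\<in>matchings D V. map (map c) bs = \<kappa>}" "concat x = concat y"
        then have "length x = length y" by (metis (mono_tags, lifting) length_map mem_Collect_eq)
        moreover have "\<forall>(a, b)\<in>set (zip x y). length a = length b"
        proof clarify
          fix a b assume "(a, b) \<in> set (zip x y)"
          then have "a \<in> set x" "b \<in> set y" by (auto dest: set_zip_leftD set_zip_rightD)
          then show "length a = length b" using xy by (simp add: matchings_def)
        qed
        ultimately show "x = y" using concat_injective xy(3) by blast
      qed
      show "concat ` {bs\<in>matchings D V. map (map c) bs = \<kappa>} \<subseteq> {xs. distinct xs \<and> set xs = V \<and> map c xs = concat \<kappa>}"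
        by (auto simp: matchings_def map_concat)
      show "finite {xs. distinct xs \<and> set xs = V \<and> map c xs = concat \<kappa>}"
        by (rule finite_subset[OF _ finite_lists_length_eq[OF V(1), of "card V"]]) (auto simp: distinct_card)
    qed
    also have "\<dots> \<le> (\<Prod>i<K. fact (g i))" unfolding g_def by (rule card_arrangements_with_colors_le[OF V(1) c])
    finally have "real (card {bs\<in>matchings D V. map (map c) bs = \<kappa>}) \<le> real (\<Prod>i<K. fact (g i))" by (rule of_nat_mono)
    then show ?thesis using factprod by simp
  qed
  have fibT: "real (card {bs\<in>tuples m (tuples D V). map (map c) bs = \<kappa>}) = \<zeta>" if kX: "\<kappa> \<in> X" for \<kappa>
  proof -
    obtain bs0 where bs0: "bs0 \<in> matchings D V" "\<kappa> = map (map c) bs0" using kX unfolding X_def by blast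
    then have len: "length \<kappa> = m" "\<And>p. p \<in> set \<kappa> \<Longrightarrow> length p = D"
      using subsetD[OF MT bs0(1)] by (auto simp: tuples_def)
    have "{bs\<in>tuples m (tuples D V). map (map c) bs = \<kappa>} = {bs. set bs \<subseteq> tuples D V \<and> map (map c) bs = \<kappa>}"
      using len(1) by (auto simp: tuples_def)
    then have "card {bs\<in>tuples m (tuples D V). map (map c) bs = \<kappa>} = prod_list (map (\<lambda>p. card {b\<in>tuples D V. map c b = p}) \<kappa>)"
      using card_lists_with_image[of "tuples D V"] finite_tuples[OF V(1)] by simp
    also have "map (\<lambda>p. card {b\<in>tuples D V. map c b = p}) \<kappa> = map (\<lambda>p. prod_list (map g p)) \<kappa>"
    proof (rule map_cong[OF refl])
      fix p assume "p \<in> set \<kappa>"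
      then have "length p = D" by (rule len(2))
      then have "{b\<in>tuples D V. map c b = p} = {b. set b \<subseteq> V \<and> map c b = p}" by (auto simp: tuples_def)
      then show "card {b\<in>tuples D V. map c b = p} = prod_list (map g p)"
        using card_lists_with_image[OF V(1), of c p] unfolding g_def[abs_def] by simp
    qed
    also have "prod_list \<dots> = prod_list (map g (concat \<kappa>))" by (rule prod_list_concat[symmetric])
    also have "concat \<kappa> = map c (concat bs0)" using bs0 by (simp add: map_concat)
    also have "prod_list (map g (map c (concat bs0))) = (\<Prod>v\<in>V. g (c v))"
    proof -
      have d: "distinct (concat bs0)" and s: "set (concat bs0) = V" using bs0(1) unfolding matchings_def by blast+
      show ?thesis using prod.distinct_set_conv_list[OF d, of "\<lambda>v. g (c v)", unfolded s] by (simp add: o_def)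
    qed
    also have "\<dots> = (\<Prod>i<K. \<Prod>v\<in>{v\<in>V. c v = i}. g (c v))" using V(1) c by (intro prod.group[symmetric]) auto
    also have "\<dots> = (\<Prod>i<K. g i ^ g i)" by (intro prod.cong) (auto simp: g_def)
    finally show ?thesis by (simp add: \<zeta>_def)
  qed
  have "(\<Sum>bs\<in>matchings D V. h (map (map c) bs)) = (\<Sum>\<kappa>\<in>X. \<Sum>bs\<in>{bs\<in>matchings D V. map (map c) bs = \<kappa>}. h (map (map c) bs))"
    unfolding X_def by (rule sum.image_gen[OF finM])
  also have "\<dots> = (\<Sum>\<kappa>\<in>X. real (card {bs\<in>matchings D V. map (map c) bs = \<kappa>}) * h \<kappa>)"
    by (intro sum.cong) auto
  also have "\<dots> \<le> (\<Sum>\<kappa>\<in>X. \<rho> * \<zeta> * h \<kappa>)" by (intro sum_mono mult_right_mono fibM h)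
  also have "\<dots> = \<rho> * (\<Sum>\<kappa>\<in>X. \<zeta> * h \<kappa>)" by (simp add: sum_distrib_left mult.assoc)
  also have "(\<Sum>\<kappa>\<in>X. \<zeta> * h \<kappa>) = (\<Sum>\<kappa>\<in>X. real (card {bs\<in>tuples m (tuples D V). map (map c) bs = \<kappa>}) * h \<kappa>)"
    using fibT by (intro sum.cong) auto
  also have "\<dots> = (\<Sum>\<kappa>\<in>X. \<Sum>bs\<in>{bs\<in>tuples m (tuples D V). map (map c) bs = \<kappa>}. h (map (map c) bs))"
    by (intro sum.cong) auto
  also have "\<dots> = (\<Sum>bs\<in>(\<Union>\<kappa>\<in>X. {bs\<in>tuples m (tuples D V). map (map c) bs = \<kappa>}). h (map (map c) bs))"
    using finX finT by (intro sum.UNION_disjoint[symmetric]) auto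
  also have "\<rho> * \<dots> \<le> \<rho> * (\<Sum>bs\<in>tuples m (tuples D V). h (map (map c) bs))"
    using \<rho>0 finT h by (intro mult_left_mono sum_mono2) auto
  finally show ?thesis by (simp add: \<rho>_def n_def)
qed

text \<open>Independence in unnormalised form: the expectation of a product over blocks is a
  power.\<close>

lemma sum_tuples_prod_list:
  fixes w :: "'a \<Rightarrow> real"
  assumes "finite A"
  shows "(\<Sum>bs\<in>tuples m A. prod_list (map w bs)) = (\<Sum>a\<in>A. w a) ^ m"
proof (induction m)
  case 0
  have "tuples 0 A = {[]}" by (auto simp: tuples_def)
  then show ?case by simp
next
  case (Suc m)
  have inj: "inj_on (\<lambda>(v, vs). v # vs) (A \<times> tuples m A)" by (auto simp: inj_on_def)
  have "(\<Sum>bs\<in>tuples (Suc m) A. prod_list (map w bs)) = (\<Sum>(a, bs)\<in>A \<times> tuples m A. w a * prod_list (map w bs))"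
    unfolding tuples_Suc by (subst sum.reindex[OF inj]) (auto simp: case_prod_beta)
  also have "\<dots> = (\<Sum>a\<in>A. w a) * (\<Sum>bs\<in>tuples m A. prod_list (map w bs))"
    by (simp add: sum_product sum.cartesian_product)
  finally show ?case using Suc.IH by simp
qed

text \<open>Tuples with repeated vertices count, so this is the probability for \<open>D\<close>
  independent random vertices.\<close>

definition color_density :: "nat \<Rightarrow> 'v set \<Rightarrow> ('v \<Rightarrow> nat) \<Rightarrow> nat list set \<Rightarrow> real" where
  "color_density D V c \<T> = real (card {vs\<in>tuples D V. map c vs \<in> \<T>}) / real (card V) ^ D"

text \<open>A Chernoff estimate. For independent blocks and density q the weight of one block
  averages 1 - q (1 - exp(- t)) \<le> exp(- q (t - t^2/2)); passing to matchings costs the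
  polynomial factor.\<close>

lemma sum_matchings_exp_le:
  assumes V: "finite V" "card V = m * D" "D > 0" "V \<noteq> {}" and c: "c ` V \<subseteq> {..<K}" and t: "t \<ge> 0"
  shows "(\<Sum>bs\<in>matchings D V. exp (- t * real (length (filter (\<lambda>b. map c b \<in> \<T>) bs)))) \<le>
     (exp 1 * (real (card V) + 1)) ^ K * fact (card V) * exp (- (color_density D V c \<T> * (t - t\<^sup>2 / 2)) * real m)"
proof -
  define n where "n = card V"
  have n0: "n > 0" using V(1,4) by (simp add: n_def card_gt_0_iff)
  define w where "w p = (if p \<in> \<T> then exp (- t) else 1)" for p
  define h where "h x = prod_list (map w x)" for x
  have hexp: "h x = exp (- t * real (length (filter (\<lambda>p. p \<in> \<T>) x)))" for x
    unfolding h_def by (induction x) (auto simp: w_def exp_add[symmetric] algebra_simps)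
  have filt: "length (filter (\<lambda>p. p \<in> \<T>) (map (map c) bs)) = length (filter (\<lambda>b. map c b \<in> \<T>) bs)" for bs
    by (simp add: filter_map o_def)
  define q where "q = color_density D V c \<T>"
  have fin: "finite (tuples D V)" by (rule finite_tuples[OF V(1)])
  have cT: "card (tuples D V) = n ^ D" by (simp add: card_tuples V n_def)
  have qc: "real (card {vs\<in>tuples D V. map c vs \<in> \<T>}) = q * real n ^ D" using n0 by (simp add: q_def color_density_def n_def)
  have q0: "q \<ge> 0" by (simp add: q_def color_density_def)
  have w: "(\<Sum>b\<in>tuples D V. w (map c b)) \<le> real n ^ D * exp (- (q * (t - t\<^sup>2 / 2)))"
  proof -
    have "(\<Sum>b\<in>tuples D V. w (map c b)) = (\<Sum>b\<in>tuples D V. 1 - (if map c b \<in> \<T> then 1 - exp (- t) else 0))"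
      by (intro sum.cong) (auto simp: w_def)
    also have "\<dots> = real n ^ D - (\<Sum>b\<in>tuples D V. if map c b \<in> \<T> then 1 - exp (- t) else 0)"
      by (simp add: sum_subtractf cT)
    also have "(\<Sum>b\<in>tuples D V. if map c b \<in> \<T> then 1 - exp (- t) else 0) = q * real n ^ D * (1 - exp (- t))"
      using fin by (simp add: sum.If_cases Int_def qc)
    finally have "(\<Sum>b\<in>tuples D V. w (map c b)) = real n ^ D * (1 - q * (1 - exp (- t)))" by (simp add: algebra_simps)
    also have "\<dots> \<le> real n ^ D * (1 - q * (t - t\<^sup>2 / 2))"
    proof -
      have "exp (- t) \<le> 1 - t + t\<^sup>2 / 2"
      proof -
        \<comment> \<open>The product equals 1 + t^4/4; together with the quadratic lower bound for
          exp t this bounds exp(- t) from above.\<close>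
        have "1 \<le> (1 - t + t\<^sup>2 / 2) * (1 + t + t\<^sup>2 / 2)" using t by (simp add: power2_eq_square algebra_simps)
        also have "\<dots> \<le> (1 - t + t\<^sup>2 / 2) * exp t"
        proof (rule mult_left_mono[OF exp_lower_Taylor_quadratic[OF t]])
          have "1 - t + t\<^sup>2 / 2 = ((1 - t)\<^sup>2 + 1) / 2" by (simp add: power2_eq_square algebra_simps)
          moreover have "0 \<le> ((1 - t)\<^sup>2 + 1) / 2" by simp
          ultimately show "0 \<le> 1 - t + t\<^sup>2 / 2" by (simp only:)
        qed
        finally show ?thesis by (simp add: exp_minus divide_simps)
      qed
      then have "q * (t - t\<^sup>2 / 2) \<le> q * (1 - exp (- t))" using q0 by (intro mult_left_mono) auto
      then show ?thesis by (intro mult_left_mono) auto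
    qed
    also have "\<dots> \<le> real n ^ D * exp (- (q * (t - t\<^sup>2 / 2)))"
      using exp_ge_add_one_self[of "- (q * (t - t\<^sup>2 / 2))"] by (intro mult_left_mono) auto
    finally show ?thesis .
  qed
  have "(\<Sum>bs\<in>matchings D V. exp (- t * real (length (filter (\<lambda>b. map c b \<in> \<T>) bs)))) = (\<Sum>bs\<in>matchings D V. h (map (map c) bs))"
    by (simp only: hexp filt)
  also have "\<dots> \<le> (exp 1 * (real n + 1)) ^ K * fact n / real n ^ n * (\<Sum>bs\<in>tuples m (tuples D V). h (map (map c) bs))"
    unfolding n_def by (rule sum_matchings_le[OF V c]) (simp add: hexp)
  also have "(\<Sum>bs\<in>tuples m (tuples D V). h (map (map c) bs)) = (\<Sum>b\<in>tuples D V. w (map c b)) ^ m"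
    using sum_tuples_prod_list[OF fin, where w = "\<lambda>b. w (map c b)" and m = m] by (simp add: h_def o_def)
  also have "(exp 1 * (real n + 1)) ^ K * fact n / real n ^ n * \<dots> \<le>
     (exp 1 * (real n + 1)) ^ K * fact n / real n ^ n * (real n ^ D * exp (- (q * (t - t\<^sup>2 / 2)))) ^ m"
    using w by (intro mult_left_mono power_mono sum_nonneg) (auto simp: w_def)
  also have "(real n ^ D * exp (- (q * (t - t\<^sup>2 / 2)))) ^ m = real n ^ n * exp (- (q * (t - t\<^sup>2 / 2)) * real m)"
  proof -
    have "D * m = n" using V(2) by (simp add: n_def mult.commute)
    then show ?thesis by (simp only: power_mult_distrib power_mult[symmetric] exp_of_nat2_mult)
  qed
  finally show ?thesis using n0 by (simp add: n_def q_def)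
qed

lemma matching_blocks:
  assumes bs: "bs \<in> matchings D V" and D: "D > 0"
  shows "\<And>b. b \<in> set bs \<Longrightarrow> length b = D \<and> distinct b \<and> set b \<subseteq> V"
    and "distinct (map set bs)"
    and "\<And>v. v \<in> V \<Longrightarrow> card {b\<in>set bs. v \<in> set b} = 1"
proof -
  have len: "\<And>b. b \<in> set bs \<Longrightarrow> length b = D" and s: "(\<Union>b\<in>set bs. set b) = V"
    using bs by (auto simp: matchings_def)
  have ne: "b \<noteq> []" if "b \<in> set bs" for b using len[OF that] D by auto
  then have "removeAll [] bs = bs" by (metis removeAll_id)
  then have d: "distinct bs" "\<And>b. b \<in> set bs \<Longrightarrow> distinct b"
     "\<And>b b'. b \<in> set bs \<Longrightarrow> b' \<in> set bs \<Longrightarrow> b \<noteq> b' \<Longrightarrow> set b \<inter> set b' = {}"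
    using bs by (auto simp: matchings_def distinct_concat_iff)
  show "length b = D \<and> distinct b \<and> set b \<subseteq> V" if "b \<in> set bs" for b
    using len[OF that] d(2)[OF that] s that by blast
  have "inj_on set (set bs)"
  proof (rule inj_onI, rule ccontr)
    fix b b' assume b: "b \<in> set bs" "b' \<in> set bs" "set b = set b'" "b \<noteq> b'"
    then have "set b = {}" using d(3)[OF b(1,2,4)] by simp
    then show False using ne[OF b(1)] by simp
  qed
  then show "distinct (map set bs)" using d(1) by (simp add: distinct_map)
  show "card {b\<in>set bs. v \<in> set b} = 1" if "v \<in> V" for v
  proof -
    obtain b where b: "b \<in> set bs" "v \<in> set b" using s \<open>v \<in> V\<close> by blast
    then have "{b\<in>set bs. v \<in> set b} = {b}" using d(3) by blast
    then show ?thesis by simp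
  qed
qed

text \<open>Method of conditional expectations: matchings are added one at a time, each avoiding the previous edges and
  keeping the sum of the exponential weights over all colourings \<open>c\<close> and pattern sets \<open>\<T>\<close> near its average.\<close>

lemma matching_sequence:
  fixes V :: "nat set" and P :: "((nat \<Rightarrow> nat) \<times> nat list set) set"
  assumes D: "D \<ge> 2" and V: "finite V" "V \<noteq> {}" "card V = m * D"
    and R: "\<And>F. finite F \<Longrightarrow> \<forall>e\<in>F. card e = D \<Longrightarrow> \<forall>v\<in>V. card {e\<in>F. v \<in> e} \<le> r \<Longrightarrow>
      fact (card V) \<le> real (card (avoiding D F V)) * G"
    and P: "finite P" "\<And>c \<T>. (c, \<T>) \<in> P \<Longrightarrow> c ` V \<subseteq> {..<K}" and t: "t \<ge> 0" and jr: "j \<le> r"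
  shows "\<exists>L. (\<forall>b\<in>set L. length b = D \<and> distinct b \<and> set b \<subseteq> V) \<and> distinct (map set L) \<and>
     (\<forall>v\<in>V. card {b\<in>set L. v \<in> set b} = j) \<and> length L = j * m \<and>
     (\<Sum>(c, \<T>)\<in>P. exp (color_density D V c \<T> * (t - t\<^sup>2 / 2) * length L - t * length (filter (\<lambda>b. map c b \<in> \<T>) L)))
       \<le> ((exp 1 * (real (card V) + 1)) ^ K * G) ^ j * card P"
  using jr
proof (induction j)
  case 0
  show ?case by (intro exI[of _ "[]"]) (auto simp: case_prod_beta)
next
  case (Suc j)
  define cnt where "cnt p L = real (length (filter (\<lambda>b. map (fst p) b \<in> snd p) L))" for p :: "(nat \<Rightarrow> nat) \<times> nat list set" and L
  define a where "a p = color_density D V (fst p) (snd p) * (t - t\<^sup>2 / 2)" for p :: "(nat \<Rightarrow> nat) \<times> nat list set"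
  define wt where "wt p L = exp (a p * real (length L) - t * cnt p L)" for p L
  define Q where "Q = (exp 1 * (real (card V) + 1)) ^ K"
  have Q0: "Q > 0" by (simp add: Q_def)
  have wteq: "(\<Sum>(c, \<T>)\<in>P. exp (color_density D V c \<T> * (t - t\<^sup>2 / 2) * length L - t * length (filter (\<lambda>b. map c b \<in> \<T>) L))) = (\<Sum>p\<in>P. wt p L)" for L
    by (simp add: wt_def a_def cnt_def case_prod_beta)
  obtain L where L: "\<forall>b\<in>set L. length b = D \<and> distinct b \<and> set b \<subseteq> V" "distinct (map set L)"
     "\<forall>v\<in>V. card {b\<in>set L. v \<in> set b} = j" "length L = j * m" "(\<Sum>p\<in>P. wt p L) \<le> (Q * G) ^ j * card P"
    using Suc.IH Suc.prems unfolding wteq Q_def by auto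
  define F where "F = set ` set L"
  have F: "finite F" "\<forall>e\<in>F. card e = D" using L(1) by (auto simp: F_def distinct_card)
  have "\<forall>v\<in>V. card {e\<in>F. v \<in> e} \<le> r"
  proof
    fix v assume v: "v \<in> V"
    have "{e\<in>F. v \<in> e} = set ` {b\<in>set L. v \<in> set b}" by (auto simp: F_def)
    then have "card {e\<in>F. v \<in> e} \<le> card {b\<in>set L. v \<in> set b}" by (simp add: card_image_le)
    then show "card {e\<in>F. v \<in> e} \<le> r" using L(3) v Suc.prems by auto
  qed
  from R[OF F this] have av: "fact (card V) \<le> real (card (avoiding D F V)) * G" .
  have finM: "finite (matchings D V)" using D by (intro finite_matchings V(1)) simp
  have finA: "finite (avoiding D F V)" using finM by (simp add: avoiding_def)
  have neA: "avoiding D F V \<noteq> {}"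
  proof
    assume "avoiding D F V = {}"
    then have "fact (card V) \<le> (0::real)" using av by simp
    then show False using fact_gt_zero[of "card V", where 'a = real] by linarith
  qed
  have wtapp: "wt p (bs @ L) = wt p L * (exp (a p * real m) * exp (- t * cnt p bs))" if "bs \<in> matchings D V" for p bs
  proof -
    have "length bs = m" using length_matching[OF that] V D by auto
    then show ?thesis by (simp add: wt_def cnt_def exp_add[symmetric] algebra_simps)
  qed
  define S where "S = (\<Sum>p\<in>P. wt p L)"
  have mgf: "(\<Sum>bs\<in>matchings D V. exp (- t * cnt p bs)) \<le> Q * fact (card V) * exp (- a p * real m)" if "p \<in> P" for p
  proof -
    have "(\<Sum>bs\<in>matchings D V. exp (- t * cnt p bs)) \<le>
      (exp 1 * (real (card V) + 1)) ^ K * fact (card V) * exp (- (color_density D V (fst p) (snd p) * (t - t\<^sup>2 / 2)) * real m)"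
      unfolding cnt_def using V D P(2)[of "fst p" "snd p"] that t by (intro sum_matchings_exp_le) auto
    then show ?thesis by (simp add: Q_def a_def)
  qed
  \<comment> \<open>Weights are nonnegative, so the sum may be extended to all matchings, where the
    Chernoff estimate holds. The averaging over avoiding matchings then loses only the factor
    \<open>G\<close>.\<close>
  have "(\<Sum>bs\<in>avoiding D F V. \<Sum>p\<in>P. wt p (bs @ L)) \<le> (\<Sum>bs\<in>matchings D V. \<Sum>p\<in>P. wt p (bs @ L))"
    using finM by (intro sum_mono2 sum_nonneg) (auto simp: avoiding_def wt_def)
  also have "\<dots> = (\<Sum>bs\<in>matchings D V. \<Sum>p\<in>P. wt p L * exp (a p * real m) * exp (- t * cnt p bs))"
    using wtapp by (intro sum.cong refl) (simp add: mult.assoc)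
  also have "\<dots> = (\<Sum>p\<in>P. wt p L * exp (a p * real m) * (\<Sum>bs\<in>matchings D V. exp (- t * cnt p bs)))"
    unfolding sum_distrib_left by (rule sum.swap)
  also have "\<dots> \<le> (\<Sum>p\<in>P. wt p L * exp (a p * real m) * (Q * fact (card V) * exp (- a p * real m)))"
    using mgf by (intro sum_mono mult_left_mono) (auto simp: wt_def)
  also have "\<dots> = (\<Sum>p\<in>P. wt p L * (Q * fact (card V)))"
    by (intro sum.cong refl) (simp add: exp_minus field_simps)
  also have "\<dots> = S * (Q * fact (card V))" by (simp add: S_def sum_distrib_right)
  also have "\<dots> \<le> S * (Q * (real (card (avoiding D F V)) * G))"
    using av Q0 by (intro mult_left_mono) (auto simp: S_def wt_def sum_nonneg)
  also have "\<dots> = (\<Sum>bs\<in>avoiding D F V. Q * G * S)" by simp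
  finally have le: "(\<Sum>bs\<in>avoiding D F V. \<Sum>p\<in>P. wt p (bs @ L)) \<le> (\<Sum>bs\<in>avoiding D F V. Q * G * S)" .
  have "\<exists>bs\<in>avoiding D F V. (\<Sum>p\<in>P. wt p (bs @ L)) \<le> Q * G * S"
  proof (rule ccontr)
    assume "\<not> ?thesis"
    then have "(\<Sum>bs\<in>avoiding D F V. Q * G * S) < (\<Sum>bs\<in>avoiding D F V. \<Sum>p\<in>P. wt p (bs @ L))"
      using finA neA by (intro sum_strict_mono) auto
    then show False using le by simp
  qed
  then obtain bs where bs: "bs \<in> avoiding D F V" "(\<Sum>p\<in>P. wt p (bs @ L)) \<le> Q * G * S" by blast
  have bsM: "bs \<in> matchings D V" "\<forall>b\<in>set bs. set b \<notin> F" using bs(1) by (auto simp: avoiding_def)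
  note mb = matching_blocks[OF bsM(1)]
  have D0: "D > 0" using D by simp
  show ?case unfolding wteq
  proof (intro exI[of _ "bs @ L"] conjI)
    show "\<forall>b\<in>set (bs @ L). length b = D \<and> distinct b \<and> set b \<subseteq> V" using mb(1)[OF D0] L(1) by auto
    show "distinct (map set (bs @ L))" using mb(2)[OF D0] L(2) bsM(2) by (auto simp: F_def)
    show "\<forall>v\<in>V. card {b\<in>set (bs @ L). v \<in> set b} = Suc j"
    proof
      fix v assume v: "v \<in> V"
      have "{b\<in>set (bs @ L). v \<in> set b} = {b\<in>set bs. v \<in> set b} \<union> {b\<in>set L. v \<in> set b}" by auto
      moreover have "{b\<in>set bs. v \<in> set b} \<inter> {b\<in>set L. v \<in> set b} = {}" using bsM(2) by (auto simp: F_def)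
      ultimately have "card {b\<in>set (bs @ L). v \<in> set b} = card {b\<in>set bs. v \<in> set b} + card {b\<in>set L. v \<in> set b}"
        by (simp add: card_Un_disjoint)
      then show "card {b\<in>set (bs @ L). v \<in> set b} = Suc j" using mb(3)[OF D0 v] L(3) v by simp
    qed
    have "length bs = m" using length_matching[OF bsM(1)] V D by auto
    then show "length (bs @ L) = Suc j * m" using L(4) by simp
    have G0: "Q * G \<ge> 0"
    proof -
      have "real (card (avoiding D F V)) * G > 0" using av fact_gt_zero[of "card V", where 'a = real] by linarith
      then show ?thesis using Q0 by (simp add: zero_less_mult_iff)
    qed
    have "(\<Sum>p\<in>P. wt p (bs @ L)) \<le> Q * G * S" by (rule bs(2))
    also have "\<dots> \<le> Q * G * ((Q * G) ^ j * card P)" using L(5) G0 by (intro mult_left_mono) (auto simp: S_def)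
    finally show "(\<Sum>p\<in>P. wt p (bs @ L)) \<le> ((exp 1 * (real (card V) + 1)) ^ K * G) ^ Suc j * real (card P)"
      by (simp add: Q_def mult.assoc)
  qed
qed

text \<open>The estimate is one-sided because the blocks lie inside the set of tuples to be counted.
  It holds for every colouring, so that one may be chosen after \<open>f\<close> and
  \<open>x\<close>.\<close>

definition quasirandom_regular :: "nat \<Rightarrow> real \<Rightarrow> nat \<Rightarrow> nat \<Rightarrow> nat \<Rightarrow> nat list list \<Rightarrow> bool" where
  "quasirandom_regular K \<epsilon> D r n L \<longleftrightarrow>
     (\<forall>b\<in>set L. length b = D \<and> distinct b \<and> set b \<subseteq> {..<n}) \<and> distinct (map set L) \<and>
     (\<forall>v<n. card {b\<in>set L. v \<in> set b} = r) \<and>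
     (\<forall>c \<T>. c ` {..<n} \<subseteq> {..<K} \<longrightarrow>
        (color_density D {..<n} c \<T> - \<epsilon>) * length L \<le> length (filter (\<lambda>b. map c b \<in> \<T>) L))"

text \<open>The exponential weights are used with parameter \<epsilon>. Their total is at most
  \<open>exp (3 * \<gamma> * n)\<close>, while a single violating pair of a colouring and a pattern
  set would contribute more than \<open>exp (4 * \<gamma> * n)\<close>.\<close>

lemma quasirandom_regular_exists:
  fixes \<epsilon> :: real
  assumes D: "D \<ge> 2" and \<epsilon>: "\<epsilon> > 0"
  shows "\<exists>r0. \<forall>r\<ge>r0. \<exists>n0. \<forall>n\<ge>n0. D dvd n \<longrightarrow> (\<exists>L. quasirandom_regular K \<epsilon> D r n L)"
proof -
  \<comment> \<open>Chosen so that \<open>\<epsilon>\<^sup>2 / 2\<close> times the number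
    \<open>r * m\<close> of edges is \<open>4 * \<gamma> * n\<close> with
    \<open>\<gamma> = \<delta> * r\<close>, one unit more than the three units spent below.\<close>
  define \<delta> where "\<delta> = \<epsilon>\<^sup>2 / (8 * D)"
  have D0: "real D > 0" using D by simp
  have \<delta>: "\<delta> > 0" using \<epsilon> D0 by (simp add: \<delta>_def)
  define r0 where "r0 = nat \<lceil>ln (real K + 1) / \<delta>\<rceil> + 1"
  show ?thesis
  proof (rule exI[of _ r0], intro allI impI)
    fix r assume r: "r \<ge> r0"
    have r1: "r \<ge> 1" using r by (simp add: r0_def)
    have lnK: "ln (real K + 1) \<le> \<delta> * real r"
    proof -
      have "ln (real K + 1) / \<delta> \<le> real (nat \<lceil>ln (real K + 1) / \<delta>\<rceil>)" by (rule real_nat_ceiling_ge)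
      also have "\<dots> \<le> real r" using r unfolding r0_def by linarith
      finally show ?thesis using \<delta> by (simp add: field_simps)
    qed
    obtain R where R: "\<forall>(U :: nat set) F. finite U \<longrightarrow> D dvd card U \<longrightarrow> card U \<ge> R \<longrightarrow> finite F \<longrightarrow>
     (\<forall>e\<in>F. card e = D) \<longrightarrow> (\<forall>v\<in>U. card {e\<in>F. v \<in> e} \<le> r) \<longrightarrow>
     fact (card U) \<le> real (card (avoiding D F U)) * (fact (R + D) * exp (\<delta> * card U))"
      using card_avoiding_lower[OF D \<delta>, of r, where 'v = nat] ..
    define C where "C = (fact (R + D) :: real)"
    define C2 where "C2 = (2::real) ^ (K ^ D)"
    have C0: "C > 0" "C2 > 0" by (auto simp: C_def C2_def)
    define \<gamma> where "\<gamma> = \<delta> * real r"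
    have \<gamma>: "\<gamma> > 0" using \<delta> r1 by (simp add: \<gamma>_def)
    have "(\<lambda>n. ((exp 1 * (real n + 1)) ^ K * C) ^ r * C2 / exp (\<gamma> * real n)) \<longlonglongrightarrow> 0"
      using C0 \<gamma> by real_asymp
    then have "\<forall>\<^sub>F n in sequentially. ((exp 1 * (real n + 1)) ^ K * C) ^ r * C2 / exp (\<gamma> * real n) < 1"
      by (rule order_tendstoD) simp
    then obtain n1 where n1: "\<forall>n\<ge>n1. ((exp 1 * (real n + 1)) ^ K * C) ^ r * C2 / exp (\<gamma> * real n) < 1"
      unfolding eventually_sequentially by blast
    show "\<exists>n0. \<forall>n\<ge>n0. D dvd n \<longrightarrow> (\<exists>L. quasirandom_regular K \<epsilon> D r n L)"
    proof (intro exI[of _ "n1 + R + 1"] allI impI)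
      fix n assume n: "n1 + R + 1 \<le> n" and "D dvd n"
      then obtain m where m: "n = m * D" by (metis dvd_div_mult_self)
      have n0: "n > 0" using n by simp
      define V where "V = {..<n}"
      have V: "finite V" "V \<noteq> {}" "card V = n" using n0 by (auto simp: V_def)
      define P where "P = (V \<rightarrow>\<^sub>E {..<K}) \<times> Pow (tuples D {..<K})"
      have finP: "finite P" unfolding P_def using V by (simp add: finite_PiE finite_tuples)
      have cP: "real (card P) = real K ^ n * C2"
        unfolding P_def card_cartesian_product using V by (simp add: card_PiE card_Pow card_tuples finite_tuples C2_def)
      have PK: "c ` V \<subseteq> {..<K}" if "(c, \<T>) \<in> P" for c \<T> using that by (auto simp: P_def)
      define G where "G = C * exp (\<delta> * n)"
      have RF: "fact (card V) \<le> real (card (avoiding D F V)) * G"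
        if "finite F" "\<forall>e\<in>F. card e = D" "\<forall>v\<in>V. card {e\<in>F. v \<in> e} \<le> r" for F
        using R[THEN spec, of V, THEN spec, of F] that V n \<open>D dvd n\<close> by (simp add: G_def C_def)
      define a where "a c \<T> = color_density D V c \<T>" for c \<T>
      have mD: "card V = m * D" using V m by simp
      have "\<exists>L. (\<forall>b\<in>set L. length b = D \<and> distinct b \<and> set b \<subseteq> V) \<and> distinct (map set L) \<and>
         (\<forall>v\<in>V. card {b\<in>set L. v \<in> set b} = r) \<and> length L = r * m \<and>
         (\<Sum>(c, \<T>)\<in>P. exp (color_density D V c \<T> * (\<epsilon> - \<epsilon>\<^sup>2 / 2) * length L - \<epsilon> * length (filter (\<lambda>b. map c b \<in> \<T>) L)))
            \<le> ((exp 1 * (real (card V) + 1)) ^ K * G) ^ r * card P"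
        by (rule matching_sequence[OF D V(1,2) mD _ finP _ less_imp_le[OF \<epsilon>] order_refl]) (erule (2) RF, erule PK)
      then obtain L where L: "\<forall>b\<in>set L. length b = D \<and> distinct b \<and> set b \<subseteq> V" "distinct (map set L)"
         "\<forall>v\<in>V. card {b\<in>set L. v \<in> set b} = r" "length L = r * m"
         "(\<Sum>(c, \<T>)\<in>P. exp (a c \<T> * (\<epsilon> - \<epsilon>\<^sup>2 / 2) * length L - \<epsilon> * length (filter (\<lambda>b. map c b \<in> \<T>) L)))
            \<le> ((exp 1 * (real n + 1)) ^ K * G) ^ r * card P"
        unfolding V(3) a_def by blast
      have bound: "((exp 1 * (real n + 1)) ^ K * G) ^ r * card P \<le> exp (3 * \<gamma> * n)"
      proof -
        have "((exp 1 * (real n + 1)) ^ K * G) ^ r * card P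
           = (((exp 1 * (real n + 1)) ^ K * C) ^ r * C2) * exp (\<delta> * n) ^ r * real K ^ n"
          by (simp add: cP G_def power_mult_distrib)
        \<comment> \<open>One unit each for the polynomial and constant factors (large
          \<open>n\<close>), for the loss through avoidance, and for the number of colourings (large
          \<open>r\<close>).\<close>
        also have "\<dots> \<le> exp (\<gamma> * n) * exp (\<gamma> * n) * exp (\<gamma> * n)"
        proof (intro mult_mono)
          show "((exp 1 * (real n + 1)) ^ K * C) ^ r * C2 \<le> exp (\<gamma> * n)"
            using n1[rule_format, of n] n by (simp add: divide_simps)
          show "exp (\<delta> * n) ^ r \<le> exp (\<gamma> * n)" by (simp add: \<gamma>_def mult_ac flip: exp_of_nat_mult)
          have "real K \<le> real K + 1" by simp
          also have "\<dots> = exp (ln (real K + 1))" by simp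
          also have "\<dots> \<le> exp \<gamma>" unfolding \<gamma>_def using lnK by (simp only: exp_le_cancel_iff)
          finally have "real K ^ n \<le> exp \<gamma> ^ n" by (rule power_mono) simp
          then show "real K ^ n \<le> exp (\<gamma> * n)" by (simp add: exp_of_nat2_mult)
        qed (use C0 in auto)
        also have "\<dots> = exp (3 * \<gamma> * n)" by (simp flip: exp_add)
        finally show ?thesis .
      qed
      have lenL: "\<epsilon>\<^sup>2 / 2 * real (length L) = 4 * \<gamma> * n"
        using D0 m L(4) by (simp add: \<gamma>_def \<delta>_def field_simps)
      show "\<exists>L. quasirandom_regular K \<epsilon> D r n L"
        unfolding quasirandom_regular_def
      proof (intro exI[of _ L] conjI allI impI)
        show "\<forall>b\<in>set L. length b = D \<and> distinct b \<and> set b \<subseteq> {..<n}" using L(1) by (simp add: V_def)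
        show "distinct (map set L)" by (rule L(2))
        show "card {b\<in>set L. v \<in> set b} = r" if "v < n" for v using L(3) that by (simp add: V_def)
        fix c :: "nat \<Rightarrow> nat" and \<T> :: "nat list set" assume c: "c ` {..<n} \<subseteq> {..<K}"
        \<comment> \<open>Extensional colourings and patterns from a finite set represent all pairs,
          which keeps \<open>P\<close> finite without changing any count.\<close>
        define c' where "c' = restrict c V"
        define \<T>' where "\<T>' = \<T> \<inter> tuples D {..<K}"
        have p: "(c', \<T>') \<in> P" using c by (auto simp: P_def c'_def \<T>'_def V_def)
        have same: "map c' b \<in> \<T>' \<longleftrightarrow> map c b \<in> \<T>" if "length b = D" "set b \<subseteq> V" for b
        proof -
          have "map c' b = map c b" using that by (auto simp: c'_def)
          moreover have "map c b \<in> tuples D {..<K}" using that c by (auto simp: tuples_def V_def)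
          ultimately show ?thesis unfolding \<T>'_def by (simp only: Int_iff simp_thms)
        qed
        have dens: "a c' \<T>' = color_density D {..<n} c \<T>"
        proof -
          have "{vs\<in>tuples D V. map c' vs \<in> \<T>'} = {vs\<in>tuples D V. map c vs \<in> \<T>}"
            using same by (auto simp: tuples_def)
          then show ?thesis by (simp add: a_def color_density_def V_def)
        qed
        have filt: "filter (\<lambda>b. map c' b \<in> \<T>') L = filter (\<lambda>b. map c b \<in> \<T>) L"
          using same L(1) by (intro filter_cong) auto
        define q where "q = color_density D {..<n} c \<T>"
        have q1: "q \<le> 1"
        proof -
          have "card {vs\<in>tuples D V. map c vs \<in> \<T>} \<le> card (tuples D V)"
            using V finite_tuples by (intro card_mono) auto
          also have "\<dots> = n ^ D" by (simp add: card_tuples V)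
          finally have "real (card {vs\<in>tuples D V. map c vs \<in> \<T>}) \<le> real n ^ D"
            by (metis of_nat_le_iff of_nat_power)
          then show ?thesis using n0 by (simp add: q_def color_density_def V_def)
        qed
        show "(color_density D {..<n} c \<T> - \<epsilon>) * length L \<le> length (filter (\<lambda>b. map c b \<in> \<T>) L)"
        proof (rule ccontr)
          define N where "N = real (length (filter (\<lambda>b. map c b \<in> \<T>) L))"
          define l where "l = real (length L)"
          assume "\<not> ?thesis"
          then have lt: "N < (q - \<epsilon>) * l" by (simp add: N_def q_def l_def)
          have l0: "l \<ge> 0" by (simp add: l_def)
          \<comment> \<open>A deviation by \<epsilon> produces the exponent
            \<open>(\<epsilon>\<^sup>2 - q * \<epsilon>\<^sup>2 / 2) * l\<close>, which is at least
            \<open>\<epsilon>\<^sup>2 / 2 * l\<close> because \<open>q \<le> 1\<close>.\<close>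
          have "4 * \<gamma> * n = \<epsilon>\<^sup>2 / 2 * l" using lenL by (simp add: l_def)
          also have "\<dots> \<le> (\<epsilon>\<^sup>2 - q * \<epsilon>\<^sup>2 / 2) * l"
          proof (rule mult_right_mono[OF _ l0])
            have "q * \<epsilon>\<^sup>2 \<le> 1 * \<epsilon>\<^sup>2" using q1 by (rule mult_right_mono) simp
            then show "\<epsilon>\<^sup>2 / 2 \<le> \<epsilon>\<^sup>2 - q * \<epsilon>\<^sup>2 / 2" by simp
          qed
          also have "\<dots> = q * (\<epsilon> - \<epsilon>\<^sup>2 / 2) * l - \<epsilon> * ((q - \<epsilon>) * l)"
            by (simp add: algebra_simps power2_eq_square)
          also have "\<dots> < q * (\<epsilon> - \<epsilon>\<^sup>2 / 2) * l - \<epsilon> * N" using lt \<epsilon> by simp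
          finally have "exp (4 * \<gamma> * n) < exp (q * (\<epsilon> - \<epsilon>\<^sup>2 / 2) * l - \<epsilon> * N)" by simp
          also have "\<dots> = (case (c', \<T>') of (c, \<T>) \<Rightarrow> exp (a c \<T> * (\<epsilon> - \<epsilon>\<^sup>2 / 2) * length L - \<epsilon> * length (filter (\<lambda>b. map c b \<in> \<T>) L)))"
            by (simp add: dens filt q_def N_def l_def)
          also have "\<dots> \<le> (\<Sum>(c, \<T>)\<in>P. exp (a c \<T> * (\<epsilon> - \<epsilon>\<^sup>2 / 2) * length L - \<epsilon> * length (filter (\<lambda>b. map c b \<in> \<T>) L)))"
            by (rule member_le_sum[OF p]) (auto simp: finP case_prod_beta)
          also have "\<dots> \<le> exp (3 * \<gamma> * n)" using L(5) bound by linarith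
          finally show False using \<gamma> n0 by simp
        qed
      qed
    qed
  qed
qed

section \<open>Convergence of the overlap numbers of complete hypergraphs\<close>

lemma convex_hull_near:
  fixes f g :: "'i \<Rightarrow> 'a::euclidean_space"
  assumes "\<And>i. i \<in> e \<Longrightarrow> dist (g i) (f i) \<le> \<eta>" "x \<in> convex hull (g ` e)"
  shows "\<exists>y\<in>convex hull (f ` e). dist x y \<le> \<eta>"
proof -
  let ?S = "\<Union>y\<in>convex hull (f ` e). \<Union>z\<in>cball 0 \<eta>. {y + z}"
  have "convex ?S" by (intro convex_sums) auto
  moreover have "g ` e \<subseteq> ?S"
  proof
    fix w assume "w \<in> g ` e"
    then obtain i where i: "i \<in> e" "w = g i" by blast
    have "f i \<in> convex hull (f ` e)" using i by (simp add: hull_inc)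
    moreover have "g i - f i \<in> cball 0 \<eta>" using assms(1)[OF i(1)] by (simp add: dist_norm norm_minus_commute)
    moreover have "w = f i + (g i - f i)" using i by simp
    ultimately show "w \<in> ?S" by blast
  qed
  ultimately have "x \<in> ?S" using assms(2) hull_minimal[of "g ` e" ?S convex] by blast
  then obtain y z where "y \<in> convex hull (f ` e)" "norm z \<le> \<eta>" "x = y + z" by auto
  then show ?thesis by (intro bexI[of _ y]) (auto simp: dist_norm)
qed

text \<open>By compactness the sum \<open>H\<close> of the distances to all hulls has a positive
  minimum on one of them. A common point after a small perturbation would yield a point of that hull
  with a smaller value.\<close>

lemma empty_intersection_stable:
  fixes f :: "'i \<Rightarrow> 'a::euclidean_space"
  assumes fin: "finite \<F>" "\<And>e. e \<in> \<F> \<Longrightarrow> finite e" and ne: "\<F> \<noteq> {}" and emp: "(\<Inter>e\<in>\<F>. convex hull (f ` e)) = {}"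
  shows "\<exists>\<eta>>0. \<forall>g. (\<forall>e\<in>\<F>. \<forall>i\<in>e. dist (g i) (f i) \<le> \<eta>) \<longrightarrow> (\<Inter>e\<in>\<F>. convex hull (g ` e)) = {}"
proof (cases "{} \<in> \<F>")
  case True
  then have "(\<Inter>e\<in>\<F>. convex hull (g ` e)) = {}" for g :: "'i \<Rightarrow> 'a" by force
  then show ?thesis by (intro exI[of _ 1]) auto
next
  case False
  obtain e0 where e0: "e0 \<in> \<F>" using ne by blast
  define H where "H y = (\<Sum>e\<in>\<F>. infdist y (convex hull (f ` e)))" for y
  have comp: "compact (convex hull (f ` e))" if "e \<in> \<F>" for e
    using fin(2)[OF that] by (intro compact_convex_hull finite_imp_compact) simp
  have nee: "convex hull (f ` e) \<noteq> {}" if "e \<in> \<F>" for e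
    using that False by auto
  have "continuous_on (convex hull (f ` e0)) H" unfolding H_def by (intro continuous_intros)
  then obtain y0 where y0: "y0 \<in> convex hull (f ` e0)" "\<And>y. y \<in> convex hull (f ` e0) \<Longrightarrow> H y0 \<le> H y"
    using continuous_attains_inf[OF comp[OF e0] nee[OF e0]] by blast
  have H0: "H y0 > 0"
  proof -
    obtain e1 where e1: "e1 \<in> \<F>" "y0 \<notin> convex hull (f ` e1)" using emp by blast
    then have "infdist y0 (convex hull (f ` e1)) > 0"
      using infdist_pos_not_in_closed[of "convex hull (f ` e1)" y0] compact_imp_closed[OF comp[OF e1(1)]] nee[OF e1(1)] by blast
    then show ?thesis unfolding H_def using fin(1) e1 by (intro sum_pos2[of _ e1]) (auto simp: infdist_nonneg)
  qed
  have c0: "card \<F> > 0" using fin(1) ne by (simp add: card_gt_0_iff)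
  \<comment> \<open>A perturbation by \<eta> leaves a point of the hull of \<open>e0\<close> within
    \<open>2 * \<eta>\<close> of every hull; the \<open>4\<close> makes \<open>H\<close> at most
    half its minimum there.\<close>
  define \<eta> where "\<eta> = H y0 / (4 * card \<F>)"
  have \<eta>: "\<eta> > 0" using H0 c0 by (simp add: \<eta>_def)
  have "(\<Inter>e\<in>\<F>. convex hull (g ` e)) = {}" if g: "\<forall>e\<in>\<F>. \<forall>i\<in>e. dist (g i) (f i) \<le> \<eta>" for g
  proof (rule ccontr)
    assume "\<not> ?thesis"
    then obtain x where x: "\<And>e. e \<in> \<F> \<Longrightarrow> x \<in> convex hull (g ` e)" by blast
    have near: "\<exists>y\<in>convex hull (f ` e). dist x y \<le> \<eta>" if "e \<in> \<F>" for e
      using convex_hull_near[of e g f \<eta> x] g x[OF that] that by blast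
    obtain y where y: "y \<in> convex hull (f ` e0)" "dist x y \<le> \<eta>" using near[OF e0] by blast
    have "infdist y (convex hull (f ` e)) \<le> 2 * \<eta>" if e: "e \<in> \<F>" for e
    proof -
      obtain z where z: "z \<in> convex hull (f ` e)" "dist x z \<le> \<eta>" using near[OF e] by blast
      have "infdist y (convex hull (f ` e)) \<le> dist y z" using z(1) by (rule infdist_le)
      also have "\<dots> \<le> dist x y + dist x z" by (metis dist_commute dist_triangle)
      finally show ?thesis using y(2) z(2) by linarith
    qed
    then have "H y \<le> (\<Sum>e\<in>\<F>. 2 * \<eta>)" unfolding H_def by (intro sum_mono)
    also have "\<dots> = H y0 / 2" using c0 by (simp add: \<eta>_def)
    finally show False using y0(2)[OF y(1)] H0 by linarith
  qed
  then show ?thesis using \<eta> by blast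
qed

text \<open>One \<eta> serves the finitely many subfamilies of \<open>E\<close> whose hulls have no
  common point. The hulls around \<open>x\<close> do have one after the perturbation, so they had
  one before.\<close>

lemma overlap_upper_semicontinuous:
  fixes f :: "'i \<Rightarrow> 'a::euclidean_space"
  assumes fin: "finite E" "\<And>e. e \<in> E \<Longrightarrow> finite e"
  shows "\<exists>\<eta>>0. \<forall>g x. (\<forall>e\<in>E. \<forall>i\<in>e. dist (g i) (f i) \<le> \<eta>) \<longrightarrow>
     (\<exists>y. {e\<in>E. x \<in> convex hull (g ` e)} \<subseteq> {e\<in>E. y \<in> convex hull (f ` e)})"
proof -
  define B where "B = {\<F>\<in>Pow E. \<F> \<noteq> {} \<and> (\<Inter>e\<in>\<F>. convex hull (f ` e)) = {}}"
  have finB: "finite B" using fin(1) by (simp add: B_def)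
  have "\<forall>\<F>\<in>B. \<exists>\<eta>>0. \<forall>g. (\<forall>e\<in>\<F>. \<forall>i\<in>e. dist (g i) (f i) \<le> \<eta>) \<longrightarrow> (\<Inter>e\<in>\<F>. convex hull (g ` e)) = {}"
  proof
    fix \<F> assume "\<F> \<in> B"
    then have "finite \<F>" "\<And>e. e \<in> \<F> \<Longrightarrow> finite e" "\<F> \<noteq> {}" "(\<Inter>e\<in>\<F>. convex hull (f ` e)) = {}"
      using fin finite_subset[of \<F> E] by (auto simp: B_def)
    then show "\<exists>\<eta>>0. \<forall>g. (\<forall>e\<in>\<F>. \<forall>i\<in>e. dist (g i) (f i) \<le> \<eta>) \<longrightarrow> (\<Inter>e\<in>\<F>. convex hull (g ` e)) = {}"
      by (rule empty_intersection_stable)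
  qed
  then obtain h where h: "\<And>\<F>. \<F> \<in> B \<Longrightarrow> h \<F> > (0::real)"
     "\<And>\<F> g. \<F> \<in> B \<Longrightarrow> (\<forall>e\<in>\<F>. \<forall>i\<in>e. dist (g i) (f i) \<le> h \<F>) \<Longrightarrow> (\<Inter>e\<in>\<F>. convex hull (g ` e)) = {}"
    by (metis (no_types))
  define \<eta> where "\<eta> = Min (insert 1 (h ` B))"
  have \<eta>: "\<eta> > 0" unfolding \<eta>_def using finB h(1) by (subst Min_gr_iff) auto
  have \<eta>le: "\<eta> \<le> h \<F>" if "\<F> \<in> B" for \<F> unfolding \<eta>_def using finB that by (intro Min_le) auto
  have "\<exists>y. {e\<in>E. x \<in> convex hull (g ` e)} \<subseteq> {e\<in>E. y \<in> convex hull (f ` e)}"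
    if g: "\<forall>e\<in>E. \<forall>i\<in>e. dist (g i) (f i) \<le> \<eta>" for g x
  proof -
    define \<F> where "\<F> = {e\<in>E. x \<in> convex hull (g ` e)}"
    have "\<F> \<notin> B"
    proof
      assume F: "\<F> \<in> B"
      have "\<forall>e\<in>\<F>. \<forall>i\<in>e. dist (g i) (f i) \<le> h \<F>"
        using g \<eta>le[OF F] by (force simp: \<F>_def)
      from h(2)[OF F this] have "(\<Inter>e\<in>\<F>. convex hull (g ` e)) = {}" .
      moreover have "x \<in> (\<Inter>e\<in>\<F>. convex hull (g ` e))" by (auto simp: \<F>_def)
      ultimately show False by blast
    qed
    moreover have "\<F> \<in> Pow E" by (auto simp: \<F>_def)
    ultimately have "\<F> = {} \<or> (\<exists>y. y \<in> (\<Inter>e\<in>\<F>. convex hull (f ` e)))" unfolding B_def by blast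
    then show ?thesis unfolding \<F>_def by blast
  qed
  then show ?thesis using \<eta> by blast
qed

section \<open>Complete hypergraphs and their blow-ups\<close>

lemma finite_complete_edges: "finite V \<Longrightarrow> finite (complete_edges k V)"
  by (rule finite_subset[of _ "Pow V"]) (auto simp: complete_edges_def)

lemma card_complete_edges: "finite V \<Longrightarrow> card (complete_edges k V) = card V choose k"
  by (simp add: complete_edges_def n_subsets)

text \<open>Vertex \<open>i + n * s i\<close> is the copy number \<open>s i\<close> of vertex \<open>i\<close> in the \<open>t\<close>-fold blow-up of \<open>{..<n}\<close>.\<close>

lemma card_section_edges:
  fixes n t k :: nat and Q :: "nat set \<Rightarrow> bool"
  assumes n: "n > 0" and t: "t > 0"
  defines "\<Omega> \<equiv> {..<n} \<rightarrow>\<^sub>E {..<t}"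
    and "T \<equiv> {e\<in>complete_edges k {..<n * t}. inj_on (\<lambda>v. v mod n) e}"
  shows "(\<Sum>s\<in>\<Omega>. card {e\<in>complete_edges k {..<n}. Q ((\<lambda>i. i + n * s i) ` e)}) = t ^ (n - k) * card {e\<in>T. Q e}"
proof -
  define h where "h = (\<lambda>(s, e). (\<lambda>i. i + n * s i) ` e :: nat set)"
  define A where "A = {p \<in> \<Omega> \<times> complete_edges k {..<n}. Q (h p)}"
  have fin\<Omega>: "finite \<Omega>" by (simp add: \<Omega>_def finite_PiE)
  have finC: "finite (complete_edges k {..<n})" by (simp add: finite_complete_edges)
  have finA: "finite A" using fin\<Omega> finC by (simp add: A_def)
  have finT: "finite {e\<in>T. Q e}" by (simp add: T_def finite_complete_edges)
  have md: "(i + n * s i) mod n = i" "(i + n * s i) div n = s i" if "i < n" for i and s :: "nat \<Rightarrow> nat"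
    using that n by auto
  have hT: "h p \<in> T" if p: "p \<in> \<Omega> \<times> complete_edges k {..<n}" for p
  proof -
    obtain s e where se: "p = (s, e)" "s \<in> \<Omega>" "e \<subseteq> {..<n}" "card e = k" using p by (auto simp: complete_edges_def)
    have inj: "inj_on (\<lambda>i. i + n * s i) e" by (rule inj_onI) (metis md(1) se(3) lessThan_iff subsetD)
    have lt: "i + n * s i < n * t" if "i \<in> e" for i
    proof -
      have "i < n" "s i < t" using that se by (auto simp: \<Omega>_def)
      then have "n * Suc (s i) \<le> n * t" by (intro mult_le_mono2) simp
      then show ?thesis using \<open>i < n\<close> by simp
    qed
    have "inj_on (\<lambda>v. v mod n) ((\<lambda>i. i + n * s i) ` e)"
      using md(1) se(3) by (auto simp: inj_on_def subset_iff)
    then show ?thesis using lt inj se by (auto simp: h_def T_def complete_edges_def card_image)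
  qed
  \<comment> \<open>A section through \<open>E\<close> is prescribed on the \<open>k\<close>
    vertices below \<open>E\<close> and free on the other \<open>n - k\<close>.\<close>
  have fib: "card {p\<in>A. h p = E} = t ^ (n - k)" if E: "E \<in> {e\<in>T. Q e}" for E
  proof -
    have ET: "E \<subseteq> {..<n * t}" "card E = k" "inj_on (\<lambda>v. v mod n) E" "Q E" using E by (auto simp: T_def complete_edges_def)
    define e where "e = (\<lambda>v. v mod n) ` E"
    define w where "w = inv_into E (\<lambda>v. v mod n)"
    have w: "w i \<in> E" "w i mod n = i" if "i \<in> e" for i
      using that unfolding w_def e_def by (auto intro: inv_into_into f_inv_into_f)
    have w': "w (v mod n) = v" if "v \<in> E" for v unfolding w_def by (rule inv_into_f_f[OF ET(3) that])
    have e: "e \<subseteq> {..<n}" "card e = k" using n ET by (auto simp: e_def card_image)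
    have "{p\<in>A. h p = E} = (\<lambda>s. (s, e)) ` (\<Pi>\<^sub>E i\<in>{..<n}. if i \<in> e then {w i div n} else {..<t})" (is "?L = ?R")
    proof (intro subset_antisym subsetI)
      fix p assume "p \<in> ?L"
      then obtain s e' where p: "p = (s, e')" "s \<in> \<Omega>" "e' \<subseteq> {..<n}" "h (s, e') = E"
        by (auto simp: A_def complete_edges_def)
      have "e = e'"
      proof -
        have "(\<lambda>v. v mod n) ` (\<lambda>i. i + n * s i) ` e' = (\<lambda>i. i) ` e'"
          unfolding image_image using md(1) p(3) by (intro image_cong) auto
        then show ?thesis using p(4) by (simp add: e_def h_def)
      qed
      moreover have "s i = w i div n" if i: "i \<in> e" for i
      proof -
        have "i < n" using i e by auto
        have "i + n * s i \<in> E" using p(4) i \<open>e = e'\<close> by (auto simp: h_def)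
        then have "w i = i + n * s i" using w'[of "i + n * s i"] md(1)[OF \<open>i < n\<close>] by simp
        then show ?thesis using md(2)[OF \<open>i < n\<close>] by simp
      qed
      ultimately show "p \<in> ?R" using p by (auto simp: \<Omega>_def PiE_iff)
    next
      fix p assume "p \<in> ?R"
      then obtain s where s: "p = (s, e)" "s \<in> (\<Pi>\<^sub>E i\<in>{..<n}. if i \<in> e then {w i div n} else {..<t})" by blast
      have si: "s i = w i div n" if "i \<in> e" for i using s(2) that e(1) by (force simp: PiE_iff)
      have wt: "w i div n < t" if "i \<in> e" for i
        using w(1)[OF that] ET(1) n by (auto simp: less_mult_imp_div_less mult.commute)
      have "s \<in> \<Omega>"
      proof -
        have "s i < t" if "i < n" for i
          using PiE_mem[OF s(2), of i] wt[of i] that by (cases "i \<in> e") auto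
        then show ?thesis using s(2) by (auto simp: \<Omega>_def PiE_iff)
      qed
      moreover have "h (s, e) = E"
      proof -
        have "(\<lambda>i. i + n * s i) ` e = w ` e"
        proof (rule image_cong[OF refl])
          fix i assume i: "i \<in> e"
          show "i + n * s i = w i" using si[OF i] w(2)[OF i] by (metis add.commute div_mult_mod_eq mult.commute)
        qed
        also have "\<dots> = E" unfolding e_def image_image using w' by auto
        finally show ?thesis by (simp add: h_def)
      qed
      ultimately show "p \<in> ?L" using s(1) ET(4) e by (auto simp: A_def complete_edges_def)
    qed
    then have "card {p\<in>A. h p = E} = card (\<Pi>\<^sub>E i\<in>{..<n}. if i \<in> e then {w i div n} else {..<t})"
      by (simp add: card_image inj_on_def)
    also have "\<dots> = (\<Prod>i\<in>{..<n}. if i \<in> e then 1 else t)"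
      by (subst card_PiE) (auto intro!: prod.cong)
    also have "\<dots> = t ^ card ({..<n} - e)" by (simp add: prod.If_cases Diff_eq)
    also have "card ({..<n} - e) = n - k" using e by (simp add: card_Diff_subset finite_subset[OF e(1)])
    finally show ?thesis .
  qed
  have "(\<Sum>s\<in>\<Omega>. card {e\<in>complete_edges k {..<n}. Q ((\<lambda>i. i + n * s i) ` e)}) = card (SIGMA s:\<Omega>. {e\<in>complete_edges k {..<n}. Q ((\<lambda>i. i + n * s i) ` e)})"
    using fin\<Omega> finC by (intro card_SigmaI[symmetric]) auto
  also have "(SIGMA s:\<Omega>. {e\<in>complete_edges k {..<n}. Q ((\<lambda>i. i + n * s i) ` e)}) = A" by (auto simp: A_def h_def)
  also have "card A = (\<Sum>E\<in>{e\<in>T. Q e}. card {p\<in>A. h p = E})"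
  proof -
    have "h ` A \<subseteq> {e\<in>T. Q e}" using hT by (auto simp: A_def)
    from sum.group[OF finA finT this, of "\<lambda>_. 1::nat"] show ?thesis by simp
  qed
  also have "\<dots> = t ^ (n - k) * card {e\<in>T. Q e}" using fib by simp
  finally show ?thesis .
qed

section \<open>Asymptotics of binomial coefficients\<close>

lemma binomial_mult_fact_ge:
  assumes "k \<le> n"
  shows "(n - k) ^ k \<le> (n choose k) * fact k"
proof -
  have "(n - k) ^ k = (\<Prod>i\<in>{n - k + 1..n}. n - k)" using assms by simp
  also have "\<dots> \<le> \<Prod>{n - k + 1..n}" by (rule prod_mono) auto
  also have "\<dots> = fact n div fact (n - k)" using fact_div_fact[of "n - k" n] by simp
  also have "\<dots> = (n choose k) * fact k"
  proof -
    have "fact n = ((n choose k) * fact k) * fact (n - k)" using binomial_fact_lemma[OF assms] by (simp add: mult_ac)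
    then show ?thesis by simp
  qed
  finally show ?thesis .
qed

lemma eventually_binomial_ratio_ge:
  fixes \<epsilon> :: real
  assumes "\<epsilon> > 0"
  shows "\<forall>\<^sub>F n in sequentially. real (n choose k) * fact k / real n ^ k \<ge> 1 - \<epsilon>"
proof -
  have "(\<lambda>n. (1 - real k / real n) ^ k) \<longlonglongrightarrow> 1" by real_asymp
  then have "\<forall>\<^sub>F n in sequentially. (1 - real k / real n) ^ k > 1 - \<epsilon>"
    by (rule order_tendstoD) (use assms in simp)
  moreover have "\<forall>\<^sub>F n in sequentially. n \<ge> k + 1" by (rule eventually_ge_at_top)
  ultimately show ?thesis
  proof eventually_elim
    case (elim n)
    then have nk: "k \<le> n" "n > 0" by auto
    have "(1 - real k / real n) ^ k = real ((n - k) ^ k) / real n ^ k"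
      using nk by (simp add: power_divide[symmetric] of_nat_diff diff_divide_distrib)
    also have "\<dots> \<le> real ((n choose k) * fact k) / real n ^ k"
      using binomial_mult_fact_ge[OF nk(1)] by (intro divide_right_mono of_nat_mono) auto
    finally show ?case using elim(1) by simp
  qed
qed

lemma complete_edges_wf:
  assumes "finite V"
  shows "finite (complete_edges (k + 1) V)" "{} \<notin> complete_edges (k + 1) V"
  using assms by (auto simp: finite_complete_edges) (simp add: complete_edges_def)

text \<open>Replacing each point of a bad configuration by a tight cluster gives bad configurations of all larger sizes.\<close>

lemma overlap_number_blow_up:
  fixes n m :: nat and c :: real
  defines "D \<equiv> CARD('d::finite) + 1" and "t \<equiv> m div n + 1"
  assumes n: "n > 0" and c: "c \<le> 1"
    and no: "\<not> has_overlap TYPE('d) {..<n} (complete_edges D {..<n}) c"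
  shows "overlap_number TYPE('d) {..<m} (complete_edges D {..<m}) * real (m choose D) \<le>
    real (n * t choose D) - (1 - c) * (real t ^ D * real (n choose D))"
proof -
  have t0: "t > 0" by (simp add: t_def)
  define C where "C = complete_edges D {..<n}"
  have finC: "finite C" "\<And>e. e \<in> C \<Longrightarrow> finite e"
    by (auto simp: C_def finite_complete_edges complete_edges_def intro: finite_subset)
  have cC: "card C = n choose D" by (simp add: C_def card_complete_edges)
  obtain f :: "nat \<Rightarrow> real ^ 'd" where f: "inj_on f {..<n}"
    "\<And>x. real (card {e\<in>C. x \<in> convex hull (f ` e)}) < c * real (card C)"
    using no by (auto simp: has_overlap_def not_le C_def)
  obtain \<eta> where \<eta>: "\<eta> > 0" "\<And>g x. (\<forall>e\<in>C. \<forall>i\<in>e. dist (g i) (f i) \<le> \<eta>) \<Longrightarrow>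
     \<exists>y. {e\<in>C. x \<in> convex hull (g ` e)} \<subseteq> {e\<in>C. y \<in> convex hull (f ` e)}"
    using overlap_upper_semicontinuous[OF finC, of f] by blast
  \<comment> \<open>Clusters smaller than \<eta> make every section a perturbation of
    \<open>f\<close>; clusters smaller than the least distance between points of \<open>f\<close>
    stay disjoint.\<close>
  define \<zeta> where "\<zeta> = Min (insert \<eta> ((\<lambda>(i, j). dist (f i) (f j)) ` {p\<in>{..<n} \<times> {..<n}. fst p \<noteq> snd p}))"
  have finZ: "finite (insert \<eta> ((\<lambda>(i, j). dist (f i) (f j)) ` {p\<in>{..<n} \<times> {..<n}. fst p \<noteq> snd p}))" by simp
  have \<zeta>: "\<zeta> > 0" unfolding \<zeta>_def using \<eta>(1) f(1) by (subst Min_gr_iff[OF finZ]) (auto simp: inj_on_def)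
  have \<zeta>\<eta>: "\<zeta> \<le> \<eta>" unfolding \<zeta>_def by (rule Min_le[OF finZ]) simp
  have \<zeta>d: "\<zeta> \<le> dist (f i) (f j)" if "i < n" "j < n" "i \<noteq> j" for i j
    unfolding \<zeta>_def by (rule Min_le[OF finZ]) (use that in force)
  obtain u :: "real ^ 'd" where u: "norm u = 1" using vector_choose_size[of 1] by auto
  \<comment> \<open>The copies of a point are lined up along \<open>u\<close> at distinct distances
    below half of \<zeta>, so \<open>f'\<close> is injective on the blow-up.\<close>
  define \<tau> where "\<tau> i = \<zeta> * (real (i div n) / real (2 * t))" for i
  define f' where "f' i = f (i mod n) + \<tau> i *\<^sub>R u" for i
  have \<tau>: "0 \<le> \<tau> i" "\<tau> i < \<zeta> / 2" if "i < n * t" for i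
  proof -
    have "i div n < t" using that by (simp add: less_mult_imp_div_less mult.commute)
    then have "real (i div n) / real (2 * t) < 1 / 2" by (simp add: divide_simps)
    then have "\<zeta> * (real (i div n) / real (2 * t)) < \<zeta> * (1 / 2)" by (rule mult_strict_left_mono[OF _ \<zeta>])
    then show "\<tau> i < \<zeta> / 2" by (simp add: \<tau>_def)
    show "0 \<le> \<tau> i" using \<zeta> by (simp add: \<tau>_def)
  qed
  have inj: "inj_on f' {..<n * t}"
  proof (rule inj_onI)
    fix i j assume ij: "i \<in> {..<n * t}" "j \<in> {..<n * t}" "f' i = f' j"
    have d: "dist (f (i mod n)) (f (j mod n)) < \<zeta>"
    proof -
      have "f (i mod n) - f (j mod n) = (\<tau> j - \<tau> i) *\<^sub>R u" using ij(3) by (simp add: f'_def algebra_simps)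
      then have "dist (f (i mod n)) (f (j mod n)) = \<bar>\<tau> j - \<tau> i\<bar>" using u by (simp add: dist_norm)
      also have "\<dots> < \<zeta>" using \<tau>[of i] \<tau>[of j] ij(1,2) \<zeta> by auto
      finally show ?thesis .
    qed
    have m: "i mod n = j mod n"
    proof (rule ccontr)
      assume "i mod n \<noteq> j mod n"
      then show False using \<zeta>d[of "i mod n" "j mod n"] d n by simp
    qed
    then have "\<tau> i *\<^sub>R u = \<tau> j *\<^sub>R u" using ij(3) by (simp add: f'_def)
    then have "\<tau> i = \<tau> j" using u by auto
    then have "i div n = j div n" using \<zeta> t0 by (simp add: \<tau>_def)
    then show "i = j" using m by (metis div_mult_mod_eq)
  qed
  define T where "T = {e\<in>complete_edges D {..<n * t}. inj_on (\<lambda>v. v mod n) e}"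
  have finM: "finite (complete_edges D {..<n * t})" by (simp add: finite_complete_edges)
  have finT: "finite T" using finM by (simp add: T_def)
  define \<Omega> where "\<Omega> = ({..<n} \<rightarrow>\<^sub>E {..<t})"
  have c\<Omega>: "card \<Omega> = t ^ n" by (simp add: \<Omega>_def card_PiE)
  have cT: "t ^ n * (n choose D) = t ^ (n - D) * card T"
    using card_section_edges[OF n t0, of D "\<lambda>_. True"] by (simp add: \<Omega>_def[symmetric] T_def[symmetric] c\<Omega> cC[unfolded C_def])
  have cT': "real (card T) = real t ^ D * real (n choose D)"
  proof (cases "D \<le> n")
    case True
    then have "real t ^ n = real t ^ D * real t ^ (n - D)" by (simp flip: power_add)
    moreover have "real t ^ n * real (n choose D) = real t ^ (n - D) * real (card T)"
      using arg_cong[OF cT, of real] by simp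
    ultimately have "real t ^ (n - D) * (real t ^ D * real (n choose D)) = real t ^ (n - D) * real (card T)"
      by (simp add: mult_ac)
    then show ?thesis using t0 by simp
  next
    case False
    then show ?thesis using cT t0 by (simp add: binomial_eq_0)
  qed
  \<comment> \<open>Averaging over sections: each one is a small perturbation of the bad
    configuration, and every edge of \<open>T\<close> lies in equally many sections.\<close>
  have tr: "real (card {e\<in>T. x \<in> convex hull (f' ` e)}) \<le> c * card T" for x
  proof -
    have s: "real (card {e\<in>C. x \<in> convex hull (f' ` (\<lambda>i. i + n * s i) ` e)}) \<le> c * real (n choose D)" if s: "s \<in> \<Omega>" for s
    proof -
      define g where "g i = f' (i + n * s i)" for i
      have near: "dist (g i) (f i) \<le> \<eta>" if "i < n" for i
      proof -
        have "s i < t" using s that by (auto simp: \<Omega>_def)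
        then have "n * Suc (s i) \<le> n * t" by (intro mult_le_mono2) simp
        then have "i + n * s i < n * t" using that by simp
        from \<tau>[OF this] have "\<bar>\<tau> (i + n * s i)\<bar> \<le> \<eta>" using \<zeta>\<eta> \<zeta> by linarith
        then show ?thesis using that u by (simp add: g_def f'_def dist_norm)
      qed
      have "\<forall>e\<in>C. \<forall>i\<in>e. dist (g i) (f i) \<le> \<eta>"
        using near by (auto simp: C_def complete_edges_def)
      from \<eta>(2)[OF this, of x] obtain y where y: "{e\<in>C. x \<in> convex hull (g ` e)} \<subseteq> {e\<in>C. y \<in> convex hull (f ` e)}" by blast
      have "card {e\<in>C. x \<in> convex hull (g ` e)} \<le> card {e\<in>C. y \<in> convex hull (f ` e)}"
        by (rule card_mono[OF _ y]) (simp add: finC)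
      then have "real (card {e\<in>C. x \<in> convex hull (g ` e)}) \<le> c * real (n choose D)"
        using f(2)[of y] cC by simp
      then show ?thesis by (simp add: g_def image_image)
    qed
    have "real t ^ (n - D) * real (card {e\<in>T. x \<in> convex hull (f' ` e)}) =
      (\<Sum>s\<in>\<Omega>. real (card {e\<in>C. x \<in> convex hull (f' ` (\<lambda>i. i + n * s i) ` e)}))"
      using arg_cong[OF card_section_edges[OF n t0, of D "\<lambda>e. x \<in> convex hull (f' ` e)"], of real]
      by (simp add: \<Omega>_def T_def C_def)
    also have "\<dots> \<le> (\<Sum>s\<in>\<Omega>. c * real (n choose D))" by (rule sum_mono) (rule s)
    also have "\<dots> = c * (real t ^ n * real (n choose D))" by (simp add: c\<Omega>)
    also have "real t ^ n * real (n choose D) = real t ^ (n - D) * real (card T)"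
      using arg_cong[OF cT, of real] by simp
    finally have "real t ^ (n - D) * real (card {e\<in>T. x \<in> convex hull (f' ` e)}) \<le> real t ^ (n - D) * (c * real (card T))"
      by (simp add: mult_ac)
    then show ?thesis using t0 by simp
  qed
  have mM: "m \<le> n * t"
  proof -
    have "m = n * (m div n) + m mod n" by simp
    also have "\<dots> \<le> n * (m div n) + n" by (intro add_left_mono less_imp_le mod_less_divisor n)
    finally show ?thesis by (simp add: t_def)
  qed
  then have "inj_on f' {..<m}" by (intro inj_on_subset[OF inj]) auto
  with overlap_number_greatest(3)[OF complete_edges_wf[of "{..<m}" "CARD('d)"], where D = "TYPE('d)" and V = "{..<m}"]
  obtain x where "overlap_number TYPE('d) {..<m} (complete_edges D {..<m}) * real (card (complete_edges D {..<m}))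
      \<le> real (card {e\<in>complete_edges D {..<m}. x \<in> convex hull (f' ` e)})"
    unfolding has_overlap_def D_def by auto
  then have "overlap_number TYPE('d) {..<m} (complete_edges D {..<m}) * real (m choose D)
      \<le> real (card {e\<in>complete_edges D {..<m}. x \<in> convex hull (f' ` e)})"
    by (simp add: card_complete_edges)
  \<comment> \<open>Edges with two vertices in one cluster are simply conceded to
    \<open>x\<close>.\<close>
  also have "\<dots> \<le> real (card ({e\<in>T. x \<in> convex hull (f' ` e)} \<union> (complete_edges D {..<n * t} - T)))"
    using mM finM finT by (intro of_nat_mono card_mono) (auto simp: T_def complete_edges_def)
  also have "\<dots> \<le> real (card {e\<in>T. x \<in> convex hull (f' ` e)}) + real (card (complete_edges D {..<n * t} - T))"
    using card_Un_le[of "{e\<in>T. x \<in> convex hull (f' ` e)}" "complete_edges D {..<n * t} - T"] by linarith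
  also have "real (card (complete_edges D {..<n * t} - T)) = real (n * t choose D) - real (card T)"
  proof -
    have sub: "T \<subseteq> complete_edges D {..<n * t}" by (auto simp: T_def)
    have "card T \<le> card (complete_edges D {..<n * t})" by (rule card_mono[OF finM sub])
    then show ?thesis using card_Diff_subset[OF finT sub] by (simp add: card_complete_edges of_nat_diff)
  qed
  also have "real (card {e\<in>T. x \<in> convex hull (f' ` e)}) + (real (n * t choose D) - real (card T)) \<le>
     c * card T + (real (n * t choose D) - real (card T))" using tr[of x] by simp
  also have "\<dots> = real (n * t choose D) - (1 - c) * real (card T)" by (simp add: algebra_simps)
  finally show ?thesis using cT' by simp
qed

text \<open>Let \<open>A\<close> be the infimum of a tail. Some \<open>a n\<close> in that tail is
  below \<open>A + e / 4\<close>, and from then on all terms lie between \<open>A\<close> and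
  \<open>A + e / 2\<close>.\<close>

lemma convergent_if_eventually_below:
  fixes a :: "nat \<Rightarrow> real"
  assumes lb: "\<And>n. 0 \<le> a n"
    and ev: "\<And>\<epsilon>. \<epsilon> > 0 \<Longrightarrow> \<exists>N. \<forall>n\<ge>N. \<exists>M. \<forall>m\<ge>M. a m \<le> a n + \<epsilon>"
  shows "convergent a"
proof (rule Cauchy_convergent, rule metric_CauchyI)
  fix e :: real assume "e > 0"
  then have e: "e / 4 > 0" by simp
  obtain N where N: "\<forall>n\<ge>N. \<exists>M. \<forall>m\<ge>M. a m \<le> a n + e / 4" using ev[OF e] by blast
  define A where "A = Inf (a ` {N..})"
  have bdd: "bdd_below (a ` {N..})" using lb by (intro bdd_belowI[of _ 0]) auto
  have "Inf (a ` {N..}) < A + e / 4" using e by (simp add: A_def)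
  from cInf_lessD[OF _ this] obtain n where n: "n \<ge> N" "a n < A + e / 4" by auto
  obtain M where M: "\<forall>m\<ge>M. a m \<le> a n + e / 4" using N n(1) by blast
  have lo: "A \<le> a m" if "m \<ge> N" for m unfolding A_def using that by (intro cInf_lower bdd) auto
  show "\<exists>M. \<forall>m\<ge>M. \<forall>n\<ge>M. dist (a m) (a n) < e"
  proof (intro exI[of _ "max M N"] allI impI)
    fix i j assume ij: "max M N \<le> i" "max M N \<le> j"
    have "A \<le> a i" "A \<le> a j" "a i \<le> a n + e / 4" "a j \<le> a n + e / 4" using lo M ij by auto
    then show "dist (a i) (a j) < e" using n(2) \<open>e > 0\<close> by (simp add: dist_real_def)
  qed
qed

text \<open>For large \<open>n\<close> and much larger \<open>m\<close>, blowing up an extremal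
  configuration shows that \<open>a m\<close> hardly exceeds \<open>a n\<close>; this is approximate
  monotonicity.\<close>

lemma convergent_overlap_number_complete:
  "convergent (\<lambda>n. overlap_number TYPE('d::finite) {..<n} (complete_edges (CARD('d) + 1) {..<n}))"
proof (rule convergent_if_eventually_below)
  define D where "D = CARD('d) + 1"
  define a where "a n = overlap_number TYPE('d) {..<n} (complete_edges D {..<n})" for n :: nat
  have a: "0 < a n" "a n \<le> 1" for n
    using overlap_number_greatest(1,2)[OF complete_edges_wf[of "{..<n}" "CARD('d)"], where D = "TYPE('d)"] by (auto simp: a_def D_def)
  show "0 \<le> overlap_number TYPE('d) {..<n} (complete_edges (CARD('d) + 1) {..<n})" for n :: nat
    using a(1)[of n] by (simp add: a_def D_def)
  fix \<epsilon> :: real assume \<epsilon>: "\<epsilon> > 0"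
  define \<alpha> where "\<alpha> n = real (n choose D) * fact D / real n ^ D" for n
  have "\<forall>\<^sub>F n in sequentially. \<alpha> n \<ge> 1 - \<epsilon> / 4"
    unfolding \<alpha>_def by (rule eventually_binomial_ratio_ge) (use \<epsilon> in simp)
  then obtain N0 where \<alpha>: "\<And>n. n \<ge> N0 \<Longrightarrow> \<alpha> n \<ge> 1 - \<epsilon> / 4"
    unfolding eventually_sequentially by blast
  show "\<exists>N::nat. \<forall>n\<ge>N. \<exists>M::nat. \<forall>m\<ge>M. overlap_number TYPE('d) {..<m} (complete_edges (CARD('d) + 1) {..<m})
    \<le> overlap_number TYPE('d) {..<n} (complete_edges (CARD('d) + 1) {..<n}) + \<epsilon>"
    unfolding D_def[symmetric] a_def[symmetric]
  proof (rule exI[of _ "max N0 1"], intro allI impI)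
    fix n assume n: "n \<ge> max N0 1"
    then have n0: "n > 0" by simp
    show "\<exists>M. \<forall>m\<ge>M. a m \<le> a n + \<epsilon>"
    proof (cases "a n + \<epsilon> / 4 \<le> 1")
      case False
      then have "a m \<le> a n + \<epsilon>" for m using a(2)[of m] \<epsilon> by linarith
      then show ?thesis by blast
    next
      case True
      \<comment> \<open>\<open>c\<close> lies strictly above the greatest admissible constant, so a
        configuration without overlap \<open>c\<close> exists.\<close>
      define c where "c = a n + \<epsilon> / 4"
      have c: "0 < c" "c \<le> 1" "a n < c" using a(1)[of n] \<epsilon> True by (auto simp: c_def)
      have no: "\<not> has_overlap TYPE('d) {..<n} (complete_edges D {..<n}) c"
        using overlap_number_greatest(4)[OF complete_edges_wf[of "{..<n}" "CARD('d)"], of c "TYPE('d)" "{..<n}"] c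
        by (auto simp: a_def D_def)
      have "(\<lambda>m. ((real m + real n) / (real m - real D)) ^ D) \<longlonglongrightarrow> 1" by real_asymp
      then have "\<forall>\<^sub>F m in sequentially. ((real m + real n) / (real m - real D)) ^ D < 1 + \<epsilon> / 4"
        by (rule order_tendstoD) (use \<epsilon> in simp)
      then obtain M0 where M0: "\<And>m. m \<ge> M0 \<Longrightarrow> ((real m + real n) / (real m - real D)) ^ D < 1 + \<epsilon> / 4"
        unfolding eventually_sequentially by blast
      have "a m \<le> a n + \<epsilon>" if m: "m \<ge> max M0 (D + 1)" for m
      proof -
        define t where "t = m div n + 1"
        \<comment> \<open>Up to lower-order terms, the share of edges of the blow-up that a point
          can meet: edges across \<open>D\<close> clusters have share \<open>\<alpha> n\<close>, and
          a fraction \<open>1 - c\<close> of them is missed.\<close>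
        define \<beta> where "\<beta> = 1 - (1 - c) * \<alpha> n"
        have mD: "D \<le> m" "real m - real D > 0" using m by auto
        have bu: "a m * real (m choose D) \<le> real (n * t choose D) - (1 - c) * (real t ^ D * real (n choose D))"
          using overlap_number_blow_up[OF n0 c(2), of m, where 'd = 'd] no by (simp add: a_def D_def t_def)
        have Cu: "real (n * t choose D) * fact D \<le> (real n * real t) ^ D"
          using of_nat_mono[OF binomial_fact_pow[of "n * t" D], where 'a = real] by simp
        have tn: "real t ^ D * real (n choose D) * fact D = \<alpha> n * (real n * real t) ^ D"
          using n0 by (simp add: \<alpha>_def power_mult_distrib)
        have tm: "real n * real t \<le> real m + real n"
        proof -
          have "n * (m div n) \<le> m" by simp
          then have "n * t \<le> m + n" by (simp add: t_def)
          then show ?thesis by (metis of_nat_add of_nat_le_iff of_nat_mult)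
        qed
        have Cl: "(real m - real D) ^ D \<le> real (m choose D) * fact D"
          using of_nat_mono[OF binomial_mult_fact_ge[OF mD(1)], where 'a = real] mD by (simp add: of_nat_diff)
        have \<alpha>1: "\<alpha> n \<le> 1"
          using of_nat_mono[OF binomial_fact_pow[of n D], where 'a = real] n0 by (simp add: \<alpha>_def)
        have "\<alpha> n \<ge> 0" by (simp add: \<alpha>_def)
        then have \<beta>0: "\<beta> \<ge> 0" unfolding \<beta>_def using c \<alpha>1 by (simp add: mult_le_one)
        have \<beta>1: "\<beta> \<le> c + \<epsilon> / 4"
        proof -
          have "(1 - c) * (1 - \<alpha> n) \<le> 1 * (1 - \<alpha> n)" using c \<alpha>1 by (intro mult_right_mono) auto
          then show ?thesis using \<alpha>[of n] n by (simp add: \<beta>_def algebra_simps)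
        qed
        have "a m * (real m - real D) ^ D \<le> a m * (real (m choose D) * fact D)"
          using Cl a(1)[of m] by (intro mult_left_mono) auto
        also have "\<dots> = (a m * real (m choose D)) * fact D" by simp
        also have "\<dots> \<le> (real (n * t choose D) - (1 - c) * (real t ^ D * real (n choose D))) * fact D"
          using bu by (rule mult_right_mono) simp
        also have "\<dots> = real (n * t choose D) * fact D - (1 - c) * (\<alpha> n * (real n * real t) ^ D)"
          unfolding tn[symmetric] by (simp add: algebra_simps)
        also have "\<dots> \<le> (real n * real t) ^ D - (1 - c) * (\<alpha> n * (real n * real t) ^ D)" using Cu by simp
        also have "\<dots> = \<beta> * (real n * real t) ^ D" by (simp add: \<beta>_def algebra_simps)
        also have "\<dots> \<le> \<beta> * (real m + real n) ^ D" using \<beta>0 tm by (intro mult_left_mono power_mono) auto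
        finally have "a m \<le> \<beta> * ((real m + real n) / (real m - real D)) ^ D"
          using mD by (simp add: power_divide field_simps)
        also have "\<dots> \<le> \<beta> * (1 + \<epsilon> / 4)" using M0[of m] m \<beta>0 by (intro mult_left_mono) auto
        finally have am: "a m \<le> \<beta> * (1 + \<epsilon> / 4)" .
        show ?thesis
        proof (cases "\<beta> \<le> 1")
          case True
          have "\<beta> * (1 + \<epsilon> / 4) \<le> \<beta> + \<epsilon> / 4" using True \<epsilon> \<beta>0 by (simp add: distrib_left mult_left_le_one_le)
          then show ?thesis using am \<beta>1 \<epsilon> unfolding c_def by linarith
        next
          case False
          then show ?thesis using a(2)[of m] \<beta>1 \<epsilon> by (simp add: c_def)
        qed
      qed
      then show ?thesis by blast
    qed
  qed
qed

section \<open>The theorem\<close>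

text \<open>Each edge around \<open>x\<close> has \<open>fact D\<close> orderings, and each of these
  tuples is either mixed or lies in a block contained entirely in the set of tuples around
  \<open>x\<close>.\<close>

lemma color_density_of_hull_blocks:
  fixes f :: "'v \<Rightarrow> real ^ 'd::finite" and c :: "'v \<Rightarrow> nat"
  assumes V: "finite V" "V \<noteq> {}"
    and mix: "real (card (mixed D V c (\<lambda>vs. x \<in> convex hull (f ` set vs)))) \<le> \<epsilon> * real (card V) ^ D"
    and ov: "a * real (card V choose D) \<le> real (card {e\<in>complete_edges D V. x \<in> convex hull (f ` e)})"
  shows "a * (real (card V choose D) * fact D / real (card V) ^ D) - \<epsilon> \<le>
     color_density D V c {p. \<forall>us\<in>tuples D V. map c us = p \<longrightarrow> x \<in> convex hull (f ` set us)}"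
proof -
  define F where "F vs \<longleftrightarrow> x \<in> convex hull (f ` set vs)" for vs
  \<comment> \<open>Patterns that no tuple attains belong to \<T> vacuously; they contribute nothing
    to the density.\<close>
  define \<T> where "\<T> = {p. \<forall>us\<in>tuples D V. map c us = p \<longrightarrow> F us}"
  define C where "C = {e\<in>complete_edges D V. x \<in> convex hull (f ` e)}"
  have finC: "finite C" using V by (simp add: C_def finite_complete_edges)
  have fin: "finite (tuples D V)" using V by (simp add: finite_tuples)
  have Ce: "finite e" "card e = D" "e \<subseteq> V" if "e \<in> C" for e
    using that V by (auto simp: C_def complete_edges_def intro: finite_subset)
  have "card C * fact D = (\<Sum>e\<in>C. card {b. length b = D \<and> distinct b \<and> set b = e})"
    using card_orderings[OF Ce(1,2)] by simp
  also have "\<dots> = card (\<Union>e\<in>C. {b. length b = D \<and> distinct b \<and> set b = e})"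
    using finC card_orderings[OF Ce(1,2)] by (intro card_UN_disjoint[symmetric]) (auto intro!: card_ge_0_finite)
  also have "\<dots> \<le> card {vs\<in>tuples D V. F vs}"
  proof (rule card_mono)
    show "finite {vs\<in>tuples D V. F vs}" using fin by simp
  qed (auto simp: tuples_def F_def C_def complete_edges_def)
  also have "\<dots> \<le> card ({vs\<in>tuples D V. map c vs \<in> \<T>} \<union> mixed D V c F)"
    using fin V by (intro card_mono) (auto simp: \<T>_def mixed_def finite_mixed)
  also have "\<dots> \<le> card {vs\<in>tuples D V. map c vs \<in> \<T>} + card (mixed D V c F)" by (rule card_Un_le)
  finally have "card C * fact D \<le> card {vs\<in>tuples D V. map c vs \<in> \<T>} + card (mixed D V c F)" .
  from of_nat_mono[OF this, where 'a = real]
  have "real (card C) * fact D \<le> real (card {vs\<in>tuples D V. map c vs \<in> \<T>}) + real (card (mixed D V c F))" by simp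
  moreover have "a * real (card V choose D) * fact D \<le> real (card C) * fact D"
    using ov unfolding C_def by (rule mult_right_mono) simp
  moreover have "real (card (mixed D V c F)) \<le> \<epsilon> * real (card V) ^ D" using mix by (simp add: F_def[abs_def])
  ultimately have "a * real (card V choose D) * fact D - \<epsilon> * real (card V) ^ D \<le> real (card {vs\<in>tuples D V. map c vs \<in> \<T>})"
    by linarith
  then have "(a * real (card V choose D) * fact D - \<epsilon> * real (card V) ^ D) / real (card V) ^ D \<le> color_density D V c \<T>"
    unfolding color_density_def by (rule divide_right_mono) simp
  then show ?thesis using V by (simp add: diff_divide_distrib \<T>_def F_def mult.assoc)
qed

theorem theorem1p8:
  fixes \<epsilon> :: real
  assumes "\<epsilon> > 0"
  shows "\<exists>r0 :: nat. \<forall>r \<ge> r0. \<exists>n0 :: nat. \<forall>n \<ge> n0. (CARD('d::finite) + 1) dvd n \<longrightarrow>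
    (\<exists>(V :: nat set) E. card V = n \<and> uniform_hypergraph (CARD('d) + 1) V E \<and>
       regular_hypergraph r V E \<and>
       overlap_number TYPE('d) V E \<ge> overlap_constant TYPE('d) - \<epsilon>)"
proof -
  define D where "D = CARD('d) + 1"
  have D: "D \<ge> 2" by (simp add: D_def Suc_leI)
  define l where "l = overlap_constant TYPE('d)"
  define a where "a n = overlap_number TYPE('d) {..<n} (complete_edges D {..<n})" for n :: nat
  have a: "0 < a n" "a n \<le> 1" "has_overlap TYPE('d) {..<n} (complete_edges D {..<n}) (a n)" for n
    using overlap_number_greatest(1-3)[OF complete_edges_wf[of "{..<n}" "CARD('d)"], where D = "TYPE('d)"] by (auto simp: a_def D_def)
  have lim: "a \<longlonglongrightarrow> l"
    using convergent_overlap_number_complete[where 'd = 'd]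
    by (simp add: convergent_LIMSEQ_iff l_def overlap_constant_def a_def[abs_def] D_def)
  \<comment> \<open>The four quarters pay for the convergence of \<open>a n\<close>, for passing
    from subsets to tuples, for mixed tuples, and for the deviation of the random edges.\<close>
  have e4: "\<epsilon> / 4 > 0" using assms by simp
  obtain K where K: "\<forall>(V :: nat set) (f :: nat \<Rightarrow> real ^ 'd) x. finite V \<longrightarrow> V \<noteq> {} \<longrightarrow>
     block_colorable K (\<epsilon> / 4) D V (\<lambda>vs. x \<in> convex hull (f ` set vs))"
    using convex_hull_colorable[OF e4, where 'v = nat and 'd = 'd] ..
  have "\<forall>\<^sub>F n in sequentially. a n > l - \<epsilon> / 4"
    by (rule order_tendstoD(1)[OF lim]) (use e4 in simp)
  moreover have "\<forall>\<^sub>F n in sequentially. real (n choose D) * fact D / real n ^ D \<ge> 1 - \<epsilon> / 4"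
    by (rule eventually_binomial_ratio_ge[OF e4])
  moreover have "\<forall>\<^sub>F n in sequentially. n \<ge> 1" by (rule eventually_ge_at_top)
  ultimately have "\<forall>\<^sub>F n in sequentially. a n > l - \<epsilon> / 4 \<and> real (n choose D) * fact D / real n ^ D \<ge> 1 - \<epsilon> / 4 \<and> n \<ge> 1"
    by eventually_elim simp
  then obtain n1 where n1: "\<And>n. n \<ge> n1 \<Longrightarrow> a n > l - \<epsilon> / 4 \<and> real (n choose D) * fact D / real n ^ D \<ge> 1 - \<epsilon> / 4 \<and> n \<ge> 1"
    unfolding eventually_sequentially by blast
  obtain r0 where r0: "\<forall>r\<ge>r0. \<exists>n0. \<forall>n\<ge>n0. D dvd n \<longrightarrow> (\<exists>L. quasirandom_regular K (\<epsilon> / 4) D r n L)"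
    using quasirandom_regular_exists[OF D e4, of K] ..
  show ?thesis unfolding D_def[symmetric] l_def[symmetric]
  proof (rule exI[of _ r0], intro allI impI)
    fix r assume r: "r0 \<le> r"
    obtain n0 where n0: "\<forall>n\<ge>n0. D dvd n \<longrightarrow> (\<exists>L. quasirandom_regular K (\<epsilon> / 4) D r n L)"
      using r0[rule_format, OF r] ..
    show "\<exists>n0. \<forall>n\<ge>n0. D dvd n \<longrightarrow> (\<exists>(V :: nat set) E. card V = n \<and> uniform_hypergraph D V E \<and>
       regular_hypergraph r V E \<and> overlap_number TYPE('d) V E \<ge> l - \<epsilon>)"
    proof (rule exI[of _ "max n0 n1"], intro allI impI)
      fix n assume n: "max n0 n1 \<le> n" and dvd: "D dvd n"
      define V where "V = {..<n}"
      have nn: "a n > l - \<epsilon> / 4" "real (n choose D) * fact D / real n ^ D \<ge> 1 - \<epsilon> / 4" "n \<ge> 1"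
        using n1[of n] n by auto
      have V: "finite V" "V \<noteq> {}" "card V = n" using nn(3) by (auto simp: V_def lessThan_empty_iff)
      from n0[THEN spec, THEN mp, THEN mp, OF _ dvd] n
      obtain L where L: "\<forall>b\<in>set L. length b = D \<and> distinct b \<and> set b \<subseteq> V" "distinct (map set L)"
        "\<forall>v<n. card {b\<in>set L. v \<in> set b} = r"
        "\<And>c \<T>. c ` V \<subseteq> {..<K} \<Longrightarrow> (color_density D V c \<T> - \<epsilon> / 4) * length L \<le> length (filter (\<lambda>b. map c b \<in> \<T>) L)"
        unfolding V_def quasirandom_regular_def by auto
      define E where "E = set ` set L"
      have injL: "inj_on set (set L)" using L(2) by (simp add: distinct_map)
      have dL: "distinct L" using L(2) by (simp add: distinct_map)
      have cE: "card E = length L" unfolding E_def using injL dL by (simp add: card_image distinct_card)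
      have finE: "finite E" by (simp add: E_def)
      have cardE: "card e = D" "e \<subseteq> V" if "e \<in> E" for e using that L(1) by (auto simp: E_def distinct_card)
      then have neE: "{} \<notin> E" using D by fastforce
      have uni: "uniform_hypergraph D V E" using V(1) cardE by (auto simp: uniform_hypergraph_def)
      have reg: "regular_hypergraph r V E"
        unfolding regular_hypergraph_def
      proof
        fix v assume v: "v \<in> V"
        have "{e\<in>E. v \<in> e} = set ` {b\<in>set L. v \<in> set b}" by (auto simp: E_def)
        also have "card \<dots> = card {b\<in>set L. v \<in> set b}"
          by (intro card_image inj_on_subset[OF injL]) auto
        finally show "card {e\<in>E. v \<in> e} = r" using L(3) v by (simp add: V_def)
      qed
      have "has_overlap TYPE('d) V E (l - \<epsilon>)"
        unfolding has_overlap_def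
      proof (intro allI impI)
        fix f :: "nat \<Rightarrow> real ^ 'd" assume f: "inj_on f V"
        obtain x where x: "a n * real (card (complete_edges D V)) \<le> real (card {e\<in>complete_edges D V. x \<in> convex hull (f ` e)})"
          using a(3)[of n] f unfolding has_overlap_def V_def by auto
        \<comment> \<open>The colouring is adapted to \<open>f\<close> and \<open>x\<close> although
          \<open>L\<close> is already fixed; \<open>L(4)\<close> covers all colourings with
          \<open>K\<close> colours.\<close>
        have "block_colorable K (\<epsilon> / 4) D V (\<lambda>vs. x \<in> convex hull (f ` set vs))" using K V by blast
        then obtain c :: "nat \<Rightarrow> nat" where c: "c ` V \<subseteq> {..<K}"
          "real (card (mixed D V c (\<lambda>vs. x \<in> convex hull (f ` set vs)))) \<le> \<epsilon> / 4 * real (card V) ^ D"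
          unfolding block_colorable_def by blast
        define \<T> where "\<T> = {p. \<forall>us\<in>tuples D V. map c us = p \<longrightarrow> x \<in> convex hull (f ` set us)}"
        define \<alpha> where "\<alpha> = real (n choose D) * fact D / real n ^ D"
        have "a n * \<alpha> - \<epsilon> / 4 \<le> color_density D V c \<T>"
          using color_density_of_hull_blocks[OF V(1,2) c(2), of "a n"] x V
          by (simp add: card_complete_edges \<T>_def \<alpha>_def)
        moreover have "a n - \<epsilon> / 4 \<le> a n * \<alpha>"
        proof -
          have "a n * (1 - \<epsilon> / 4) \<le> a n * \<alpha>" using nn(2) a(1)[of n] by (intro mult_left_mono) (auto simp: \<alpha>_def)
          moreover have "a n * (\<epsilon> / 4) \<le> 1 * (\<epsilon> / 4)" using a(2)[of n] e4 by (intro mult_right_mono) auto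
          ultimately show ?thesis by (simp add: algebra_simps)
        qed
        ultimately have "l - \<epsilon> \<le> color_density D V c \<T> - \<epsilon> / 4" using nn(1) by linarith
        then have "(l - \<epsilon>) * real (length L) \<le> (color_density D V c \<T> - \<epsilon> / 4) * real (length L)"
          by (rule mult_right_mono) simp
        also have "\<dots> \<le> length (filter (\<lambda>b. map c b \<in> \<T>) L)" by (rule L(4)[OF c(1)])
        also have "\<dots> \<le> card {e\<in>E. x \<in> convex hull (f ` e)}"
        proof -
          have "length (filter (\<lambda>b. map c b \<in> \<T>) L) = card (set (filter (\<lambda>b. map c b \<in> \<T>) L))"
            using dL by (simp add: distinct_card distinct_filter del: set_filter)
          also have "\<dots> = card (set ` set (filter (\<lambda>b. map c b \<in> \<T>) L))"
            by (intro card_image[symmetric] inj_on_subset[OF injL]) auto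
          also have "\<dots> \<le> card {e\<in>E. x \<in> convex hull (f ` e)}"
            using finE L(1) by (intro card_mono) (auto simp: E_def \<T>_def tuples_def)
          finally show ?thesis by simp
        qed
        finally show "\<exists>x. (l - \<epsilon>) * real (card E) \<le> real (card {e\<in>E. x \<in> convex hull (f ` e)})"
          using cE by auto
      qed
      moreover have "l - \<epsilon> \<le> 1" using nn(1) a(2)[of n] assms by linarith
      \<comment> \<open>If \<open>l - \<epsilon>\<close> is not positive it is no candidate in the
        definition, but then positivity of the overlap number suffices.\<close>
      ultimately have "l - \<epsilon> \<le> overlap_number TYPE('d) V E"
        using overlap_number_greatest[OF finE neE, where V = V and D = "TYPE('d)"] by (cases "l - \<epsilon> > 0") auto
      then show "\<exists>(V :: nat set) E. card V = n \<and> uniform_hypergraph D V E \<and>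
       regular_hypergraph r V E \<and> overlap_number TYPE('d) V E \<ge> l - \<epsilon>"
        using V(3) uni reg by blast
    qed
  qed
qed

end
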